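(* Let $V$ be a braided vector space of super type $A_\theta$ with parameter $q$ of order $N\ge3$, and let $U^+(V)$ be its distinguished pre-Nichols algebra with root vectors $E_{j,k}$, $1\le j\le k\le\theta$. Let $1\le j\le k\le\theta$ be such that $\alpha_{j,k}\in\mathcal O(V)$. Then $$\underline\Delta(E_{j,k}^N)=E_{j,k}^N\otimes1+1\otimes E_{j,k}^N+\sum_{\ell:\ j\le\ell<k,\ \alpha_{j,\ell}\in\mathcal O(V)}(1-\widetilde{q_{\ell,\ell+1}})^N\,\chi(\alpha_{j,\ell},\alpha_{\ell+1,k})^{\frac{N(N-1)}2}\,E_{j,\ell}^N\otimes E_{\ell+1,k}^N.$$
   Context: $\mathbf k$ is an algebraically closed field of characteristic $0$, $\theta\ge2$, $q\in\mathbf k$ is a root of unity of order $N\ge3$, and $1\le i_1<\dots<i_r\le\theta$ is a set of "odd" indices. The braiding of super type $A_\theta$ attached to these data is a matrix $(q_{ij})_{1\le i,j\le\theta}$ in $\mathbf k^\times$ such that, writing $\widetilde{q_{ij}}=q_{ij}q_{ji}$ for $i\ne j$: $\widetilde{q_{ij}}=1$ if $|i-j|>1$; if $i\in\{i_1,\dots,i_r\}$ then $q_{ii}=-1$ and $\widetilde{q_{i-1,i}}\,\widetilde{q_{i,i+1}}=1$; if $i\notin\{i_1,\dots,i_r\}$ then $q_{ii}\widetilde{q_{i-1,i}}=q_{ii}\widetilde{q_{i,i+1}}=1$ (conditions involving the indices $0$ or $\theta+1$ are dropped); and $q=q_{11}^2\,\widetilde{q_{12}}$. $(\alpha_i)$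 is the canonical basis of $\mathbb Z^\theta$, $\chi:\mathbb Z^\theta\times\mathbb Z^\theta\to\mathbf k^\times$ the bicharacter with $\chi(\alpha_i,\alpha_j)=q_{ij}$, and $\alpha_{j,k}=\alpha_j+\alpha_{j+1}+\dots+\alpha_k$ ($1\le j\le k\le\theta$) are the positive roots. The parity is the group map $\mathbb Z^\theta\to\mathbb Z/2$ with $|\alpha_i|=1$ if $i\in\{i_1,\dots,i_r\}$ and $0$ otherwise; $\mathcal O(V)$ is the set of positive roots $\alpha_{j,k}$ of even parity. For homogeneous $x,y$ of degrees $\beta,\gamma\in\mathbb Z^\theta$ put $[x,y]_c=xy-\chi(\beta,\gamma)yx$ and $(\mathrm{ad}_cE_i)y=[E_i,y]_c$. The distinguished pre-Nichols algebra $U^+(V)$ is the $\mathbb Z^\theta$-graded algebra ($\deg E_i=\alpha_i$) presented by generators $E_1,\dots,E_\theta$ and relations: $E_iE_j=q_{ij}E_jE_i$ for $j-i\ge2$; $E_i^2=0$ and $[(\mathrm{ad}_cE_{i-1})(\mathrm{ad}_cE_i)E_{i+1},E_i]_c=0$ for $i\in\{i_1,\dots,i_r\}$ (the latter for $1<i<\theta$); $(\mathrm{ad}_cE_i)^2E_{i\pm1}=0$ for $i\notin\{i_1,\dots,i_r\}$. It is a braided Hopf algebra: $\underline\Delta:U^+(V)\to U^+(V)\otimes U^+(V)$ is the algebra map with $\underline\Delta(E_i)=E_i\otimes1+1\otimes E_i$, where the target has product $(x\otimes y)(x'\otimes y')=\chi(\deg y,\deg x')\,xx'\otimes yy'$.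 Finally $E_{j,k}=(\mathrm{ad}_cE_j)\cdots(\mathrm{ad}_cE_{k-1})E_k$ (so $E_{j,j}=E_j$).
   Formalization: The arguments of χ in the coefficient are swapped, to χ(α_{ℓ+1,k}, α_{j,ℓ})^{N(N-1)/2}: with the stated product on U⊗U the printed formula fails, e.g. for E_{1,2} with 1, 2 even, N=3, q_{12}=t, q_{21}=1/(qt), t^6≠1. *)

theory Defs
  imports
    "HOL-Library.Poly_Mapping"
    "HOL-Computational_Algebra.Polynomial"
    "HOL-Algebra.QuotRing"
    "HOL-Algebra.Module"
    "HOL-Algebra.Generated_Groups"
begin

section \<open>Braidings of super type \<open>A\<close>\<close>

definition qtilde :: "(nat \<Rightarrow> nat \<Rightarrow> 'k::field) \<Rightarrow> nat \<Rightarrow> nat \<Rightarrow> 'k" where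
  "qtilde Q i j = Q i j * Q j i"

definition is_root_of_unity_of_order :: "'k::field \<Rightarrow> nat \<Rightarrow> bool" where
  "is_root_of_unity_of_order q N \<longleftrightarrow> N > 0 \<and> q ^ N = 1 \<and> (\<forall>m. 0 < m \<and> m < N \<longrightarrow> q ^ m \<noteq> 1)"

text \<open>\<open>S\<close> is the set of odd indices. Only the entries of \<open>Q\<close> with indices in \<open>{1..\<theta>}\<close> are meaningful.\<close>

definition super_type_A :: "nat \<Rightarrow> nat set \<Rightarrow> 'k::field \<Rightarrow> (nat \<Rightarrow> nat \<Rightarrow> 'k) \<Rightarrow> bool" where
  "super_type_A \<theta> S q Q \<longleftrightarrow>
     S \<subseteq> {1..\<theta>} \<and>
     (\<forall>i\<in>{1..\<theta>}. \<forall>j\<in>{1..\<theta>}. Q i j \<noteq> 0) \<and>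
     (\<forall>i\<in>{1..\<theta>}. \<forall>j\<in>{1..\<theta>}. i + 1 < j \<or> j + 1 < i \<longrightarrow> qtilde Q i j = 1) \<and>
     (\<forall>i\<in>S. Q i i = -1 \<and>
        (1 < i \<and> i < \<theta> \<longrightarrow> qtilde Q (i - 1) i * qtilde Q i (i + 1) = 1)) \<and>
     (\<forall>i\<in>{1..\<theta>} - S.
        (1 < i \<longrightarrow> Q i i * qtilde Q (i - 1) i = 1) \<and>
        (i < \<theta> \<longrightarrow> Q i i * qtilde Q i (i + 1) = 1)) \<and>
     q = (Q 1 1)\<^sup>2 * qtilde Q 1 2"

section \<open>Root lattice\<close>

text \<open>Elements of the lattice \<open>\<int>\<^sup>\<theta>\<close> are finitely supported integer vectors (with support
  in \<open>{1..\<theta>}\<close>).\<close>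

definition simple_root :: "nat \<Rightarrow> (nat \<Rightarrow>\<^sub>0 int)" where
  "simple_root i = Poly_Mapping.single i 1"

definition pos_root :: "nat \<Rightarrow> nat \<Rightarrow> (nat \<Rightarrow>\<^sub>0 int)" where
  "pos_root j k = (\<Sum>i=j..k. simple_root i)"

text \<open>The bicharacter with values \<open>Q i j\<close> on pairs of simple roots.\<close>

definition chi :: "(nat \<Rightarrow> nat \<Rightarrow> 'k::field) \<Rightarrow> (nat \<Rightarrow>\<^sub>0 int) \<Rightarrow> (nat \<Rightarrow>\<^sub>0 int) \<Rightarrow> 'k" where
  "chi Q \<beta> \<gamma> = (\<Prod>i\<in>Poly_Mapping.keys \<beta>. \<Prod>j\<in>Poly_Mapping.keys \<gamma>.
      Q i j powi (Poly_Mapping.lookup \<beta> i * Poly_Mapping.lookup \<gamma> j))"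

lemma chi_simple_root: "chi Q (simple_root i) (simple_root j) = Q i j"
  by (simp add: chi_def simple_root_def)

text \<open>The parity, with \<open>\<int>/2\<close> represented by \<open>{0, 1}\<close>.\<close>

definition parity :: "nat set \<Rightarrow> (nat \<Rightarrow>\<^sub>0 int) \<Rightarrow> int" where
  "parity S \<beta> = (\<Sum>i\<in>S. Poly_Mapping.lookup \<beta> i) mod 2"

definition even_roots :: "nat \<Rightarrow> nat set \<Rightarrow> (nat \<Rightarrow>\<^sub>0 int) set" where
  "even_roots \<theta> S = {pos_root j k | j k. 1 \<le> j \<and> j \<le> k \<and> k \<le> \<theta> \<and> parity S (pos_root j k) = 0}"

section \<open>The free algebra and its braided tensor square\<close>

text \<open>Words under concatenation form a monoid; with this instance, the type
  \<open>nat list \<Rightarrow>\<^sub>0 'k\<close> with its convolution product is the free associative \<open>'k\<close>-algebra.\<close>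

instantiation list :: (type) monoid_add
begin
definition zero_list :: "'a list" where "zero_list = []"
definition plus_list :: "'a list \<Rightarrow> 'a list \<Rightarrow> 'a list" where "plus_list = (@)"
instance by standard (simp_all add: zero_list_def plus_list_def)
end

definition scale :: "'k::field \<Rightarrow> ('a \<Rightarrow>\<^sub>0 'k) \<Rightarrow> ('a \<Rightarrow>\<^sub>0 'k)" where
  "scale c = Poly_Mapping.map ((*) c)"

definition linear_ext :: "('a \<Rightarrow> ('c \<Rightarrow>\<^sub>0 'k)) \<Rightarrow> ('a \<Rightarrow>\<^sub>0 'k::field) \<Rightarrow> ('c \<Rightarrow>\<^sub>0 'k)" where
  "linear_ext f x = (\<Sum>u\<in>Poly_Mapping.keys x. scale (Poly_Mapping.lookup x u) (f u))"

definition bilinear_ext ::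
    "('a \<Rightarrow> 'b \<Rightarrow> ('c \<Rightarrow>\<^sub>0 'k)) \<Rightarrow> ('a \<Rightarrow>\<^sub>0 'k::field) \<Rightarrow> ('b \<Rightarrow>\<^sub>0 'k) \<Rightarrow> ('c \<Rightarrow>\<^sub>0 'k)" where
  "bilinear_ext f x y = linear_ext (\<lambda>u. linear_ext (f u) y) x"

definition wdeg :: "nat list \<Rightarrow> (nat \<Rightarrow>\<^sub>0 int)" where
  "wdeg w = (\<Sum>i\<leftarrow>w. simple_root i)"

definition free_alg :: "nat \<Rightarrow> ('k::field, nat list \<Rightarrow>\<^sub>0 'k) module" where
  "free_alg \<theta> = \<lparr>carrier = {x. Poly_Mapping.keys x \<subseteq> lists {1..\<theta>}},
     mult = (*), one = 1, zero = 0, add = (+), smult = scale\<rparr>"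

definition gen :: "nat \<Rightarrow> (nat list \<Rightarrow>\<^sub>0 'k::field)" where
  "gen i = Poly_Mapping.single [i] 1"

text \<open>The tensor square of the free algebra has the pairs \<open>(u, v)\<close>, standing for \<open>u \<otimes> v\<close>,
  of words as a basis. The product is \<open>(x \<otimes> y)(x' \<otimes> y') = \<chi>(deg y, deg x') xx' \<otimes> yy'\<close>; in
  particular the \<open>N\<close>-th power of \<open>x \<otimes> y\<close> is \<open>\<chi>(deg y, deg x)\<close> to the power \<open>N(N - 1)/2\<close>
  times the tensor product of the \<open>N\<close>-th powers, with the degree of the right factor first
  in \<open>\<chi>\<close>.\<close>

definition braided_mult :: "(nat \<Rightarrow> nat \<Rightarrow> 'k::field) \<Rightarrow>
    (nat list \<times> nat list \<Rightarrow>\<^sub>0 'k) \<Rightarrow> (nat list \<times> nat list \<Rightarrow>\<^sub>0 'k) \<Rightarrow> (nat list \<times> nat list \<Rightarrow>\<^sub>0 'k)" where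
  "braided_mult Q = bilinear_ext
     (\<lambda>(u, v) (u', v'). Poly_Mapping.single (u @ u', v @ v') (chi Q (wdeg v) (wdeg u')))"

definition free_sq ::
    "nat \<Rightarrow> (nat \<Rightarrow> nat \<Rightarrow> 'k::field) \<Rightarrow> ('k, nat list \<times> nat list \<Rightarrow>\<^sub>0 'k) module" where
  "free_sq \<theta> Q = \<lparr>carrier = {x. Poly_Mapping.keys x \<subseteq> lists {1..\<theta>} \<times> lists {1..\<theta>}},
     mult = braided_mult Q, one = Poly_Mapping.single ([], []) 1, zero = 0, add = (+), smult = scale\<rparr>"

definition free_tensor ::
    "(nat list \<Rightarrow>\<^sub>0 'k::field) \<Rightarrow> (nat list \<Rightarrow>\<^sub>0 'k) \<Rightarrow> (nat list \<times> nat list \<Rightarrow>\<^sub>0 'k)" where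
  "free_tensor = bilinear_ext (\<lambda>u v. Poly_Mapping.single (u, v) 1)"

text \<open>The algebra map from the free algebra to its braided tensor square that sends each
  generator \<open>E\<^sub>i\<close> to \<open>E\<^sub>i \<otimes> 1 + 1 \<otimes> E\<^sub>i\<close>.\<close>

definition free_coproduct ::
    "(nat \<Rightarrow> nat \<Rightarrow> 'k::field) \<Rightarrow> (nat list \<Rightarrow>\<^sub>0 'k) \<Rightarrow> (nat list \<times> nat list \<Rightarrow>\<^sub>0 'k)" where
  "free_coproduct Q = linear_ext (\<lambda>w.
     foldr (\<lambda>i y. braided_mult Q (free_tensor (gen i) 1 + free_tensor 1 (gen i)) y) w
       (Poly_Mapping.single ([], []) 1))"

section \<open>The distinguished pre-Nichols algebra\<close>

text \<open>Words are homogeneous, so the bilinear extension below is \<open>xy - \<chi>(\<beta>, \<gamma>)yx\<close>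
  whenever \<open>x\<close> and \<open>y\<close> are homogeneous of degrees \<open>\<beta>\<close> and \<open>\<gamma>\<close>.\<close>

definition cbracket :: "(nat \<Rightarrow> nat \<Rightarrow> 'k::field) \<Rightarrow>
    (nat list \<Rightarrow>\<^sub>0 'k) \<Rightarrow> (nat list \<Rightarrow>\<^sub>0 'k) \<Rightarrow> (nat list \<Rightarrow>\<^sub>0 'k)" where
  "cbracket Q = bilinear_ext (\<lambda>u v.
     Poly_Mapping.single (u @ v) 1 - Poly_Mapping.single (v @ u) (chi Q (wdeg u) (wdeg v)))"

abbreviation ad_c :: "(nat \<Rightarrow> nat \<Rightarrow> 'k::field) \<Rightarrow> nat \<Rightarrow> (nat list \<Rightarrow>\<^sub>0 'k) \<Rightarrow> (nat list \<Rightarrow>\<^sub>0 'k)" where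
  "ad_c Q i \<equiv> cbracket Q (gen i)"

definition relators :: "nat \<Rightarrow> nat set \<Rightarrow> (nat \<Rightarrow> nat \<Rightarrow> 'k::field) \<Rightarrow> (nat list \<Rightarrow>\<^sub>0 'k) set" where
  "relators \<theta> S Q =
     {gen i * gen j - scale (Q i j) (gen j * gen i) | i j. 1 \<le> i \<and> i + 2 \<le> j \<and> j \<le> \<theta>} \<union>
     {(gen i)\<^sup>2 | i. i \<in> S} \<union>
     {cbracket Q (ad_c Q (i - 1) (ad_c Q i (gen (i + 1)))) (gen i) | i. i \<in> S \<and> 1 < i \<and> i < \<theta>} \<union>
     {ad_c Q i (ad_c Q i (gen (i - 1))) | i. i \<in> {1..\<theta>} - S \<and> 1 < i} \<union>
     {ad_c Q i (ad_c Q i (gen (i + 1))) | i. i \<in> {1..\<theta>} - S \<and> i < \<theta>}"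

definition rel_ideal :: "nat \<Rightarrow> nat set \<Rightarrow> (nat \<Rightarrow> nat \<Rightarrow> 'k::field) \<Rightarrow> (nat list \<Rightarrow>\<^sub>0 'k) set" where
  "rel_ideal \<theta> S Q = Idl\<^bsub>free_alg \<theta>\<^esub> (relators \<theta> S Q)"

text \<open>A map out of a quotient, given on representatives.\<close>

definition induced :: "('a \<Rightarrow> 'b) \<Rightarrow> 'a set \<Rightarrow> 'b" where
  "induced f X = the_elem (f ` X)"

text \<open>The ring \<open>A Quot I\<close>, with the scalar multiplication inherited from \<open>A\<close>.\<close>

definition alg_quot :: "('k, 'a) module \<Rightarrow> 'a set \<Rightarrow> ('k, 'a set) module" where
  "alg_quot A I = \<lparr>carrier = carrier (A Quot I), mult = monoid.mult (A Quot I),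
     one = monoid.one (A Quot I), zero = ring.zero (A Quot I), add = ring.add (A Quot I),
     smult = (\<lambda>c. induced (\<lambda>x. I +>\<^bsub>A\<^esub> (c \<odot>\<^bsub>A\<^esub> x)))\<rparr>"

definition preNichols :: "nat \<Rightarrow> nat set \<Rightarrow> (nat \<Rightarrow> nat \<Rightarrow> 'k::field) \<Rightarrow> ('k, (nat list \<Rightarrow>\<^sub>0 'k) set) module"
  where "preNichols \<theta> S Q = alg_quot (free_alg \<theta>) (rel_ideal \<theta> S Q)"

definition root_vector ::
    "nat \<Rightarrow> nat set \<Rightarrow> (nat \<Rightarrow> nat \<Rightarrow> 'k::field) \<Rightarrow> nat \<Rightarrow> nat \<Rightarrow> (nat list \<Rightarrow>\<^sub>0 'k) set" where
  "root_vector \<theta> S Q j k =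
     rel_ideal \<theta> S Q +>\<^bsub>free_alg \<theta>\<^esub> (foldr (ad_c Q) [j..<k] (gen k))"

text \<open>With \<open>F\<close> the free algebra, \<open>I\<close> the ideal of relations and \<open>U = F/I\<close>, the space
  \<open>U \<otimes> U\<close> is \<open>F \<otimes> F\<close> modulo the kernel \<open>I \<otimes> F + F \<otimes> I\<close> of the canonical surjection. The ideal
  \<open>I\<close> is graded, so this kernel is an ideal for the braided product.\<close>

definition sq_ideal ::
    "nat \<Rightarrow> nat set \<Rightarrow> (nat \<Rightarrow> nat \<Rightarrow> 'k::field) \<Rightarrow> (nat list \<times> nat list \<Rightarrow>\<^sub>0 'k) set" where
  "sq_ideal \<theta> S Q = generate (add_monoid (free_sq \<theta> Q))
     ({free_tensor x y | x y. x \<in> rel_ideal \<theta> S Q \<and> y \<in> carrier (free_alg \<theta>)} \<union>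
      {free_tensor x y | x y. x \<in> carrier (free_alg \<theta>) \<and> y \<in> rel_ideal \<theta> S Q})"

definition preNichols_sq ::
    "nat \<Rightarrow> nat set \<Rightarrow> (nat \<Rightarrow> nat \<Rightarrow> 'k::field) \<Rightarrow> ('k, (nat list \<times> nat list \<Rightarrow>\<^sub>0 'k) set) module" where
  "preNichols_sq \<theta> S Q = alg_quot (free_sq \<theta> Q) (sq_ideal \<theta> S Q)"

definition tensor :: "nat \<Rightarrow> nat set \<Rightarrow> (nat \<Rightarrow> nat \<Rightarrow> 'k::field) \<Rightarrow>
    (nat list \<Rightarrow>\<^sub>0 'k) set \<Rightarrow> (nat list \<Rightarrow>\<^sub>0 'k) set \<Rightarrow> (nat list \<times> nat list \<Rightarrow>\<^sub>0 'k) set" where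
  "tensor \<theta> S Q X Y =
     induced (\<lambda>(x, y). sq_ideal \<theta> S Q +>\<^bsub>free_sq \<theta> Q\<^esub> free_tensor x y) (X \<times> Y)"

definition coproduct :: "nat \<Rightarrow> nat set \<Rightarrow> (nat \<Rightarrow> nat \<Rightarrow> 'k::field) \<Rightarrow>
    (nat list \<Rightarrow>\<^sub>0 'k) set \<Rightarrow> (nat list \<times> nat list \<Rightarrow>\<^sub>0 'k) set" where
  "coproduct \<theta> S Q = induced (\<lambda>x. sq_ideal \<theta> S Q +>\<^bsub>free_sq \<theta> Q\<^esub> free_coproduct Q x)"

end

(*
  Write E' = E_{j,k} and beta = alpha_{j,k}. In U (x) U one has
    Delta(E') = E' (x) 1 + 1 (x) E' + sum_l (1 - qtilde_{l,l+1}) E_{j,l} (x) E_{l+1,k},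
  and because [E_{j,l}, E_{j,m}]_c = 0 and [E_{l,k}, E_{m,k}]_c = 0 for l < m, the summands
  x_l commute up to one and the same scalar: x_l x_m = chi(beta, beta) x_m x_l for l < m. For an
  even root chi(beta, beta) is q or 1/q, hence of order N, and the Gauss binomial theorem gives
  Delta(E')^N = sum_l x_l^N. A summand with alpha_{j,l} odd dies because E_{j,l}^2 = 0: writing
  v = E_{j,l} = [x, y]_c with x = E_j and y = E_{j+1,l}, the commutation rules of v with x and y
  give v^2 = (chi(y,y) / chi(x,x)) v^2, where one of the two factors is -1 and the other is q or 1/q.

  All of this takes place in an algebra with two families a_i, b_i that satisfy the relations of U
  and b_i a_j = q_{ij} a_j b_i. The family a_i + b_i then satisfies the relations as well, which is
  the well-definedness of Delta on U. The algebra used is a representation of U (x) U by linear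
  endomorphisms, so that computations in the quotient become equations in a type of class ring_1.
*)
theory Submission
  imports Defs "HOL-Library.Multiset"
begin

text \<open>Two cancellations depend on q^2 \<noteq> 1. Commuting E_{j,k} with an even inner E_i,
  and squaring an odd root vector, each ends in an equation multiplied by 1 + t or its negative,
  where t is q or 1/q. At an odd inner index the first argument breaks down, since 1 + q_ii = 0
  there; this is why [[E_{i-1}, [E_i, E_{i+1}]], E_i] = 0 has to be a relation of its own. That
  chi(beta, beta) is q or 1/q for every even root rests on one pattern along the diagram: q~_{i,i+1}
  is q or 1/q, it switches exactly at the odd vertices, and q = q_11^2 q~_{12} fixes which value
  comes first. The expansion of the root vector of a + b uses the relations of a and those of b, but
  not those of a + b. It may therefore serve to prove the relation of a + b at an odd vertex without
  circularity.\<close>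

section \<open>Gauss binomials and scaled rings\<close>

text \<open>The bicharacter of the degrees of two words, read off letter by letter. A root
  alpha_{j,k} is represented by the word \<open>[j..<Suc k]\<close>, so that splitting a root is
  splitting a list and bimultiplicativity becomes a simplification rule; \<open>chi_wdeg\<close>
  leads back to \<open>chi\<close>.\<close>

definition word_chi :: "(nat \<Rightarrow> nat \<Rightarrow> 'k::field) \<Rightarrow> nat list \<Rightarrow> nat list \<Rightarrow> 'k" where
  "word_chi Q u v = (\<Prod>i\<leftarrow>u. \<Prod>j\<leftarrow>v. Q i j)"

lemma word_chi_simps [simp]:
  fixes Q :: "nat \<Rightarrow> nat \<Rightarrow> 'k::field"
  shows "word_chi Q [] v = 1" "word_chi Q u [] = 1"
  "word_chi Q (u @ u') v = word_chi Q u v * word_chi Q u' v"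
  "word_chi Q u (v @ v') = word_chi Q u v * word_chi Q u v'"
  "word_chi Q [i] [j] = Q i j"
  "u \<noteq> [] \<Longrightarrow> word_chi Q (i # u) v = word_chi Q [i] v * word_chi Q u v"
  "v \<noteq> [] \<Longrightarrow> word_chi Q u (j # v) = word_chi Q u [j] * word_chi Q u v"
proof -
  have *: "(\<Prod>i\<leftarrow>u. f i * g i) = (\<Prod>i\<leftarrow>u. f i) * (\<Prod>i\<leftarrow>u. g i)" for f g :: "nat \<Rightarrow> 'k" and u :: "nat list"
    by (induction u) (simp_all add: ac_simps)
  have 1: "(\<Prod>i\<leftarrow>u. (1::'k)) = 1" for u :: "nat list"
    by (induction u) simp_all
  show "word_chi Q [] v = 1" "word_chi Q u [] = 1"
    "word_chi Q (u @ u') v = word_chi Q u v * word_chi Q u' v"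
    "word_chi Q u (v @ v') = word_chi Q u v * word_chi Q u v'"
    "word_chi Q [i] [j] = Q i j"
    "word_chi Q (i # u) v = word_chi Q [i] v * word_chi Q u v"
    "word_chi Q u (j # v) = word_chi Q u [j] * word_chi Q u v"
    by (simp_all add: word_chi_def * 1)
qed

lemma word_chi_nonzero:
  assumes "\<And>i j. i \<in> set u \<Longrightarrow> j \<in> set v \<Longrightarrow> Q i j \<noteq> 0"
  shows "word_chi Q u v \<noteq> 0"
  using assms by (auto simp: word_chi_def prod_list_zero_iff)

lemma word_chi_commute_far:
  assumes "\<And>i j. i \<in> set u \<Longrightarrow> j \<in> set v \<Longrightarrow> qtilde Q i j = 1"
  shows "word_chi Q u v * word_chi Q v u = 1"
  using assms
proof (induction u)
  case (Cons i u)
  have *: "word_chi Q [i] v * word_chi Q v [i] = 1"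
    using Cons.prems
  proof (induction v)
    case (Cons j v)
    have "word_chi Q [i] ([j] @ v) * word_chi Q ([j] @ v) [i]
        = (Q i j * Q j i) * (word_chi Q [i] v * word_chi Q v [i])"
      by (simp only: word_chi_simps) (simp add: ac_simps)
    also have "\<dots> = 1" using Cons.IH Cons.prems by (simp add: qtilde_def)
    finally show ?case by simp
  qed simp
  have "word_chi Q ([i] @ u) v * word_chi Q v ([i] @ u)
      = (word_chi Q [i] v * word_chi Q v [i]) * (word_chi Q u v * word_chi Q v u)"
    by (simp only: word_chi_simps) (simp add: ac_simps)
  also have "\<dots> = 1" using * Cons.IH Cons.prems by simp
  finally show ?case by simp
qed simp

section \<open>Gauss binomial coefficients and their vanishing at roots of unity\<close>

fun gauss_binomial :: "'k::comm_ring_1 \<Rightarrow> nat \<Rightarrow> nat \<Rightarrow> 'k" where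
  "gauss_binomial p n 0 = 1"
| "gauss_binomial p 0 (Suc i) = 0"
| "gauss_binomial p (Suc n) (Suc i) = gauss_binomial p n i + p ^ Suc i * gauss_binomial p n (Suc i)"

lemma gauss_binomial_eq_0: "n < i \<Longrightarrow> gauss_binomial p n i = 0"
  by (induction p n i rule: gauss_binomial.induct) auto

lemma gauss_binomial_self [simp]: "gauss_binomial p n n = 1"
  by (induction n) (auto simp: gauss_binomial_eq_0)

text \<open>With \<open>f m\<close> = (1 - p)(1 - p^2)...(1 - p^m) this is the product formula for
  Gauss binomials with denominators cleared, hence meaningful also where some \<open>f m\<close>
  vanishes.\<close>

lemma gauss_binomial_factorial:
  fixes p :: "'k::comm_ring_1"
  defines "f \<equiv> \<lambda>m. \<Prod>r=1..m. 1 - p ^ r"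
  shows "gauss_binomial p (a + b) a * f a * f b = f (a + b)"
proof (induction "a + b" arbitrary: a b)
  case (Suc n)
  have fS: "f (Suc m) = f m * (1 - p ^ Suc m)" for m
    by (simp add: f_def)
  have f0: "f 0 = 1" by (simp add: f_def)
  consider "a = 0" | "b = 0" | a' b' where "a = Suc a'" "b = Suc b'"
    by (metis not0_implies_Suc)
  then show ?case
  proof cases
    case 3
    have n: "n = a' + b" "n = a + b'" using Suc.hyps 3 by auto
    have "gauss_binomial p (a + b) a * f a * f b
      = (gauss_binomial p (a' + b) a' * f a' * f b) * (1 - p ^ a)
        + p ^ a * (gauss_binomial p (a + b') a * f a * f b') * (1 - p ^ b)"
      by (simp add: 3 fS algebra_simps)
    also have "\<dots> = f n * (1 - p ^ a) + p ^ a * f n * (1 - p ^ b)"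
      using Suc.hyps(1)[OF n(1)] Suc.hyps(1)[OF n(2)] n by simp
    also have "\<dots> = f n * (1 - p ^ (a + b))"
      by (simp add: algebra_simps power_add)
    finally show ?thesis by (simp only: Suc.hyps(2)[symmetric] fS)
  qed (simp_all add: f0)
qed (simp add: f_def)

text \<open>In the product formula \<open>f N\<close> contains the factor 1 - p^N = 0, while
  \<open>f i\<close> and \<open>f (N - i)\<close> are nonzero.\<close>

lemma gauss_binomial_root_of_unity:
  assumes p: "is_root_of_unity_of_order (p :: 'k::field) N" and i: "0 < i" "i < N"
  shows "gauss_binomial p N i = 0"
proof -
  define f where "f m = (\<Prod>r=1..m. 1 - p ^ r)" for m
  have nz: "f m \<noteq> 0" if "m < N" for m
    using that p by (auto simp: f_def is_root_of_unity_of_order_def)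
  have "f N = 0"
    using p i by (auto simp: f_def is_root_of_unity_of_order_def intro!: bexI[of _ N])
  moreover have "gauss_binomial p N i * f i * f (N - i) = f N"
    using gauss_binomial_factorial[of p i "N - i"] i by (simp add: f_def)
  ultimately show ?thesis using nz[of i] nz[of "N - i"] i by simp
qed

text \<open>A unital algebra that fills a whole type of class \<open>ring_1\<close>, so that
  \<open>algebra_simps\<close> applies without carrier side conditions. The scalar action is a
  parameter; the later instance is \<open>scale_endo\<close> on linear endomorphisms.\<close>

locale scaled_ring =
  fixes scl :: "'k::field \<Rightarrow> 'a::ring_1 \<Rightarrow> 'a" (infixr "\<cdot>" 75)
  assumes scl_add_right: "c \<cdot> (x + y) = c \<cdot> x + c \<cdot> y"
    and scl_add_left: "(c + d) \<cdot> x = c \<cdot> x + d \<cdot> x"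
    and scl_scl [simp]: "c \<cdot> d \<cdot> x = (c * d) \<cdot> x"
    and scl_one [simp]: "1 \<cdot> x = x"
    and mult_scl_left [simp]: "(c \<cdot> x) * y = c \<cdot> (x * y)"
    and mult_scl_right [simp]: "x * (c \<cdot> y) = c \<cdot> (x * y)"
begin

lemma scl_zero_left [simp]: "0 \<cdot> x = 0"
  using scl_add_left[of 0 0 x] by simp

lemma scl_zero_right [simp]: "c \<cdot> 0 = 0"
  using scl_add_right[of c 0 0] by simp

lemma scl_minus_right [simp]: "c \<cdot> (- x) = - (c \<cdot> x)"
  using scl_add_right[of c x "- x"] by (simp add: eq_neg_iff_add_eq_0 add.commute)

lemma scl_minus_left [simp]: "(- c) \<cdot> x = - (c \<cdot> x)"
  using scl_add_left[of c "- c" x] by (simp add: eq_neg_iff_add_eq_0 add.commute)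

lemma scl_diff_right: "c \<cdot> (x - y) = c \<cdot> x - c \<cdot> y"
  using scl_add_right[of c x "- y"] by simp

lemma scl_diff_left: "(c - d) \<cdot> x = c \<cdot> x - d \<cdot> x"
  using scl_add_left[of c "- d" x] by simp

lemmas scl_distribs = scl_add_right scl_add_left scl_diff_right scl_diff_left

lemma scl_sum_right: "c \<cdot> sum f A = (\<Sum>x\<in>A. c \<cdot> f x)"
  by (induction A rule: infinite_finite_induct) (auto simp: scl_distribs)

lemma scl_cancel: "c \<cdot> x = c \<cdot> y \<Longrightarrow> c \<noteq> 0 \<Longrightarrow> x = y"
  by (metis scl_scl scl_one left_inverse)

lemma scl_eq_0D: "c \<cdot> x = 0 \<Longrightarrow> c \<noteq> 0 \<Longrightarrow> x = 0"
  using scl_cancel[of c x 0] by simp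

lemma power_scl: "(c \<cdot> x) ^ n = c ^ n \<cdot> x ^ n"
  by (induction n) (auto simp: ac_simps)

lemma power_commute_past:
  assumes "y * x = p \<cdot> (x * y)"
  shows "y * x ^ n = p ^ n \<cdot> (x ^ n * y)"
proof (induction n)
  case (Suc n)
  have "y * x ^ Suc n = (y * x) * x ^ n" by (simp add: mult.assoc)
  also have "\<dots> = p \<cdot> (x * (y * x ^ n))" by (simp add: assms mult.assoc)
  finally show ?case by (simp add: Suc mult.assoc)
qed simp

text \<open>On multiplication by \<open>x + y\<close> from the left, \<open>x\<close> raises the
  exponent and \<open>y\<close> has to pass \<open>x ^ i\<close> at the cost of
  \<open>p ^ i\<close>; this is the Pascal rule in the recursion of
  \<open>gauss_binomial\<close>.\<close>

lemma gauss_binomial_theorem: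
  assumes "y * x = p \<cdot> (x * y)"
  shows "(x + y) ^ n = (\<Sum>i\<le>n. gauss_binomial p n i \<cdot> (x ^ i * y ^ (n - i)))"
proof (induction n)
  case (Suc n)
  have yx: "y * (x ^ i * y ^ (n - i)) = p ^ i \<cdot> (x ^ i * y ^ (Suc n - i))" if "i \<le> n" for i
    using that power_commute_past[OF assms, of i]
    by (simp add: Suc_diff_le mult.assoc [symmetric])
  have "(x + y) ^ Suc n = (\<Sum>i\<le>n. gauss_binomial p n i \<cdot> (x ^ Suc i * y ^ (n - i)))
      + (\<Sum>i\<le>n. (gauss_binomial p n i * p ^ i) \<cdot> (x ^ i * y ^ (Suc n - i)))"
    unfolding power_Suc Suc.IH distrib_right sum_distrib_left sum.distrib
    by (intro arg_cong2[where f = "(+)"] sum.cong) (auto simp: yx mult.assoc)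
  also have "(\<Sum>i\<le>n. (gauss_binomial p n i * p ^ i) \<cdot> (x ^ i * y ^ (Suc n - i)))
      = (\<Sum>i\<le>Suc n. (gauss_binomial p n i * p ^ i) \<cdot> (x ^ i * y ^ (Suc n - i)))"
    by (simp add: gauss_binomial_eq_0)
  also have "\<dots> = y ^ Suc n + (\<Sum>i\<le>n. (gauss_binomial p n (Suc i) * p ^ Suc i) \<cdot> (x ^ Suc i * y ^ (n - i)))"
    by (subst sum.atMost_Suc_shift) simp
  also have "(\<Sum>i\<le>n. gauss_binomial p n i \<cdot> (x ^ Suc i * y ^ (n - i))) + \<dots>
      = y ^ Suc n + (\<Sum>i\<le>n. gauss_binomial p (Suc n) (Suc i) \<cdot> (x ^ Suc i * y ^ (Suc n - Suc i)))"
    by (simp add: sum.distrib scl_distribs ac_simps)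
  also have "\<dots> = (\<Sum>i\<le>Suc n. gauss_binomial p (Suc n) i \<cdot> (x ^ i * y ^ (Suc n - i)))"
    by (subst sum.atMost_Suc_shift) simp
  finally show ?case .
qed simp

lemma power_add_root_of_unity:
  assumes yx: "y * x = p \<cdot> (x * y)" and p: "is_root_of_unity_of_order p N"
  shows "(x + y) ^ N = x ^ N + y ^ N"
proof -
  obtain M where N: "N = Suc M"
    using p by (cases N) (auto simp: is_root_of_unity_of_order_def)
  have "(x + y) ^ N = (\<Sum>i\<in>{0, N}. gauss_binomial p N i \<cdot> (x ^ i * y ^ (N - i)))"
    unfolding gauss_binomial_theorem[OF yx]
    by (rule sum.mono_neutral_right) (auto simp: gauss_binomial_root_of_unity[OF p])
  then show ?thesis by (simp add: N add.commute)
qed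

text \<open>The topmost summand is split off: the sum of the others commutes with it up to the same
  \<open>p\<close>, so the two-term case applies at each step.\<close>

lemma power_sum_root_of_unity:
  fixes x :: "nat \<Rightarrow> 'a"
  assumes "\<And>l m. a \<le> l \<Longrightarrow> l < m \<Longrightarrow> m < b \<Longrightarrow> x l * x m = p \<cdot> (x m * x l)"
    and p: "is_root_of_unity_of_order p N"
  shows "(\<Sum>l\<in>{a..<b}. x l) ^ N = (\<Sum>l\<in>{a..<b}. x l ^ N)"
  using assms(1)
proof (induction b)
  case 0
  then show ?case using p by (auto simp: is_root_of_unity_of_order_def power_0_left)
next
  case (Suc b)
  show ?case
  proof (cases "a \<le> b")
    case True
    have "(\<Sum>l\<in>{a..<b}. x l) * x b = (\<Sum>l\<in>{a..<b}. p \<cdot> (x b * x l))"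
      unfolding sum_distrib_right by (intro sum.cong) (auto simp: Suc.prems)
    then have "(\<Sum>l\<in>{a..<b}. x l) * x b = p \<cdot> (x b * (\<Sum>l\<in>{a..<b}. x l))"
      by (simp add: sum_distrib_left scl_sum_right)
    from power_add_root_of_unity[OF this p] Suc True show ?thesis
      by (simp add: add.commute)
  next
    case False
    then show ?thesis using p by (auto simp: is_root_of_unity_of_order_def power_0_left)
  qed
qed

text \<open>In the step from \<open>n\<close> to \<open>Suc n\<close> the new \<open>y\<close>
  passes \<open>x ^ n\<close> and contributes \<open>r ^ n\<close>; these exponents add up to the
  triangular number of the final formula.\<close>

lemma power_mult_commuting:
  assumes "y * x = r \<cdot> (x * y)"
  shows "(x * y) ^ n = r ^ (n * (n - 1) div 2) \<cdot> (x ^ n * y ^ n)"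
proof (induction n)
  case (Suc n)
  have tri: "Suc n * (Suc n - 1) div 2 = n * (n - 1) div 2 + n"
    by (cases n) auto
  have "(x * y) ^ Suc n = r ^ (n * (n - 1) div 2) \<cdot> (x * (y * x ^ n) * y ^ n)"
    by (simp add: Suc mult.assoc)
  also have "\<dots> = (r ^ (n * (n - 1) div 2) * r ^ n) \<cdot> (x ^ Suc n * y ^ Suc n)"
    by (simp add: power_commute_past[OF assms] mult.assoc)
  finally show ?case by (simp only: tri power_add)
qed simp

section \<open>Braided commutators with arbitrary scalars\<close>

definition bracket :: "'k \<Rightarrow> 'a \<Rightarrow> 'a \<Rightarrow> 'a" where
  "bracket c x y = x * y - c \<cdot> (y * x)"

text \<open>The braided Jacobi identity in the case where \<open>x\<close> and \<open>z\<close>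
  commute up to a scalar, so that its third term is zero.\<close>

lemma bracket_jacobi:
  assumes "x * z = e \<cdot> (z * x)"
  shows "bracket (b * e) (bracket a x y) z = bracket (a * e) x (bracket b y z)"
proof -
  have 1: "x * (z * y) = e \<cdot> (z * (x * y))"
    by (simp add: assms mult.assoc[symmetric])
  show ?thesis
    unfolding bracket_def by (simp add: algebra_simps scl_distribs 1 assms)
qed

lemma bracket_eq_0: "bracket c x y = 0 \<longleftrightarrow> x * y = c \<cdot> (y * x)"
  by (simp add: bracket_def)

text \<open>If \<open>[[x, y], y]\<close> and \<open>[y, [y, z]]\<close> vanish, then expanding \<open>[x, y][y, z]\<close> in two ways gives a
  commutation rule for \<open>y\<close> and \<open>[x, [y, z]]\<close>.\<close>

lemma bracket_middle:
  assumes u: "u = bracket a x y" and w: "w = bracket b y z" and v: "v = bracket (a * e) x w"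
    and uy: "u * y = (a * p) \<cdot> (y * u)" and yw: "y * w = (p * b) \<cdot> (w * y)" and xz: "x * z = e \<cdot> (z * x)"
  shows "(a * (1 + p)) \<cdot> (y * v) = (b * (1 + p)) \<cdot> (v * y)"
proof -
  have v': "v = bracket (b * e) u z"
    using bracket_jacobi[OF xz, of b a y] by (simp add: u v w)
  have uz: "u * z = v + (b * e) \<cdot> (z * u)"
    by (simp add: v' bracket_def)
  have xw: "x * w = v + (a * e) \<cdot> (w * x)"
    by (simp add: v bracket_def)
  have "u * w = (u * y) * z - b \<cdot> ((u * z) * y)"
    by (simp add: w bracket_def algebra_simps scl_distribs)
  also have "(u * y) * z = (a * p) \<cdot> (y * (u * z))" by (simp add: uy mult.assoc)
  also have "(a * p) \<cdot> (y * (u * z)) - b \<cdot> ((u * z) * y)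
      = (a * p) \<cdot> (y * v) - b \<cdot> (v * y) + (a * p * b * e) \<cdot> ((y * z) * u) - (b * b * e) \<cdot> (z * (u * y))"
    by (simp add: uz algebra_simps scl_distribs)
  also have "\<dots> = (a * p) \<cdot> (y * v) - b \<cdot> (v * y) + (a * p * b * e) \<cdot> (w * u)"
    by (simp add: uy w bracket_def algebra_simps scl_distribs)
  finally have 1: "u * w = (a * p) \<cdot> (y * v) - b \<cdot> (v * y) + (a * p * b * e) \<cdot> (w * u)" .
  have "u * w = x * (y * w) - a \<cdot> (y * (x * w))"
    by (simp add: u bracket_def algebra_simps scl_distribs)
  also have "x * (y * w) = (p * b) \<cdot> ((x * w) * y)" by (simp add: yw mult.assoc)
  also have "(p * b) \<cdot> ((x * w) * y) - a \<cdot> (y * (x * w))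
      = (p * b) \<cdot> (v * y) - a \<cdot> (y * v) + (p * b * a * e) \<cdot> (w * (x * y)) - (a * a * e) \<cdot> ((y * w) * x)"
    by (simp add: xw algebra_simps scl_distribs)
  also have "\<dots> = (p * b) \<cdot> (v * y) - a \<cdot> (y * v) + (p * b * a * e) \<cdot> (w * u)"
    by (simp add: yw u bracket_def algebra_simps scl_distribs)
  finally have 2: "u * w = (p * b) \<cdot> (v * y) - a \<cdot> (y * v) + (a * p * b * e) \<cdot> (w * u)"
    by (simp add: ac_simps)
  from 1 2 have "(a * p) \<cdot> (y * v) + a \<cdot> (y * v) = (p * b) \<cdot> (v * y) + b \<cdot> (v * y)"
    by (simp add: algebra_simps)
  then show ?thesis
    by (simp add: scl_distribs ring_distribs ac_simps)
qed

lemma bracket_add_left: "bracket c (x + y) z = bracket c x z + bracket c y z"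
  and bracket_add_right: "bracket c x (y + z) = bracket c x y + bracket c x z"
  and bracket_scl_left: "bracket c (d \<cdot> x) y = d \<cdot> bracket c x y"
  and bracket_scl_right: "bracket c x (d \<cdot> y) = d \<cdot> bracket c x y"
  by (simp_all add: bracket_def algebra_simps scl_distribs)

lemma bracket_sum_right: "bracket c x (sum f A) = (\<Sum>l\<in>A. bracket c x (f l))"
  by (simp add: bracket_def sum_distrib_left sum_distrib_right scl_sum_right sum_subtractf)

text \<open>After reordering, every mixed term carries the factor \<open>1 - p * c * c'\<close>.
  With \<open>p\<close> = q_ii and \<open>c * c'\<close> = q~_{ij} for a neighbour j of i, it
  vanishes by the condition on an even index, so the Serre elements of the two families simply add
  up.\<close>

lemma serre_add:
  fixes x\<^sub>1 x\<^sub>2 y\<^sub>1 y\<^sub>2 :: 'a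
  assumes xx: "x\<^sub>2 * x\<^sub>1 = p \<cdot> (x\<^sub>1 * x\<^sub>2)" and xy: "x\<^sub>2 * y\<^sub>1 = c \<cdot> (y\<^sub>1 * x\<^sub>2)" and yx: "y\<^sub>2 * x\<^sub>1 = c' \<cdot> (x\<^sub>1 * y\<^sub>2)"
    and pcc: "p * c * c' = 1"
  shows "bracket (p * c) (x\<^sub>1 + x\<^sub>2) (bracket c (x\<^sub>1 + x\<^sub>2) (y\<^sub>1 + y\<^sub>2))
    = bracket (p * c) x\<^sub>1 (bracket c x\<^sub>1 y\<^sub>1) + bracket (p * c) x\<^sub>2 (bracket c x\<^sub>2 y\<^sub>2)"
proof -
  have assoc: "x\<^sub>2 * (x\<^sub>1 * t) = p \<cdot> (x\<^sub>1 * (x\<^sub>2 * t))" "x\<^sub>2 * (y\<^sub>1 * t) = c \<cdot> (y\<^sub>1 * (x\<^sub>2 * t))"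
    "y\<^sub>2 * (x\<^sub>1 * t) = c' \<cdot> (x\<^sub>1 * (y\<^sub>2 * t))" for t
    by (simp_all add: xx xy yx flip: mult.assoc)
  have "bracket (p * c) (x\<^sub>1 + x\<^sub>2) (bracket c (x\<^sub>1 + x\<^sub>2) (y\<^sub>1 + y\<^sub>2))
    = bracket (p * c) x\<^sub>1 (bracket c x\<^sub>1 y\<^sub>1) + bracket (p * c) x\<^sub>2 (bracket c x\<^sub>2 y\<^sub>2)
      + ((1 - c * c') * (1 - p * c * c')) \<cdot> (x\<^sub>1 * x\<^sub>1 * y\<^sub>2)
      + ((1 + p) * (1 - p * c * c')) \<cdot> (x\<^sub>1 * x\<^sub>2 * y\<^sub>2)
      - ((1 + p) * c * (1 - p * c * c')) \<cdot> (x\<^sub>1 * y\<^sub>2 * x\<^sub>2)"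
    by (simp add: bracket_def algebra_simps scl_distribs xx xy yx assoc)
  then show ?thesis by (simp add: pcc)
qed

end

section \<open>The bicharacter on intervals\<close>

abbreviation interval :: "nat \<Rightarrow> nat \<Rightarrow> nat list" where
  "interval j k \<equiv> [j..<Suc k]"

lemma interval_Cons: "j \<le> k \<Longrightarrow> interval j k = j # interval (Suc j) k"
  by (simp only: upt_conv_Cons less_Suc_eq_le)

lemma interval_split: "j \<le> l \<Longrightarrow> l \<le> k \<Longrightarrow> interval j k = interval j l @ interval (Suc l) k"
  by (metis le_add_diff_inverse le_SucI upt_add_eq_append Suc_le_mono add_Suc)

text \<open>\<open>q_sq\<close> records that q is neither 1 nor -1, the form in which N >= 3 acts on
  the relations between root vectors; the exact order comes in with the Gauss binomials.\<close>

locale super_data =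
  fixes \<theta> :: nat and S :: "nat set" and q :: "'k::field" and Q :: "nat \<Rightarrow> nat \<Rightarrow> 'k"
  assumes theta: "2 \<le> \<theta>" and super: "super_type_A \<theta> S q Q" and q_sq: "q\<^sup>2 \<noteq> 1"
begin

lemma Q_nonzero: "i \<in> {1..\<theta>} \<Longrightarrow> j \<in> {1..\<theta>} \<Longrightarrow> Q i j \<noteq> 0"
  using super by (simp add: super_type_A_def)

lemma qtilde_far: "i \<in> {1..\<theta>} \<Longrightarrow> j \<in> {1..\<theta>} \<Longrightarrow> i + 1 < j \<or> j + 1 < i \<Longrightarrow> qtilde Q i j = 1"
  using super unfolding super_type_A_def by blast

lemma finite_S: "finite S" and S_subset: "S \<subseteq> {1..\<theta>}"
  using super finite_subset unfolding super_type_A_def by auto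

lemma Q_odd: "i \<in> S \<Longrightarrow> Q i i = -1"
  using super by (simp add: super_type_A_def)

lemma qtilde_odd: "Suc i \<in> S \<Longrightarrow> 1 \<le> i \<Longrightarrow> Suc i < \<theta> \<Longrightarrow> qtilde Q i (Suc i) * qtilde Q (Suc i) (Suc (Suc i)) = 1"
  using super unfolding super_type_A_def by force

lemma qtilde_even:
  "Suc i \<notin> S \<Longrightarrow> 1 \<le> i \<Longrightarrow> Suc i \<le> \<theta> \<Longrightarrow> Q (Suc i) (Suc i) * qtilde Q i (Suc i) = 1"
  "i \<notin> S \<Longrightarrow> 1 \<le> i \<Longrightarrow> i < \<theta> \<Longrightarrow> Q i i * qtilde Q i (Suc i) = 1"
proof -
  have *: "(1 < i \<longrightarrow> Q i i * qtilde Q (i - 1) i = 1) \<and> (i < \<theta> \<longrightarrow> Q i i * qtilde Q i (i + 1) = 1)"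
    if "i \<in> {1..\<theta>} - S" for i
    using super that unfolding super_type_A_def by blast
  show "Suc i \<notin> S \<Longrightarrow> 1 \<le> i \<Longrightarrow> Suc i \<le> \<theta> \<Longrightarrow> Q (Suc i) (Suc i) * qtilde Q i (Suc i) = 1"
    using *[of "Suc i"] by simp
  show "i \<notin> S \<Longrightarrow> 1 \<le> i \<Longrightarrow> i < \<theta> \<Longrightarrow> Q i i * qtilde Q i (Suc i) = 1"
    using *[of i] by simp
qed

lemma q_eq: "q = (Q 1 1)\<^sup>2 * qtilde Q 1 2"
  using super by (simp add: super_type_A_def)

lemma q_nonzero: "q \<noteq> 0"
  using q_eq Q_nonzero theta by (simp add: qtilde_def)

text \<open>The value of q~_{i,i+1} and, at an even vertex, of 1/q_ii. It is inverted at each odd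
  vertex, and the start is forced by q = q_11^2 q~_{12}: an odd vertex 1 gives q~_{12} = q, an even
  one gives q~_{12} = 1/q. Unlike q~ it is meaningful at the last vertex too.\<close>

definition level :: "nat \<Rightarrow> 'k" where
  "level i = (if even (card (S \<inter> {1..i})) then inverse q else q)"

lemma level_nonzero: "level i \<noteq> 0"
  using q_nonzero by (simp add: level_def)

lemma level_not_minus_1: "level i \<noteq> -1"
  using q_sq by (auto simp: level_def power2_eq_square dest: arg_cong[where f = inverse])

lemma inverse_level_not_minus_1: "inverse (level i) \<noteq> -1"
  using level_not_minus_1[of i] by (metis inverse_inverse_eq inverse_minus_eq inverse_1)

lemma card_Suc: "j \<le> Suc i \<Longrightarrow>
    card (S \<inter> {j..Suc i}) = (if Suc i \<in> S then Suc (card (S \<inter> {j..i})) else card (S \<inter> {j..i}))"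
  by (simp add: atLeastAtMostSuc_conv Int_insert_right)

lemma level_Suc: "level (Suc i) = (if Suc i \<in> S then inverse (level i) else level i)"
  by (simp add: level_def card_Suc)

lemma qtilde_level:
  assumes "1 \<le> i" "i < \<theta>"
  shows "qtilde Q i (Suc i) = level i"
  using assms
proof (induction i rule: nat_induct_at_least)
  case base
  show ?case
  proof (cases "1 \<in> S")
    case True
    have "qtilde Q 1 (Suc 1) = q" using q_eq Q_odd[OF True] by (simp add: numeral_2_eq_2)
    then show ?thesis using level_Suc[of 0] True by (simp add: level_def)
  next
    case False
    have 1: "Q 1 1 * qtilde Q 1 2 = 1" using qtilde_even(2)[of 1] False base by (simp add: numeral_2_eq_2)
    then have "q = Q 1 1" using q_eq by (simp add: power2_eq_square mult.assoc)
    then have "qtilde Q 1 (Suc 1) = inverse q"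
      using 1 by (metis inverse_unique numeral_2_eq_2 One_nat_def)
    then show ?thesis using level_Suc[of 0] False by (simp add: level_def)
  qed
next
  case (Suc i)
  show ?case
  proof (cases "Suc i \<in> S")
    case True
    then show ?thesis using Suc qtilde_odd[of i] level_Suc[of i] by (simp add: inverse_unique)
  next
    case False
    then have "Q (Suc i) (Suc i) * qtilde Q i (Suc i) = Q (Suc i) (Suc i) * qtilde Q (Suc i) (Suc (Suc i))"
      using qtilde_even(1)[of i] qtilde_even(2)[of "Suc i"] Suc by simp
    then show ?thesis using False Suc level_Suc[of i] Q_nonzero[of "Suc i" "Suc i"] by simp
  qed
qed

lemma Q_diag:
  assumes "1 \<le> i" "i \<le> \<theta>"
  shows "Q i i = (if i \<in> S then -1 else inverse (level i))"
proof (cases "i \<in> S")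
  case False
  show ?thesis
  proof (cases "i < \<theta>")
    case True
    then have "level i * Q i i = 1"
      using qtilde_even(2)[of i] False assms qtilde_level[of i] by (simp add: mult.commute)
    then show ?thesis using False by (simp add: inverse_unique)
  next
    case False': False
    \<comment> \<open>The last vertex has only a left neighbour, which exists because
      \<open>\<theta>\<close> is at least 2; the level there equals that of \<open>i\<close> because
      \<open>i\<close> is even.\<close>
    then obtain h where h: "i = Suc h" "1 \<le> h" "h < \<theta>" using theta assms by (cases i) auto
    then have "level h * Q i i = 1"
      using qtilde_even(1)[of h] False assms qtilde_level[of h] by (simp add: mult.commute)
    then show ?thesis using False h level_Suc[of h] by (simp add: inverse_unique)
  qed
qed (simp add: Q_odd)

lemma Q_diag_not_minus_1: "1 \<le> i \<Longrightarrow> i \<le> \<theta> \<Longrightarrow> i \<notin> S \<Longrightarrow> Q i i \<noteq> -1"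
  using Q_diag inverse_level_not_minus_1 by simp

section \<open>The bicharacter on positive roots\<close>

lemma word_chi_far:
  assumes "set u \<subseteq> {1..\<theta>}" "set v \<subseteq> {1..\<theta>}" "\<And>i j. i \<in> set u \<Longrightarrow> j \<in> set v \<Longrightarrow> i + 1 < j \<or> j + 1 < i"
  shows "word_chi Q u v * word_chi Q v u = 1"
  using assms by (intro word_chi_commute_far qtilde_far) blast+

text \<open>Only the letters \<open>l\<close> and \<open>Suc l\<close> are neighbours; every other
  pair of letters contributes q~ = 1.\<close>

lemma word_chi_adjacent:
  assumes "1 \<le> j" "j \<le> l" "l < k" "k \<le> \<theta>"
  shows "word_chi Q (interval j l) (interval (Suc l) k) * word_chi Q (interval (Suc l) k) (interval j l)
    = qtilde Q l (Suc l)"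
proof -
  define u where "u = [j..<l]"
  define v where "v = interval (Suc (Suc l)) k"
  have eqs: "interval j l = u @ [l]" "interval (Suc l) k = [Suc l] @ v"
    using assms interval_Cons[of "Suc l" k] by (auto simp: u_def v_def)
  have 1: "word_chi Q u [Suc l] * word_chi Q [Suc l] u = 1"
    and 2: "word_chi Q u v * word_chi Q v u = 1"
    and 3: "word_chi Q [l] v * word_chi Q v [l] = 1"
    using assms by (intro word_chi_far; auto simp: u_def v_def)+
  have "word_chi Q (u @ [l]) ([Suc l] @ v) * word_chi Q ([Suc l] @ v) (u @ [l])
    = (word_chi Q u [Suc l] * word_chi Q [Suc l] u) * (word_chi Q u v * word_chi Q v u)
     * (word_chi Q [l] v * word_chi Q v [l]) * qtilde Q l (Suc l)"
    by (simp only: word_chi_simps(1-5) qtilde_def) (simp only: ac_simps)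
  then show ?thesis using 1 2 3 eqs by simp
qed

text \<open>Appending the vertex \<open>Suc k\<close> multiplies the value by
  \<open>level k * Q (Suc k) (Suc k)\<close>, which is 1 at an even vertex and
  \<open>- level k\<close> at an odd one. For an even root the result is q or 1/q, the parameter of
  the Gauss binomials.\<close>

lemma word_chi_root:
  assumes "1 \<le> j" "j \<le> k" "k \<le> \<theta>"
  shows "word_chi Q (interval j k) (interval j k)
    = (if even (card (S \<inter> {j..k})) then inverse (level k) else -1)"
  using assms(2,3)
proof (induction k rule: nat_induct_at_least)
  case base
  then show ?case using assms Q_diag[of j] by auto
next
  case (Suc k)
  let ?u = "interval j k"
  have i: "interval j (Suc k) = ?u @ [Suc k]" using Suc by (simp only: upt_Suc) simp
  have "word_chi Q (?u @ [Suc k]) (?u @ [Suc k])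
    = word_chi Q ?u ?u * (word_chi Q ?u [Suc k] * word_chi Q [Suc k] ?u) * Q (Suc k) (Suc k)"
    by (simp only: word_chi_simps(3,4,5) ac_simps)
  also have "word_chi Q ?u [Suc k] * word_chi Q [Suc k] ?u = level k"
    using word_chi_adjacent[of j k "Suc k"] qtilde_level[of k] Suc assms by simp
  finally have "word_chi Q (interval j (Suc k)) (interval j (Suc k))
      = word_chi Q ?u ?u * level k * Q (Suc k) (Suc k)"
    by (simp only: i)
  then show ?case
    using Suc Q_diag[of "Suc k"] level_Suc[of k] level_nonzero[of k] card_Suc[of j k]
    by (cases "Suc k \<in> S"; cases "even (card (S \<inter> {j..k}))") (simp_all del: upt_Suc)
qed

text \<open>The letters that matter are \<open>i - 1\<close>, \<open>i\<close> and
  \<open>i + 1\<close>, and the product is q~_{i-1,i} q_ii^2 q~_{i,i+1}. For even \<open>i\<close>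
  it splits into two factors 1; for odd \<open>i\<close> one has q_ii^2 = 1 and the neighbours
  cancel. This symmetry allows a commutation rule with \<open>E i\<close> to be reversed.\<close>

lemma word_chi_inner:
  assumes "1 \<le> j" "j < i" "i < k" "k \<le> \<theta>"
  shows "word_chi Q [i] (interval j k) * word_chi Q (interval j k) [i] = 1"
proof -
  define h where "h = i - 1"
  have h: "i = Suc h" "1 \<le> h" "j \<le> h" using assms by (auto simp: h_def)
  define u where "u = [j..<h]"
  define v where "v = interval (Suc (Suc i)) k"
  have I: "interval j k = u @ [h] @ [i] @ [Suc i] @ v"
  proof -
    have "interval j k = interval j h @ interval i k" using interval_split[of j h k] assms h by simp
    also have "interval j h = u @ [h]" using h by (simp add: u_def)
    also have "interval i k = [i] @ [Suc i] @ v"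
      using interval_Cons[of i k] interval_Cons[of "Suc i" k] assms by (simp add: v_def)
    finally show ?thesis by simp
  qed
  have 1: "word_chi Q u [i] * word_chi Q [i] u = 1"
    and 2: "word_chi Q [i] v * word_chi Q v [i] = 1"
    using assms by (intro word_chi_far; auto simp: u_def v_def h_def)+
  have 3: "qtilde Q h i * (Q i i)\<^sup>2 * qtilde Q i (Suc i) = 1"
  proof (cases "i \<in> S")
    case True
    then show ?thesis using qtilde_odd[of h] Q_odd[of i] assms h by simp
  next
    case False
    have "qtilde Q h i * (Q i i)\<^sup>2 * qtilde Q i (Suc i)
      = (Q i i * qtilde Q h i) * (Q i i * qtilde Q i (Suc i))"
      by (simp only: power2_eq_square ac_simps)
    also have "Q i i * qtilde Q h i = 1" using qtilde_even(1)[of h] False assms h by simp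
    also have "Q i i * qtilde Q i (Suc i) = 1" using qtilde_even(2)[of i] False assms h by simp
    finally show ?thesis by simp
  qed
  have "word_chi Q [i] (u @ [h] @ [i] @ [Suc i] @ v) * word_chi Q (u @ [h] @ [i] @ [Suc i] @ v) [i]
    = (word_chi Q u [i] * word_chi Q [i] u) * (word_chi Q [i] v * word_chi Q v [i])
      * (qtilde Q h i * (Q i i)\<^sup>2 * qtilde Q i (Suc i))"
    by (simp only: word_chi_simps(1-5) qtilde_def power2_eq_square) (simp only: ac_simps)
  then show ?thesis unfolding I using 1 2 3 by simp
qed

end

section \<open>Commutation relations between root vectors\<close>

locale super_scaled_ring = super_data \<theta> S q Q + scaled_ring scl
  for \<theta> S and q :: "'k::field" and Q and scl :: "'k \<Rightarrow> 'a::ring_1 \<Rightarrow> 'a" (infixr "\<cdot>" 75)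
begin

text \<open>\<open>comm u x v y\<close> says \<open>[x, y]\<^sub>c = 0\<close> for elements \<open>x\<close>, \<open>y\<close> of the degrees of the words \<open>u\<close>, \<open>v\<close>.\<close>

definition comm :: "nat list \<Rightarrow> 'a \<Rightarrow> nat list \<Rightarrow> 'a \<Rightarrow> bool" where
  "comm u x v y \<longleftrightarrow> x * y = word_chi Q u v \<cdot> (y * x)"

text \<open>The iterated bracket of an arbitrary family \<open>E\<close>, with scalars fixed by the
  intended degrees: the same expression is evaluated at two families and at their sum.\<close>

definition rootv :: "(nat \<Rightarrow> 'a) \<Rightarrow> nat \<Rightarrow> nat \<Rightarrow> 'a" where
  "rootv E j k = foldr (\<lambda>i. bracket (word_chi Q [i] (interval (Suc i) k)) (E i)) [j..<k] (E k)"

lemma rootv_self [simp]: "rootv E k k = E k"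
  by (simp add: rootv_def)

lemma rootv_step: "j < k \<Longrightarrow> rootv E j k = bracket (word_chi Q [j] (interval (Suc j) k)) (E j) (rootv E (Suc j) k)"
  by (simp add: rootv_def upt_conv_Cons del: upt_Suc)

text \<open>The scalar \<open>c\<close> is free: an element that commutes with both factors up to
  their characters passes both terms of the bracket with the same total factor.\<close>

lemma comm_bracket_right:
  assumes "comm u x v y" "comm u x w z"
  shows "comm u x (v @ w) (bracket c y z)"
proof -
  have xy: "x * y = word_chi Q u v \<cdot> (y * x)" "x * (y * t) = word_chi Q u v \<cdot> (y * (x * t))"
    and xz: "x * z = word_chi Q u w \<cdot> (z * x)" "x * (z * t) = word_chi Q u w \<cdot> (z * (x * t))" for t
    using assms by (simp_all add: comm_def flip: mult.assoc)
  show ?thesis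
    unfolding comm_def bracket_def
    by (simp add: right_diff_distrib left_diff_distrib mult.assoc xy xz scl_distribs)
      (simp add: ac_simps)
qed

lemma comm_bracket_left:
  assumes "comm v y u x" "comm w z u x"
  shows "comm (v @ w) (bracket c y z) u x"
proof -
  have yx: "y * x = word_chi Q v u \<cdot> (x * y)" "y * (x * t) = word_chi Q v u \<cdot> (x * (y * t))"
    and zx: "z * x = word_chi Q w u \<cdot> (x * z)" "z * (x * t) = word_chi Q w u \<cdot> (x * (z * t))" for t
    using assms by (simp_all add: comm_def flip: mult.assoc)
  show ?thesis
    unfolding comm_def bracket_def
    by (simp add: right_diff_distrib left_diff_distrib mult.assoc yx zx scl_distribs)
      (simp add: ac_simps)
qed

lemma comm_sym:
  assumes "comm u x v y" "word_chi Q v u * word_chi Q u v = 1"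
  shows "comm v y u x"
  using assms by (simp add: comm_def)

lemma comm_root_right:
  assumes "j \<le> k" "\<And>i. j \<le> i \<Longrightarrow> i \<le> k \<Longrightarrow> comm u x [i] (E i)"
  shows "comm u x (interval j k) (rootv E j k)"
  using assms
proof (induction j rule: inc_induct)
  case (step j)
  then have "comm u x ([j] @ interval (Suc j) k) (bracket (word_chi Q [j] (interval (Suc j) k)) (E j) (rootv E (Suc j) k))"
    by (intro comm_bracket_right) auto
  then show ?case using step(2) by (simp add: rootv_step interval_Cons del: upt_Suc)
qed simp

lemma comm_root_left:
  assumes "j \<le> k" "\<And>i. j \<le> i \<Longrightarrow> i \<le> k \<Longrightarrow> comm [i] (E i) u x"
  shows "comm (interval j k) (rootv E j k) u x"
  using assms
proof (induction j rule: inc_induct)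
  case (step j)
  then have "comm ([j] @ interval (Suc j) k) (bracket (word_chi Q [j] (interval (Suc j) k)) (E j) (rootv E (Suc j) k)) u x"
    by (intro comm_bracket_left) auto
  then show ?case using step(2) by (simp add: rootv_step interval_Cons del: upt_Suc)
qed simp

end

text \<open>The relators read in an algebra of class \<open>ring_1\<close>. Neighbouring indices are
  written as successors, which avoids truncated subtraction; the words in \<open>word_chi\<close>
  are the degrees of the bracketed elements.\<close>

locale super_relations = super_scaled_ring \<theta> S q Q scl
  for \<theta> S and q :: "'k::field" and Q and scl :: "'k \<Rightarrow> 'a::ring_1 \<Rightarrow> 'a" (infixr "\<cdot>" 75) +
  fixes E :: "nat \<Rightarrow> 'a"
  assumes far: "\<lbrakk>1 \<le> i; i + 2 \<le> j; j \<le> \<theta>\<rbrakk> \<Longrightarrow> E i * E j = Q i j \<cdot> (E j * E i)"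
    and odd_square: "i \<in> S \<Longrightarrow> E i * E i = 0"
    and odd_middle: "\<lbrakk>1 \<le> i; Suc (Suc i) \<le> \<theta>; Suc i \<in> S\<rbrakk> \<Longrightarrow>
      bracket (word_chi Q [i, Suc i, Suc (Suc i)] [Suc i])
        (bracket (word_chi Q [i] [Suc i, Suc (Suc i)]) (E i)
          (bracket (Q (Suc i) (Suc (Suc i))) (E (Suc i)) (E (Suc (Suc i))))) (E (Suc i)) = 0"
    and serre_pred: "\<lbrakk>1 \<le> i; Suc i \<le> \<theta>; Suc i \<notin> S\<rbrakk> \<Longrightarrow>
      bracket (word_chi Q [Suc i] [Suc i, i]) (E (Suc i)) (bracket (Q (Suc i) i) (E (Suc i)) (E i)) = 0"
    and serre_succ: "\<lbrakk>1 \<le> i; Suc i \<le> \<theta>; i \<notin> S\<rbrakk> \<Longrightarrow>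
      bracket (word_chi Q [i] [i, Suc i]) (E i) (bracket (Q i (Suc i)) (E i) (E (Suc i))) = 0"
begin

lemma comm_far:
  assumes "i \<in> {1..\<theta>}" "j \<in> {1..\<theta>}" "i + 2 \<le> j \<or> j + 2 \<le> i"
  shows "comm [i] (E i) [j] (E j)"
proof (cases "i + 2 \<le> j")
  case True
  then show ?thesis using far assms by (simp add: comm_def)
next
  case False
  then have "comm [j] (E j) [i] (E i)" using far assms by (simp add: comm_def)
  then show ?thesis
    by (rule comm_sym) (use qtilde_far[of i j] assms in \<open>auto simp: qtilde_def\<close>)
qed

text \<open>The outer \<open>E j\<close> is moved into the left factor. The Jacobi rule applies
  because \<open>E j\<close> commutes up to a scalar with \<open>rootv E (Suc l) k\<close>, whose
  letters are all far from \<open>j\<close> when \<open>j < l\<close>.\<close>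

lemma rootv_split:
  assumes "1 \<le> j" "j \<le> l" "l < k" "k \<le> \<theta>"
  shows "rootv E j k = bracket (word_chi Q (interval j l) (interval (Suc l) k)) (rootv E j l) (rootv E (Suc l) k)"
  using assms(2,1)
proof (induction j rule: inc_induct)
  case base
  then show ?case using rootv_step[OF assms(3)] by simp
next
  case (step j)
  let ?y = "interval (Suc j) l" and ?z = "interval (Suc l) k"
  have "comm [j] (E j) ?z (rootv E (Suc l) k)"
    using step assms by (intro comm_root_right comm_far) auto
  from bracket_jacobi[OF this[unfolded comm_def], of "word_chi Q ?y ?z" "word_chi Q [j] ?y" "rootv E (Suc j) l"]
  have "bracket (word_chi Q ?y ?z * word_chi Q [j] ?z) (rootv E j l) (rootv E (Suc l) k)
    = bracket (word_chi Q [j] ?y * word_chi Q [j] ?z) (E j) (rootv E (Suc j) k)"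
    using step by (simp add: rootv_step del: upt_Suc)
  moreover have "interval j l = [j] @ ?y" "interval (Suc j) k = ?y @ ?z"
    using step assms interval_Cons[of j l] interval_split[of "Suc j" l k] by auto
  ultimately show ?case
    using step assms rootv_step[of j k] by (simp add: mult.commute del: upt_Suc)
qed

text \<open>The case \<open>k = Suc j\<close> is the Serre relation, or a consequence of
  \<open>E j * E j = 0\<close> at an odd index; the remaining letters are far from \<open>j\<close>
  and are attached by \<open>rootv_split\<close>.\<close>

lemma comm_first:
  assumes "1 \<le> j" "j < k" "k \<le> \<theta>"
  shows "comm [j] (E j) (interval j k) (rootv E j k)"
proof -
  have iv: "interval j (Suc j) = [j, Suc j]" by simp
  have 1: "comm [j] (E j) (interval j (Suc j)) (rootv E j (Suc j))"
  proof (cases "j \<in> S")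
    case True
    then have "E j * (E j * x) = 0" for x
      using odd_square by (simp add: mult.assoc[symmetric])
    then show ?thesis
      unfolding comm_def iv using True odd_square Q_odd
      by (simp add: rootv_step bracket_def algebra_simps scl_distribs)
  next
    case False
    then show ?thesis
      using serre_succ[of j] assms unfolding comm_def iv bracket_eq_0
      by (simp add: rootv_step)
  qed
  show ?thesis
  proof (cases "k = Suc j")
    case False
    then have "comm [j] (E j) (interval j (Suc j) @ interval (Suc (Suc j)) k) (rootv E j k)"
      using assms
      by (subst rootv_split[of j "Suc j" k], auto simp del: upt_Suc
          intro!: comm_bracket_right 1 comm_root_right comm_far)
    then show ?thesis using interval_split[of j "Suc j" k] assms by simp
  qed (use 1 in simp)
qed

lemma comm_last:
  assumes "1 \<le> j" "j < k" "k \<le> \<theta>"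
  shows "comm (interval j k) (rootv E j k) [k] (E k)"
proof -
  define i where "i = k - 1"
  have i: "k = Suc i" "1 \<le> i" "j \<le> i" using assms by (auto simp: i_def)
  have iv: "interval i k = [i, k]" by (simp add: i)
  have 1: "comm (interval i k) (rootv E i k) [k] (E k)"
  proof (cases "k \<in> S")
    case True
    then have "E k * (E k * x) = 0" for x
      using odd_square by (simp add: mult.assoc[symmetric])
    then show ?thesis
      unfolding comm_def iv using True odd_square Q_odd i
      by (simp add: rootv_step bracket_def algebra_simps scl_distribs)
  next
    case False
    define p c c' where "p = Q k k" and "c = Q k i" and "c' = Q i k"
    have pcc: "p * (c * c') = 1"
      using qtilde_even(1)[of i] False assms i by (simp add: p_def c_def c'_def qtilde_def mult.commute)
    have "bracket (p * c) (E k) (bracket c (E k) (E i)) = 0"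
      using serre_pred[of i] False assms i by (simp add: p_def c_def)
    \<comment> \<open>The factor \<open>p * c' * c'\<close> turns the coefficient of
      \<open>E i * (E k * E k)\<close> into \<open>(p * (c * c')) * (p * (c * c'))\<close>, which is
      1. The Serre relation with \<open>E k\<close> acting from the left thereby becomes the
      vanishing of [E_{i,k}, E_k].\<close>
    then have "(p * c' * c') \<cdot> (bracket (p * c) (E k) (bracket c (E k) (E i))) = 0" by simp
    then have "(p * c' * c') \<cdot> (E k * (E k * E i)) - (p * (c * c') * c') \<cdot> (E k * (E i * E k))
       - ((p * (c * c')) * (p * c')) \<cdot> (E k * (E i * E k)) + ((p * (c * c')) * (p * (c * c'))) \<cdot> (E i * (E k * E k)) = 0"
      by (simp add: bracket_def algebra_simps scl_distribs)
    then have "(p * c' * c') \<cdot> (E k * (E k * E i)) - c' \<cdot> (E k * (E i * E k))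
       - (p * c') \<cdot> (E k * (E i * E k)) + E i * (E k * E k) = 0"
      by (simp only: pcc mult_1 scl_one)
    then show ?thesis
      unfolding comm_def iv using i
      by (simp add: rootv_step bracket_def algebra_simps scl_distribs p_def c'_def)
  qed
  show ?thesis
  proof (cases "j = i")
    case False
    have "comm (interval j (i - 1)) (rootv E j (i - 1)) [k] (E k)"
      using False assms i by (intro comm_root_left comm_far) auto
    then have "comm (interval j (i - 1) @ interval i k) (rootv E j k) [k] (E k)"
      using 1 False assms i rootv_split[of j "i - 1" k]
      by (auto simp del: upt_Suc intro!: comm_bracket_left)
    then show ?thesis using interval_split[of j "i - 1" k] assms i False by simp
  qed (use 1 in simp)
qed

text \<open>At an odd vertex this is a defining relation. At an even one it follows from the two
  Serre relations of the vertex through \<open>bracket_middle\<close>, after cancelling 1 + q_ii,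
  which is nonzero because q_ii is q or 1/q.\<close>

lemma comm_middle_3:
  assumes "1 \<le> j" "Suc (Suc j) \<le> \<theta>"
  shows "comm (interval j (Suc (Suc j))) (rootv E j (Suc (Suc j))) [Suc j] (E (Suc j))"
proof -
  define i k where "i = Suc j" and "k = Suc i"
  have iv: "interval j k = [j, i, k]" "interval i k = [i, k]" "interval j i = [j, i]"
    by (simp_all add: i_def k_def)
  have w: "rootv E i k = bracket (Q i k) (E i) (E k)" and u: "rootv E j i = bracket (Q j i) (E j) (E i)"
    by (simp_all add: i_def k_def rootv_step)
  have v: "rootv E j k = bracket (Q j i * Q j k) (E j) (rootv E i k)"
    using rootv_step[of j k] iv by (simp add: i_def k_def)
  show ?thesis
    unfolding i_def[symmetric] k_def[symmetric]
  proof (cases "i \<in> S")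
    case True
    then show "comm (interval j k) (rootv E j k) [i] (E i)"
      using odd_middle[of j] assms unfolding comm_def iv v w bracket_eq_0[symmetric]
      by (simp add: i_def k_def)
  next
    case False
    define p where "p = Q i i"
    have ij: "E j * E k = Q j k \<cdot> (E k * E j)" using far[of j k] assms by (simp add: k_def i_def)
    have uy: "rootv E j i * E i = (Q j i * p) \<cdot> (E i * rootv E j i)"
      using comm_last[of j i] assms unfolding comm_def iv by (simp add: i_def p_def)
    have yw: "E i * rootv E i k = (p * Q i k) \<cdot> (rootv E i k * E i)"
      using comm_first[of i k] assms unfolding comm_def iv by (simp add: i_def k_def p_def)
    from bracket_middle[OF u w v uy yw ij]
    have 1: "(1 + p) \<cdot> Q j i \<cdot> (E i * rootv E j k) = (1 + p) \<cdot> Q i k \<cdot> (rootv E j k * E i)"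
      by (simp add: mult.commute)
    have "1 + p \<noteq> 0"
      using Q_diag_not_minus_1[of i] False assms by (auto simp: p_def i_def add_eq_0_iff)
    from scl_cancel[OF 1 this]
    have "(p * Q k i) \<cdot> Q j i \<cdot> (E i * rootv E j k) = (p * Q k i) \<cdot> Q i k \<cdot> (rootv E j k * E i)" by simp
    moreover have "p * Q k i * Q i k = 1"
      using qtilde_even(2)[of i] False assms by (simp add: p_def qtilde_def i_def k_def ac_simps)
    ultimately have "rootv E j k * E i = (p * Q k i * Q j i) \<cdot> (E i * rootv E j k)" by simp
    then show "comm (interval j k) (rootv E j k) [i] (E i)"
      unfolding comm_def iv by (simp add: p_def ac_simps)
  qed
qed

text \<open>Only the letters \<open>i - 1\<close>, \<open>i\<close>, \<open>i + 1\<close> interact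
  with \<open>E i\<close>; the parts of the root on either side of them are far from
  \<open>i\<close> and are attached by \<open>rootv_split\<close>.\<close>

lemma comm_middle:
  assumes "1 \<le> j" "j < i" "i < k" "k \<le> \<theta>"
  shows "comm (interval j k) (rootv E j k) [i] (E i)"
proof -
  define h where "h = i - 1"
  have h: "i = Suc h" "1 \<le> h" "j \<le> h" using assms by (auto simp: h_def)
  have 1: "comm (interval h k) (rootv E h k) [i] (E i)"
  proof (cases "k = Suc i")
    case True
    then show ?thesis using comm_middle_3[of h] h assms by simp
  next
    case False
    have "comm (interval (Suc (Suc i)) k) (rootv E (Suc (Suc i)) k) [i] (E i)"
      using False assms by (intro comm_root_left comm_far) auto
    then have "comm (interval h (Suc i) @ interval (Suc (Suc i)) k) (rootv E h k) [i] (E i)"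
      using rootv_split[of h "Suc i" k] comm_middle_3[of h] h assms False
      by (auto simp del: upt_Suc intro!: comm_bracket_left)
    then show ?thesis using interval_split[of h "Suc i" k] h assms False by simp
  qed
  show ?thesis
  proof (cases "j = h")
    case False
    have "comm (interval j (h - 1)) (rootv E j (h - 1)) [i] (E i)"
      using False assms h by (intro comm_root_left comm_far) auto
    then have "comm (interval j (h - 1) @ interval h k) (rootv E j k) [i] (E i)"
      using 1 False assms h rootv_split[of j "h - 1" k]
      by (auto simp del: upt_Suc intro!: comm_bracket_left)
    then show ?thesis using interval_split[of j "h - 1" k] assms h False by simp
  qed (use 1 in simp)
qed

lemma comm_suffix:
  assumes "1 \<le> l" "l < m" "m \<le> k" "k \<le> \<theta>"
  shows "comm (interval l k) (rootv E l k) (interval m k) (rootv E m k)"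
proof (rule comm_root_right)
  fix i assume "m \<le> i" "i \<le> k"
  then show "comm (interval l k) (rootv E l k) [i] (E i)"
    using comm_middle[of l i k] comm_last[of l k] assms by (cases "i = k") auto
qed (use assms in simp)

text \<open>Each \<open>E i\<close> now stands on the left. For inner \<open>i\<close> the rule of
  \<open>comm_middle\<close> is reversed by \<open>word_chi_inner\<close>; for \<open>i = j\<close>
  the two bicharacter values are not inverse to each other, and \<open>comm_first\<close> supplies
  the rule directly.\<close>

lemma comm_prefix:
  assumes "1 \<le> j" "j \<le> l" "l < m" "m \<le> \<theta>"
  shows "comm (interval j l) (rootv E j l) (interval j m) (rootv E j m)"
proof (rule comm_root_left)
  fix i assume i: "j \<le> i" "i \<le> l"
  show "comm [i] (E i) (interval j m) (rootv E j m)"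
  proof (cases "i = j")
    case False
    then have "comm (interval j m) (rootv E j m) [i] (E i)" using i assms by (intro comm_middle) auto
    then show ?thesis by (rule comm_sym) (use word_chi_inner[of j i m] i assms False in simp)
  qed (use comm_first assms in simp)
qed (use assms in simp)

lemma odd_root_square:
  assumes "1 \<le> j" "j \<le> k" "k \<le> \<theta>" "odd (card (S \<inter> {j..k}))"
  shows "rootv E j k * rootv E j k = 0"
proof (cases "j = k")
  case True
  then have "k \<in> S" using assms by (cases "k \<in> S") auto
  then show ?thesis using True odd_square by simp
next
  case False
  define x y v where "x = E j" and "y = rootv E (Suc j) k" and "v = rootv E j k"
  let ?Y = "interval (Suc j) k"
  have jk: "interval j k = [j] @ ?Y" using interval_Cons[OF assms(2)] by simp
  define a where "a = word_chi Q [j] ?Y"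
  have v: "v = bracket a x y" using rootv_step[of j k] False assms by (simp add: v_def x_def y_def a_def)
  have xv: "x * v = (Q j j * a) \<cdot> (v * x)"
    using comm_first[of j k] False assms unfolding jk by (simp add: comm_def x_def v_def a_def del: upt_Suc)
  define b where "b = word_chi Q ?Y ?Y"
  have vy: "v * y = (a * b) \<cdot> (y * v)"
    using comm_suffix[of j "Suc j" k] False assms unfolding jk
    by (simp add: comm_def y_def v_def a_def b_def del: upt_Suc)
  \<comment> \<open>The right factor \<open>v\<close> is opened as
    \<open>x * y - a \<cdot> (y * x)\<close>. Carrying the other \<open>v\<close> to the right past
    \<open>x\<close> and \<open>y\<close> and closing the bracket again gives a second scalar in
    front of \<open>v * v\<close>.\<close>
  have "(Q j j * a) \<cdot> (v * v) = ((Q j j * a) \<cdot> (v * x)) * y - (Q j j * a * a) \<cdot> ((v * y) * x)"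
    by (subst (2) v) (simp add: bracket_def algebra_simps scl_distribs)
  also have "\<dots> = x * (v * y) - (a * a * b) \<cdot> (y * ((Q j j * a) \<cdot> (v * x)))"
  proof -
    have "((Q j j * a) \<cdot> (v * x)) * y = x * (v * y)" by (simp only: xv[symmetric] mult.assoc)
    moreover have "(Q j j * a * a) \<cdot> ((v * y) * x) = (a * a * b) \<cdot> (y * ((Q j j * a) \<cdot> (v * x)))"
      by (simp add: vy ac_simps)
    ultimately show ?thesis by simp
  qed
  also have "\<dots> = (a * b) \<cdot> ((x * y) * v) - (a * a * b) \<cdot> ((y * x) * v)"
    unfolding xv[symmetric] by (simp add: vy mult.assoc)
  also have "\<dots> = (a * b) \<cdot> (v * v)"
    by (subst (3) v) (simp add: bracket_def algebra_simps scl_distribs)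
  finally have "a \<cdot> (Q j j - b) \<cdot> (v * v) = 0"
    by (simp add: algebra_simps scl_distribs)
  moreover have "a \<noteq> 0"
    unfolding a_def using assms by (intro word_chi_nonzero Q_nonzero) auto
  moreover have "Q j j - b \<noteq> 0"
  proof -
    have *: "card (S \<inter> {j..k}) = (if j \<in> S then Suc (card (S \<inter> {Suc j..k})) else card (S \<inter> {Suc j..k}))"
    proof -
      have "S \<inter> {j..k} = (if j \<in> S then insert j (S \<inter> {Suc j..k}) else S \<inter> {Suc j..k})"
        using assms(2) by (auto simp: Suc_le_eq le_less)
      then show ?thesis using finite_S by simp
    qed
    show ?thesis
      using word_chi_root[of "Suc j" k] Q_diag[of j] assms False * inverse_level_not_minus_1[of j]
        inverse_level_not_minus_1[of k] unfolding b_def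
      by (cases "j \<in> S") (auto simp del: upt_Suc simp: eq_commute[of _ "- 1"])
  qed
  ultimately show ?thesis unfolding v_def by (metis scl_eq_0D)
qed

end

section \<open>Two families of generators that braid\<close>

text \<open>The families stand for E_i (x) 1 and 1 (x) E_i; \<open>cross\<close> is all that the
  computations of this locale use of the braided product.\<close>

locale braided_pair = super_scaled_ring \<theta> S q Q scl
    + A: super_relations \<theta> S q Q scl a + B: super_relations \<theta> S q Q scl b
  for \<theta> S and q :: "'k::field" and Q and scl :: "'k \<Rightarrow> 'a::ring_1 \<Rightarrow> 'a" (infixr "\<cdot>" 75) and a b +
  assumes cross: "i \<in> {1..\<theta>} \<Longrightarrow> j \<in> {1..\<theta>} \<Longrightarrow> b i * a j = Q i j \<cdot> (a j * b i)"
begin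

lemma cross_roots:
  assumes "1 \<le> j" "j \<le> k" "k \<le> \<theta>" "1 \<le> l" "l \<le> m" "m \<le> \<theta>"
  shows "comm (interval j k) (rootv b j k) (interval l m) (rootv a l m)"
  using assms by (intro comm_root_left comm_root_right) (auto simp: comm_def cross)

lemma cross_root_left: "\<lbrakk>1 \<le> j; j \<le> k; k \<le> \<theta>; i \<in> {1..\<theta>}\<rbrakk> \<Longrightarrow> comm (interval j k) (rootv b j k) [i] (a i)"
  using cross_roots[of j k i i] by auto

lemma cross_root_right: "\<lbrakk>1 \<le> j; j \<le> k; k \<le> \<theta>; i \<in> {1..\<theta>}\<rbrakk> \<Longrightarrow> comm [i] (b i) (interval j k) (rootv a j k)"
  using cross_roots[of i i j k] by auto

definition summand :: "nat \<Rightarrow> nat \<Rightarrow> nat \<Rightarrow> 'a" where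
  "summand j k l = (1 - qtilde Q l (Suc l)) \<cdot> (rootv a j l * rootv b (Suc l) k)"

text \<open>A mixed term grows by one letter on the left: \<open>a j\<close> passes the
  \<open>b\<close> factor, to whose degree alpha_j is orthogonal, and enlarges the \<open>a\<close>
  factor, whereas \<open>b j\<close> commutes with the whole term up to exactly the scalar of the
  bracket.\<close>

lemma bracket_summand:
  assumes "1 \<le> j" "j < l" "l < k" "k \<le> \<theta>"
  shows "bracket (word_chi Q [j] (interval (Suc j) k)) (a j) (summand (Suc j) k l) = summand j k l"
    and "bracket (word_chi Q [j] (interval (Suc j) k)) (b j) (summand (Suc j) k l) = 0"
proof -
  let ?u = "interval (Suc j) l" and ?v = "interval (Suc l) k"
  have c: "word_chi Q [j] (interval (Suc j) k) = word_chi Q [j] ?u * word_chi Q [j] ?v"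
    using interval_split[of "Suc j" l k] assms by simp
  have "comm ?v (rootv b (Suc l) k) [j] (a j)"
    using assms by (intro cross_root_left) auto
  moreover have "word_chi Q [j] ?v * word_chi Q ?v [j] = 1"
    using assms by (intro word_chi_far) auto
  ultimately have "word_chi Q [j] ?v \<cdot> (rootv b (Suc l) k * a j) = a j * rootv b (Suc l) k"
    by (simp add: comm_def del: upt_Suc)
  then have "bracket (word_chi Q [j] ?u * word_chi Q [j] ?v) (a j) (rootv a (Suc j) l * rootv b (Suc l) k)
    = rootv a j l * rootv b (Suc l) k"
    using rootv_step[of j l a] assms
    by (simp add: bracket_def mult.assoc left_diff_distrib del: upt_Suc)
      (metis mult_scl_right scl_scl)
  then show "bracket (word_chi Q [j] (interval (Suc j) k)) (a j) (summand (Suc j) k l) = summand j k l"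
    by (simp only: summand_def bracket_scl_right c)
  have "comm [j] (b j) ?u (rootv a (Suc j) l)"
    using assms by (intro cross_root_right) auto
  moreover have "comm [j] (b j) ?v (rootv b (Suc l) k)"
    using assms by (intro comm_root_right B.comm_far) auto
  ultimately have "b j * (rootv a (Suc j) l * rootv b (Suc l) k)
    = (word_chi Q [j] ?u * word_chi Q [j] ?v) \<cdot> ((rootv a (Suc j) l * rootv b (Suc l) k) * b j)"
    unfolding comm_def by (simp add: mult.assoc[symmetric] del: upt_Suc) (simp add: mult.assoc del: upt_Suc)
  then have "bracket (word_chi Q [j] ?u * word_chi Q [j] ?v) (b j) (rootv a (Suc j) l * rootv b (Suc l) k) = 0"
    by (simp add: bracket_eq_0 del: upt_Suc)
  then show "bracket (word_chi Q [j] (interval (Suc j) k)) (b j) (summand (Suc j) k l) = 0"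
    by (simp only: summand_def bracket_scl_right c scl_zero_right)
qed

text \<open>Each step creates one new mixed term, from \<open>a j\<close> and
  \<open>rootv b (Suc j) k\<close>: the scalar of the bracket and that of the exchange multiply to
  q~_{j,j+1}, whence the coefficient 1 - q~_{j,j+1}. The opposite mixed bracket, of
  \<open>b j\<close> with \<open>rootv a (Suc j) k\<close>, vanishes.\<close>

lemma rootv_add:
  assumes "1 \<le> j" "j \<le> k" "k \<le> \<theta>"
  shows "rootv (\<lambda>i. a i + b i) j k = rootv a j k + rootv b j k + (\<Sum>l\<in>{j..<k}. summand j k l)"
  using assms(2,1)
proof (induction j rule: inc_induct)
  case (step j)
  let ?c = "word_chi Q [j] (interval (Suc j) k)" and ?d = "\<lambda>i. a i + b i"
  have "rootv ?d j k = bracket ?c (a j + b j) (rootv a (Suc j) k + rootv b (Suc j) k + (\<Sum>l\<in>{Suc j..<k}. summand (Suc j) k l))"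
    using step by (simp add: rootv_step del: upt_Suc)
  also have "\<dots> = bracket ?c (a j) (rootv a (Suc j) k) + bracket ?c (b j) (rootv a (Suc j) k)
      + bracket ?c (a j) (rootv b (Suc j) k) + bracket ?c (b j) (rootv b (Suc j) k)
      + (\<Sum>l\<in>{Suc j..<k}. bracket ?c (a j) (summand (Suc j) k l) + bracket ?c (b j) (summand (Suc j) k l))"
    by (simp add: bracket_add_left bracket_add_right bracket_sum_right sum.distrib algebra_simps del: upt_Suc)
  also have "(\<Sum>l\<in>{Suc j..<k}. bracket ?c (a j) (summand (Suc j) k l) + bracket ?c (b j) (summand (Suc j) k l))
      = (\<Sum>l\<in>{Suc j..<k}. summand j k l)"
    using step assms by (intro sum.cong) (auto simp: bracket_summand simp del: upt_Suc)
  also have "bracket ?c (a j) (rootv a (Suc j) k) = rootv a j k"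
    using step by (simp add: rootv_step del: upt_Suc)
  also have "bracket ?c (b j) (rootv b (Suc j) k) = rootv b j k"
    using step by (simp add: rootv_step del: upt_Suc)
  also have "bracket ?c (b j) (rootv a (Suc j) k) = 0"
    using cross_root_right[of "Suc j" k j] step assms by (simp add: bracket_eq_0 comm_def del: upt_Suc)
  also have "bracket ?c (a j) (rootv b (Suc j) k) = summand j k j"
  proof -
    have "?c * word_chi Q (interval (Suc j) k) [j] = qtilde Q j (Suc j)"
      using word_chi_adjacent[of j j k] step assms by (simp add: upt_conv_Cons del: upt_Suc)
    then show ?thesis
      using cross_root_left[of "Suc j" k j] step assms
      by (simp add: bracket_def comm_def summand_def scl_distribs del: upt_Suc)
  qed
  also have "rootv a j k + 0 + summand j k j + rootv b j k + (\<Sum>l\<in>{Suc j..<k}. summand j k l)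
     = rootv a j k + rootv b j k + (\<Sum>l\<in>{j..<k}. summand j k l)"
    using step by (simp add: sum.atLeast_Suc_lessThan[of j k])
  finally show ?case .
qed simp

end

section \<open>Exchange of summands and powers of the expanded root vector\<close>

lemma root_of_unity_order_inverse:
  "is_root_of_unity_of_order q N \<Longrightarrow> is_root_of_unity_of_order (inverse q) N"
  by (simp add: is_root_of_unity_of_order_def power_inverse)

context braided_pair
begin

text \<open>Cut the root into \<open>u\<close>, \<open>v\<close>, \<open>w\<close> at
  \<open>l\<close> and \<open>m\<close>. The first reorderings yield every factor of chi(u+v+w,
  u+v+w) except chi(u, w). The exchange of \<open>bm\<close> and \<open>al\<close> accounts for it,
  because \<open>u\<close> and \<open>w\<close> are separated by the nonempty \<open>v\<close> and
  hence orthogonal.\<close>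

lemma summand_commute:
  assumes "1 \<le> j" "j \<le> l" "l < m" "m < k" "k \<le> \<theta>"
  shows "summand j k l * summand j k m
    = word_chi Q (interval j k) (interval j k) \<cdot> (summand j k m * summand j k l)"
proof -
  define u v w where "u = interval j l" and "v = interval (Suc l) m" and "w = interval (Suc m) k"
  define al am bl bm where "al = rootv a j l" and "am = rootv a j m"
    and "bl = rootv b (Suc l) k" and "bm = rootv b (Suc m) k"
  have iv: "interval j m = u @ v" "interval (Suc l) k = v @ w" "interval j k = u @ v @ w"
    using interval_split[of j l m] interval_split[of "Suc l" m k] interval_split[of j l k] assms
    by (simp_all add: u_def v_def w_def del: upt_Suc)
  have 1: "bl * am = word_chi Q (v @ w) (u @ v) \<cdot> (am * bl)"
    using cross_roots[of "Suc l" k j m] assms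
    by (simp add: comm_def am_def bl_def iv del: upt_Suc word_chi_simps)
  have 2: "bm * al = word_chi Q w u \<cdot> (al * bm)"
    using cross_roots[of "Suc m" k j l] assms
    by (simp add: comm_def al_def am_def bl_def bm_def u_def w_def del: upt_Suc)
  have 3: "al * am = word_chi Q u (u @ v) \<cdot> (am * al)"
    using A.comm_prefix[of j l m] assms iv
    by (simp add: comm_def al_def am_def u_def del: upt_Suc)
  have 4: "bl * bm = word_chi Q (v @ w) w \<cdot> (bm * bl)"
    using B.comm_suffix[of "Suc l" "Suc m" k] assms iv
    by (simp add: comm_def bl_def bm_def w_def del: upt_Suc)
  have uw: "word_chi Q w u * word_chi Q u w = 1"
    unfolding u_def w_def using assms by (intro word_chi_far) auto
  have "(al * bl) * (am * bm) = al * (bl * am) * bm" by (simp add: mult.assoc)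
  also have "\<dots> = word_chi Q (v @ w) (u @ v) \<cdot> ((al * am) * (bl * bm))"
    by (simp only: 1 mult_scl_right mult_scl_left mult.assoc)
  also have "\<dots> = (word_chi Q (v @ w) (u @ v) * word_chi Q u (u @ v) * word_chi Q (v @ w) w) \<cdot> (am * (al * bm) * bl)"
    by (simp only: 3 4 mult_scl_right mult_scl_left mult.assoc scl_scl) (simp only: ac_simps)
  also have "word_chi Q (v @ w) (u @ v) * word_chi Q u (u @ v) * word_chi Q (v @ w) w
      = word_chi Q (u @ v @ w) (u @ v @ w) * word_chi Q w u"
  proof -
    have "word_chi Q (u @ v @ w) (u @ v @ w) * word_chi Q w u
      = word_chi Q (v @ w) (u @ v) * word_chi Q u (u @ v) * word_chi Q (v @ w) w * (word_chi Q w u * word_chi Q u w)"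
      by (simp only: word_chi_simps(3,4) ac_simps)
    then show ?thesis unfolding uw mult_1_right by (rule sym)
  qed
  also have "(word_chi Q (u @ v @ w) (u @ v @ w) * word_chi Q w u) \<cdot> (am * (al * bm) * bl)
      = word_chi Q (u @ v @ w) (u @ v @ w) \<cdot> (am * (word_chi Q w u \<cdot> (al * bm)) * bl)"
    by (simp only: mult_scl_right mult_scl_left scl_scl)
  also have "\<dots> = word_chi Q (u @ v @ w) (u @ v @ w) \<cdot> ((am * bm) * (al * bl))"
    by (simp only: 2[symmetric] mult.assoc)
  finally show ?thesis
    unfolding summand_def iv(3) al_def am_def bl_def bm_def
    by (simp only: mult_scl_right mult_scl_left scl_scl ac_simps)
qed

text \<open>In the order of the summands, \<open>rootv b j k\<close> behaves like one more term
  before all the others, and \<open>rootv a j k\<close> like one more after them.\<close>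

lemma summand_commute_first:
  assumes "1 \<le> j" "j \<le> l" "l < k" "k \<le> \<theta>"
  shows "rootv b j k * summand j k l = word_chi Q (interval j k) (interval j k) \<cdot> (summand j k l * rootv b j k)"
proof -
  define u v where "u = interval j l" and "v = interval (Suc l) k"
  have iv: "interval j k = u @ v"
    using interval_split[of j l k] assms by (simp add: u_def v_def del: upt_Suc)
  have 1: "rootv b j k * rootv a j l = word_chi Q (u @ v) u \<cdot> (rootv a j l * rootv b j k)"
    using cross_roots[of j k j l] assms iv by (simp add: comm_def u_def del: upt_Suc)
  have 2: "rootv b j k * rootv b (Suc l) k = word_chi Q (u @ v) v \<cdot> (rootv b (Suc l) k * rootv b j k)"
    using B.comm_suffix[of j "Suc l" k] assms iv by (simp add: comm_def v_def del: upt_Suc)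
  have "rootv b j k * (rootv a j l * rootv b (Suc l) k)
    = word_chi Q (u @ v) u \<cdot> (rootv a j l * (rootv b j k * rootv b (Suc l) k))"
    by (simp only: 1 mult.assoc[symmetric] mult_scl_left)
  also have "\<dots> = word_chi Q (u @ v) (u @ v) \<cdot> ((rootv a j l * rootv b (Suc l) k) * rootv b j k)"
    by (simp only: 2 mult.assoc mult_scl_right scl_scl word_chi_simps(4))
  finally show ?thesis
    unfolding summand_def iv by (simp only: mult_scl_right mult_scl_left scl_scl ac_simps)
qed

lemma summand_commute_last:
  assumes "1 \<le> j" "j \<le> l" "l < k" "k \<le> \<theta>"
  shows "summand j k l * rootv a j k = word_chi Q (interval j k) (interval j k) \<cdot> (rootv a j k * summand j k l)"
proof -
  define u v where "u = interval j l" and "v = interval (Suc l) k"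
  have iv: "interval j k = u @ v"
    using interval_split[of j l k] assms by (simp add: u_def v_def del: upt_Suc)
  have 1: "rootv a j l * rootv a j k = word_chi Q u (u @ v) \<cdot> (rootv a j k * rootv a j l)"
    using A.comm_prefix[of j l k] assms iv by (simp add: comm_def u_def del: upt_Suc)
  have 2: "rootv b (Suc l) k * rootv a j k = word_chi Q v (u @ v) \<cdot> (rootv a j k * rootv b (Suc l) k)"
    using cross_roots[of "Suc l" k j k] assms iv by (simp add: comm_def v_def del: upt_Suc)
  have "(rootv a j l * rootv b (Suc l) k) * rootv a j k
    = word_chi Q v (u @ v) \<cdot> ((rootv a j l * rootv a j k) * rootv b (Suc l) k)"
    by (simp only: 2 mult.assoc mult_scl_right)
  also have "\<dots> = word_chi Q (u @ v) (u @ v) \<cdot> (rootv a j k * (rootv a j l * rootv b (Suc l) k))"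
    by (simp only: 1 mult.assoc mult_scl_left scl_scl word_chi_simps(3) mult.commute)
  finally show ?thesis
    unfolding summand_def iv by (simp only: mult_scl_right mult_scl_left scl_scl ac_simps)
qed

text \<open>The \<open>b\<close> factor has to pass the \<open>a\<close> factor, so the bicharacter
  appears with the degree of the right tensor factor first. For odd alpha_{j,l} the exponent
  \<open>N\<close>, being at least 2, exposes the square of an odd root vector.\<close>

lemma summand_power:
  assumes "1 \<le> j" "j \<le> l" "l < k" "k \<le> \<theta>" "2 \<le> N"
  shows "summand j k l ^ N = (if even (card (S \<inter> {j..l}))
    then ((1 - qtilde Q l (Suc l)) ^ N * word_chi Q (interval (Suc l) k) (interval j l) ^ (N * (N - 1) div 2))
      \<cdot> (rootv a j l ^ N * rootv b (Suc l) k ^ N) else 0)"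
proof -
  have "rootv b (Suc l) k * rootv a j l
      = word_chi Q (interval (Suc l) k) (interval j l) \<cdot> (rootv a j l * rootv b (Suc l) k)"
    using cross_roots[of "Suc l" k j l] assms by (simp add: comm_def del: upt_Suc)
  from power_mult_commuting[OF this]
  have "summand j k l ^ N
    = ((1 - qtilde Q l (Suc l)) ^ N * word_chi Q (interval (Suc l) k) (interval j l) ^ (N * (N - 1) div 2))
      \<cdot> (rootv a j l ^ N * rootv b (Suc l) k ^ N)"
    by (simp only: summand_def power_scl scl_scl)
  moreover have "rootv a j l ^ N = 0" if "odd (card (S \<inter> {j..l}))"
  proof -
    have "rootv a j l ^ 2 = 0"
      using A.odd_root_square[of j l] assms that by (simp add: power2_eq_square)
    then show ?thesis
      using assms(5) by (metis le_add_diff_inverse power_add mult_zero_left)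
  qed
  ultimately show ?thesis by simp
qed

lemma rootv_add_power:
  assumes jk: "1 \<le> j" "j \<le> k" "k \<le> \<theta>" and even: "even (card (S \<inter> {j..k}))"
    and q: "is_root_of_unity_of_order q N" and N: "2 \<le> N"
  shows "rootv (\<lambda>i. a i + b i) j k ^ N = rootv a j k ^ N + rootv b j k ^ N
    + (\<Sum>l\<in>{l. j \<le> l \<and> l < k \<and> even (card (S \<inter> {j..l}))}.
        ((1 - qtilde Q l (Suc l)) ^ N * word_chi Q (interval (Suc l) k) (interval j l) ^ (N * (N - 1) div 2))
          \<cdot> (rootv a j l ^ N * rootv b (Suc l) k ^ N))"
proof -
  define p where "p = word_chi Q (interval j k) (interval j k)"
  have "p = inverse (level k)" using word_chi_root[OF jk] even by (simp add: p_def)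
  then have p: "is_root_of_unity_of_order p N"
    using q root_of_unity_order_inverse[OF q] by (simp add: level_def)
  let ?X = "\<Sum>l\<in>{j..<k}. summand j k l"
  have "rootv b j k * ?X = p \<cdot> (?X * rootv b j k)"
    unfolding sum_distrib_left sum_distrib_right scl_sum_right p_def
    by (intro sum.cong) (use jk in \<open>auto intro!: summand_commute_first simp del: upt_Suc\<close>)
  from power_add_root_of_unity[OF this p]
  have 1: "(?X + rootv b j k) ^ N = ?X ^ N + rootv b j k ^ N" .
  have "?X * rootv a j k = p \<cdot> (rootv a j k * ?X)"
    unfolding sum_distrib_left sum_distrib_right scl_sum_right p_def
    by (intro sum.cong) (use jk in \<open>auto intro!: summand_commute_last simp del: upt_Suc\<close>)
  moreover have "rootv b j k * rootv a j k = p \<cdot> (rootv a j k * rootv b j k)"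
    using cross_roots[of j k j k] jk by (simp add: comm_def p_def del: upt_Suc)
  ultimately have "(?X + rootv b j k) * rootv a j k = p \<cdot> (rootv a j k * (?X + rootv b j k))"
    by (simp only: ring_distribs scl_add_right)
  from power_add_root_of_unity[OF this p] 1
  have "rootv (\<lambda>i. a i + b i) j k ^ N = rootv a j k ^ N + rootv b j k ^ N + ?X ^ N"
    by (simp add: rootv_add[OF jk] ac_simps)
  also have "?X ^ N = (\<Sum>l\<in>{j..<k}. summand j k l ^ N)"
    using jk by (intro power_sum_root_of_unity[OF _ p]) (auto simp: p_def intro!: summand_commute simp del: upt_Suc)
  also have "\<dots> = (\<Sum>l\<in>{j..<k}. if even (card (S \<inter> {j..l}))
    then ((1 - qtilde Q l (Suc l)) ^ N * word_chi Q (interval (Suc l) k) (interval j l) ^ (N * (N - 1) div 2))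
      \<cdot> (rootv a j l ^ N * rootv b (Suc l) k ^ N) else 0)"
    using jk N by (intro sum.cong summand_power) auto
  also have "\<dots> = (\<Sum>l\<in>{l \<in> {j..<k}. even (card (S \<inter> {j..l}))}.
        ((1 - qtilde Q l (Suc l)) ^ N * word_chi Q (interval (Suc l) k) (interval j l) ^ (N * (N - 1) div 2))
          \<cdot> (rootv a j l ^ N * rootv b (Suc l) k ^ N))"
    by (simp only: sum.inter_filter finite_atLeastLessThan)
  also have "{l \<in> {j..<k}. even (card (S \<inter> {j..l}))} = {l. j \<le> l \<and> l < k \<and> even (card (S \<inter> {j..l}))}"
    by auto
  finally show ?thesis .
qed

text \<open>\<open>rootv_add\<close> expands the inner bracket. Of the brackets of its terms with
  \<open>a i\<close> and \<open>b i\<close>, only those of \<open>a j * w\<^sub>2\<close> with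
  \<open>a i\<close> and of \<open>u\<^sub>1 * b k\<close> with \<open>b i\<close> survive, both
  multiples of \<open>u\<^sub>1 * w\<^sub>2\<close>. After multiplication by the nonzero
  \<open>Q i k\<close> their coefficients add up to q~_{ji} q~_{ik} - 1, which is 0 at an odd
  vertex.\<close>

lemma odd_middle_add:
  assumes "1 \<le> j" "Suc (Suc j) \<le> \<theta>" "Suc j \<in> S"
  shows "bracket (word_chi Q [j, Suc j, Suc (Suc j)] [Suc j])
    (rootv (\<lambda>i. a i + b i) j (Suc (Suc j))) (a (Suc j) + b (Suc j)) = 0"
proof -
  define i k where "i = Suc j" and "k = Suc i"
  have iv: "interval j k = [j, i, k]" "interval i k = [i, k]" "interval j i = [j, i]"
    by (simp_all add: i_def k_def)
  define C where "C = word_chi Q [j, i, k] [i]"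
  have Qi: "Q i i = -1" using assms Q_odd by (simp add: i_def)
  have C: "C = - (Q j i * Q k i)" by (simp add: C_def Qi)
  have t: "qtilde Q j i * qtilde Q i k = 1"
    using qtilde_odd[of j] assms by (simp add: i_def k_def)
  define v\<^sub>1 v\<^sub>2 u\<^sub>1 w\<^sub>2 where "v\<^sub>1 = rootv a j k" and "v\<^sub>2 = rootv b j k" and "u\<^sub>1 = rootv a j i" and "w\<^sub>2 = rootv b i k"
  have u\<^sub>1: "u\<^sub>1 = a j * a i - Q j i \<cdot> (a i * a j)"
    by (simp add: u\<^sub>1_def i_def rootv_step bracket_def)
  have w\<^sub>2: "w\<^sub>2 = b i * b k - Q i k \<cdot> (b k * b i)"
    by (simp add: w\<^sub>2_def k_def rootv_step bracket_def)
  have aa: "a i * a i = 0" "a i * (a i * x) = 0" and bb: "b i * b i = 0" "b i * (b i * x) = 0" for x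
    using A.odd_square[of i] B.odd_square[of i] assms by (simp_all add: i_def flip: mult.assoc)
  have D: "rootv (\<lambda>i. a i + b i) j k
    = v\<^sub>1 + v\<^sub>2 + (1 - qtilde Q j i) \<cdot> (a j * w\<^sub>2) + (1 - qtilde Q i k) \<cdot> (u\<^sub>1 * b k)"
    using rootv_add[of j k] assms
    by (simp add: i_def k_def v\<^sub>1_def v\<^sub>2_def u\<^sub>1_def w\<^sub>2_def summand_def algebra_simps)
  have b1: "bracket C v\<^sub>1 (a i) = 0" "bracket C v\<^sub>2 (b i) = 0"
    using A.comm_middle[of j i k] B.comm_middle[of j i k] assms unfolding iv
    by (simp_all add: bracket_eq_0 comm_def v\<^sub>1_def v\<^sub>2_def C_def i_def k_def)
  have b2: "bracket C v\<^sub>2 (a i) = 0"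
    using cross_root_left[of j k i] assms unfolding iv
    by (simp add: bracket_eq_0 comm_def v\<^sub>2_def C_def i_def k_def)
  have b3: "bracket C v\<^sub>1 (b i) = 0"
  proof -
    have "comm (interval j k) v\<^sub>1 [i] (b i)"
      using cross_root_right[of j k i] word_chi_inner[of j i k] assms
      by (intro comm_sym[of "[i]"]) (auto simp: v\<^sub>1_def i_def k_def mult.commute)
    then show ?thesis unfolding iv by (simp add: bracket_eq_0 comm_def C_def)
  qed
  have wa: "w\<^sub>2 * a i = - (Q k i \<cdot> (a i * w\<^sub>2))"
    using cross_root_left[of i k i] assms unfolding iv
    by (simp add: comm_def w\<^sub>2_def i_def k_def Qi[unfolded i_def])
  have b4: "bracket C (a j * w\<^sub>2) (a i) = - (Q k i \<cdot> (u\<^sub>1 * w\<^sub>2))"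
  proof -
    have "bracket C (a j * w\<^sub>2) (a i) = a j * (w\<^sub>2 * a i) - C \<cdot> (a i * a j * w\<^sub>2)"
      by (simp add: bracket_def mult.assoc)
    also have "\<dots> = - (Q k i \<cdot> ((a j * a i - Q j i \<cdot> (a i * a j)) * w\<^sub>2))"
      by (simp add: wa C algebra_simps scl_distribs)
    finally show ?thesis by (simp add: u\<^sub>1)
  qed
  have ba: "b i * a j = Q i j \<cdot> (a j * b i)" using cross[of i j] assms by (simp add: i_def)
  have b5: "bracket C (a j * w\<^sub>2) (b i) = 0"
  proof -
    have wb: "w\<^sub>2 * b i = b i * (b k * b i)" "b i * w\<^sub>2 = - (Q i k \<cdot> (b i * (b k * b i)))"
      by (simp_all add: w\<^sub>2 algebra_simps bb)
    have "bracket C (a j * w\<^sub>2) (b i) = a j * (w\<^sub>2 * b i) - C \<cdot> ((b i * a j) * w\<^sub>2)"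
      by (simp add: bracket_def mult.assoc)
    also have "\<dots> = a j * (w\<^sub>2 * b i) - (C * Q i j) \<cdot> (a j * (b i * w\<^sub>2))"
      by (simp add: ba mult.assoc)
    also have "\<dots> = (1 - qtilde Q j i * qtilde Q i k) \<cdot> (a j * (b i * (b k * b i)))"
      by (simp add: wb C qtilde_def scl_distribs ac_simps)
    finally show ?thesis by (simp add: t)
  qed
  have bka: "b k * a i = Q k i \<cdot> (a i * b k)" using cross[of k i] assms by (simp add: i_def k_def)
  have b6: "bracket C (u\<^sub>1 * b k) (a i) = 0"
  proof -
    have ua: "u\<^sub>1 * a i = - (Q j i \<cdot> (a i * (a j * a i)))" "a i * u\<^sub>1 = a i * (a j * a i)"
      by (simp_all add: u\<^sub>1 algebra_simps aa)
    have "bracket C (u\<^sub>1 * b k) (a i) = u\<^sub>1 * (b k * a i) - C \<cdot> (a i * u\<^sub>1 * b k)"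
      by (simp add: bracket_def mult.assoc)
    also have "\<dots> = Q k i \<cdot> ((u\<^sub>1 * a i) * b k) - C \<cdot> ((a i * u\<^sub>1) * b k)"
      by (simp add: bka mult.assoc)
    finally show ?thesis by (simp add: ua C ac_simps)
  qed
  have b7: "Q i k \<cdot> bracket C (u\<^sub>1 * b k) (b i) = - (u\<^sub>1 * w\<^sub>2)"
  proof -
    have bu: "b i * u\<^sub>1 = - (Q i j \<cdot> (u\<^sub>1 * b i))"
      using cross_root_right[of j i i] assms unfolding iv
      by (simp add: comm_def u\<^sub>1_def i_def Qi[unfolded i_def])
    have "bracket C (u\<^sub>1 * b k) (b i) = u\<^sub>1 * (b k * b i) - C \<cdot> ((b i * u\<^sub>1) * b k)"
      by (simp add: bracket_def mult.assoc)
    also have "\<dots> = u\<^sub>1 * (b k * b i) - (qtilde Q j i * Q k i) \<cdot> (u\<^sub>1 * (b i * b k))"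
      by (simp add: bu C mult.assoc qtilde_def ac_simps)
    also have "Q i k \<cdot> \<dots> = Q i k \<cdot> (u\<^sub>1 * (b k * b i)) - (qtilde Q j i * qtilde Q i k) \<cdot> (u\<^sub>1 * (b i * b k))"
      by (simp add: scl_distribs qtilde_def ac_simps)
    finally show ?thesis unfolding t by (simp add: w\<^sub>2 algebra_simps)
  qed
  have "Q i k \<cdot> bracket C (rootv (\<lambda>i. a i + b i) j k) (a i + b i)
    = ((1 - qtilde Q j i) * Q i k) \<cdot> (- (Q k i \<cdot> (u\<^sub>1 * w\<^sub>2))) + (1 - qtilde Q i k) \<cdot> (Q i k \<cdot> bracket C (u\<^sub>1 * b k) (b i))"
    unfolding D by (simp add: bracket_add_left bracket_add_right bracket_scl_left b1 b2 b3 b4 b5 b6 scl_add_right scl_diff_right ac_simps)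
  also have "\<dots> = (qtilde Q j i * qtilde Q i k - 1) \<cdot> (u\<^sub>1 * w\<^sub>2)"
    unfolding b7 by (simp add: scl_distribs algebra_simps qtilde_def)
  finally have "Q i k \<cdot> bracket C (rootv (\<lambda>i. a i + b i) j k) (a i + b i) = 0" by (simp add: t)
  moreover have "Q i k \<noteq> 0" using assms by (intro Q_nonzero) (auto simp: i_def k_def)
  ultimately have "bracket C (rootv (\<lambda>i. a i + b i) j k) (a i + b i) = 0" by (rule scl_eq_0D)
  then show ?thesis by (simp add: C_def i_def k_def)
qed

lemma relations_add: "super_relations \<theta> S q Q scl (\<lambda>i. a i + b i)"
proof unfold_locales
  fix i j assume ij: "1 \<le> i" "i + 2 \<le> j" "j \<le> \<theta>"
  then have "b i * a j = Q i j \<cdot> (a j * b i)" "b j * a i = Q j i \<cdot> (a i * b j)" "Q i j * Q j i = 1"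
    using cross[of i j] cross[of j i] qtilde_far[of i j] by (auto simp: qtilde_def)
  then show "(a i + b i) * (a j + b j) = Q i j \<cdot> ((a j + b j) * (a i + b i))"
    using A.far[OF ij] B.far[OF ij] by (simp add: algebra_simps scl_distribs)
next
  fix i assume i: "i \<in> S"
  then have "b i * a i = - (a i * b i)" using cross[of i i] Q_odd[OF i] S_subset by auto
  then show "(a i + b i) * (a i + b i) = 0"
    using A.odd_square[OF i] B.odd_square[OF i] by (simp add: algebra_simps)
next
  fix i assume i: "1 \<le> i" "Suc (Suc i) \<le> \<theta>" "Suc i \<in> S"
  have "rootv (\<lambda>i. a i + b i) i (Suc (Suc i)) = bracket (word_chi Q [i] [Suc i, Suc (Suc i)]) (a i + b i)
          (bracket (Q (Suc i) (Suc (Suc i))) (a (Suc i) + b (Suc i)) (a (Suc (Suc i)) + b (Suc (Suc i))))"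
    by (simp add: rootv_step)
  then show "bracket (word_chi Q [i, Suc i, Suc (Suc i)] [Suc i])
     (bracket (word_chi Q [i] [Suc i, Suc (Suc i)]) (a i + b i)
          (bracket (Q (Suc i) (Suc (Suc i))) (a (Suc i) + b (Suc i)) (a (Suc (Suc i)) + b (Suc (Suc i)))))
     (a (Suc i) + b (Suc i)) = 0"
    using odd_middle_add[OF i] by simp
next
  fix i assume i: "1 \<le> i" "Suc i \<le> \<theta>" "Suc i \<notin> S"
  have "Q (Suc i) (Suc i) * Q (Suc i) i * Q i (Suc i) = 1"
    using qtilde_even(1)[OF i(3,1,2)] by (simp add: qtilde_def ac_simps)
  from serre_add[OF _ _ _ this] A.serre_pred[OF i] B.serre_pred[OF i]
  show "bracket (word_chi Q [Suc i] [Suc i, i]) (a (Suc i) + b (Suc i))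
      (bracket (Q (Suc i) i) (a (Suc i) + b (Suc i)) (a i + b i)) = 0"
    using i by (simp add: cross)
next
  fix i assume i: "1 \<le> i" "Suc i \<le> \<theta>" "i \<notin> S"
  have "Q i i * Q i (Suc i) * Q (Suc i) i = 1"
    using qtilde_even(2)[OF i(3,1)] i by (simp add: qtilde_def ac_simps)
  from serre_add[OF _ _ _ this] A.serre_succ[OF i] B.serre_succ[OF i]
  show "bracket (word_chi Q [i] [i, Suc i]) (a i + b i)
      (bracket (Q i (Suc i)) (a i + b i) (a (Suc i) + b (Suc i))) = 0"
    using i by (simp add: cross)
qed

end

section \<open>Linear algebra of the free algebra and its tensor square\<close>

lemma lookup_scale [simp]: "Poly_Mapping.lookup (scale c x) u = c * Poly_Mapping.lookup x u"
  unfolding scale_def by transfer (simp add: when_def)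

lemma scale_single [simp]: "scale c (Poly_Mapping.single u d) = Poly_Mapping.single u (c * d)"
  by (rule poly_mapping_eqI) (simp add: lookup_single when_def)

interpretation free_module: vector_space "scale :: 'k::field \<Rightarrow> ('a \<Rightarrow>\<^sub>0 'k) \<Rightarrow> _"
  by unfold_locales (auto intro!: poly_mapping_eqI simp: lookup_add algebra_simps)

interpretation free_module: vector_space_pair "scale :: 'k::field \<Rightarrow> ('a \<Rightarrow>\<^sub>0 'k) \<Rightarrow> _" "scale :: 'k \<Rightarrow> ('b \<Rightarrow>\<^sub>0 'k) \<Rightarrow> _"
  by unfold_locales

abbreviation lin :: "(('a \<Rightarrow>\<^sub>0 'k::field) \<Rightarrow> ('b \<Rightarrow>\<^sub>0 'k)) \<Rightarrow> bool" where
  "lin \<equiv> Vector_Spaces.linear scale scale"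

lemma linI:
  "(\<And>x y. f (x + y) = f x + f y) \<Longrightarrow> (\<And>c x. f (scale c x) = scale c (f x)) \<Longrightarrow> lin f"
  by unfold_locales auto

lemma lin_scale: "lin f \<Longrightarrow> f (scale c x) = scale c (f x)"
  by (rule free_module.linear_scale)

lemma sum_monomials: "(\<Sum>u\<in>Poly_Mapping.keys x. scale (Poly_Mapping.lookup x u) (Poly_Mapping.single u 1)) = (x :: 'a \<Rightarrow>\<^sub>0 'k::field)"
proof (rule poly_mapping_eqI)
  fix v
  have "(\<Sum>u\<in>Poly_Mapping.keys x. Poly_Mapping.lookup x u * (1 when u = v)) = (\<Sum>u\<in>Poly_Mapping.keys x. if u = v then Poly_Mapping.lookup x v else 0)"
    by (intro sum.cong) (auto simp: when_def)
  then show "Poly_Mapping.lookup (\<Sum>u\<in>Poly_Mapping.keys x. scale (Poly_Mapping.lookup x u) (Poly_Mapping.single u 1)) v = Poly_Mapping.lookup x v"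
    by (simp del: scale_single add: lookup_sum lookup_single in_keys_iff)
qed

lemma lin_expand:
  assumes "lin f"
  shows "f x = (\<Sum>u\<in>Poly_Mapping.keys x. scale (Poly_Mapping.lookup x u) (f (Poly_Mapping.single u 1)))"
proof -
  interpret Vector_Spaces.linear scale scale f by fact
  show ?thesis by (subst sum_monomials[of x, symmetric]) (simp only: sum scale)
qed

text \<open>Only words in the support of \<open>x\<close> have to be tested, so identities that hold
  on a carrier or in a single degree can be checked on monomials as well.\<close>

lemma lin_eq:
  assumes "lin f" "lin g" "\<And>u. u \<in> Poly_Mapping.keys x \<Longrightarrow> f (Poly_Mapping.single u 1) = g (Poly_Mapping.single u 1)"
  shows "f x = g x"
  unfolding lin_expand[OF assms(1), of x] lin_expand[OF assms(2), of x] using assms(3) by simp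

lemma lin_mem_subspace:
  assumes "lin f" "free_module.subspace V" "\<And>u. u \<in> Poly_Mapping.keys x \<Longrightarrow> f (Poly_Mapping.single u 1) \<in> V"
  shows "f x \<in> V"
  unfolding lin_expand[OF assms(1), of x]
  by (intro free_module.subspace_sum free_module.subspace_scale assms)

lemma lin_linear_ext [intro]: "lin (linear_ext f)"
proof -
  have *: "linear_ext f x = (\<Sum>u\<in>A. scale (Poly_Mapping.lookup x u) (f u))" if "finite A" "Poly_Mapping.keys x \<subseteq> A" for x A
    unfolding linear_ext_def using that by (intro sum.mono_neutral_left) (auto simp: in_keys_iff)
  show ?thesis
  proof (intro linI)
    fix x y
    have "linear_ext f (x + y) = (\<Sum>u\<in>Poly_Mapping.keys x \<union> Poly_Mapping.keys y. scale (Poly_Mapping.lookup (x + y) u) (f u))"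
      by (rule *) (auto dest: subsetD[OF keys_add])
    also have "\<dots> = (\<Sum>u\<in>Poly_Mapping.keys x \<union> Poly_Mapping.keys y. scale (Poly_Mapping.lookup x u) (f u)) + (\<Sum>u\<in>Poly_Mapping.keys x \<union> Poly_Mapping.keys y. scale (Poly_Mapping.lookup y u) (f u))"
      by (simp add: lookup_add free_module.scale_left_distrib sum.distrib)
    also have "\<dots> = linear_ext f x + linear_ext f y"
      by (intro arg_cong2[where f = "(+)"] *[symmetric]) auto
    finally show "linear_ext f (x + y) = linear_ext f x + linear_ext f y" .
  next
    fix c x
    have "linear_ext f (scale c x) = (\<Sum>u\<in>Poly_Mapping.keys x. scale (Poly_Mapping.lookup (scale c x) u) (f u))"
      by (rule *) (auto simp: in_keys_iff)
    then show "linear_ext f (scale c x) = scale c (linear_ext f x)"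
      by (simp add: linear_ext_def free_module.scale_sum_right)
  qed
qed

lemma linear_ext_single [simp]: "linear_ext f (Poly_Mapping.single u c) = scale c (f u)"
  by (cases "c = 0") (auto simp: linear_ext_def)

lemma lin_bilinear_ext_left: "lin (\<lambda>x. bilinear_ext f x y)"
  unfolding bilinear_ext_def by (rule lin_linear_ext)

lemma lin_bilinear_ext_right: "lin (bilinear_ext f x)"
proof (intro linI)
  fix c y z
  interpret l: Vector_Spaces.linear scale scale "linear_ext (f u)" for u by (rule lin_linear_ext)
  show "bilinear_ext f x (y + z) = bilinear_ext f x y + bilinear_ext f x z"
    by (simp add: bilinear_ext_def linear_ext_def[of _ x] l.add free_module.scale_right_distrib sum.distrib)
  show "bilinear_ext f x (scale c y) = scale c (bilinear_ext f x y)"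
    by (simp add: bilinear_ext_def linear_ext_def[of _ x] l.scale free_module.scale_sum_right mult.commute)
qed

lemma bilinear_ext_single [simp]:
  "bilinear_ext f (Poly_Mapping.single u c) (Poly_Mapping.single v d) = scale (c * d) (f u v)"
  by (simp add: bilinear_ext_def)

lemma lin_compose: "lin f \<Longrightarrow> lin g \<Longrightarrow> lin (\<lambda>x. f (g x))"
  by (intro linI) (simp_all add: free_module.linear_add free_module.linear_scale)

lemma lin_plus: "lin f \<Longrightarrow> lin g \<Longrightarrow> lin (\<lambda>x. f x + g x)"
  by (rule free_module.linear_compose_add)

lemma lin_minus: "lin f \<Longrightarrow> lin g \<Longrightarrow> lin (\<lambda>x. f x - g x)"
  by (rule free_module.linear_compose_sub)

lemma lin_scale_fun: "lin f \<Longrightarrow> lin (\<lambda>x. scale c (f x))"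
  by (rule free_module.linear_compose_scale_right)

lemma lin_id: "lin (\<lambda>x. x)"
  by (rule free_module.linear_id[unfolded id_def])

lemma single_mult_single: "Poly_Mapping.single u c * Poly_Mapping.single v d = Poly_Mapping.single (u @ v) (c * d)"
  for u v :: "'a list" and c d :: "'k::field"
  by (simp add: mult_single plus_list_def)

lemma lin_mult_left: "lin (\<lambda>x. x * (y :: 'a list \<Rightarrow>\<^sub>0 'k::field))"
  by (intro linI) (auto simp: scale_def mult_map_scale_conv_mult distrib_right mult.assoc)

text \<open>\<open>scale\<close> is left multiplication by a multiple of the empty word; centrality
  of these elements makes the product linear in its right factor too.\<close>

lemma single_zero_central: "x * Poly_Mapping.single 0 c = Poly_Mapping.single 0 c * (x :: 'a list \<Rightarrow>\<^sub>0 'k::field)"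
proof -
  have "(*) (Poly_Mapping.single 0 c) = (scale c :: ('a list \<Rightarrow>\<^sub>0 'k) \<Rightarrow> _)"
    by (rule ext) (simp add: scale_def mult_map_scale_conv_mult)
  then have "lin ((*) (Poly_Mapping.single 0 c) :: ('a list \<Rightarrow>\<^sub>0 'k) \<Rightarrow> _)"
    using lin_scale_fun[OF lin_id, of c] by simp
  then show ?thesis
    by (rule lin_eq[OF lin_mult_left]) (simp add: mult_single mult.commute)
qed

lemma lin_mult_right: "lin (\<lambda>y. (x :: 'a list \<Rightarrow>\<^sub>0 'k::field) * y)"
proof (intro linI)
  fix c y
  have "x * (Poly_Mapping.single 0 c * y) = Poly_Mapping.single 0 c * (x * y)"
    by (simp only: mult.assoc[symmetric] single_zero_central)
  then show "x * scale c y = scale c (x * y)" by (simp add: scale_def mult_map_scale_conv_mult)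
qed (auto simp: distrib_left)

lemma one_eq_single: "(1 :: 'a list \<Rightarrow>\<^sub>0 'k::field) = Poly_Mapping.single [] 1"
  by (simp flip: single_one add: zero_list_def)

section \<open>From the bicharacter on the lattice to the bicharacter on words\<close>

lemma prod_list_map_eq_prod_count:
  assumes "finite A" "set u \<subseteq> A"
  shows "(\<Prod>i\<leftarrow>u. f i) = (\<Prod>i\<in>A. f i ^ count_list u i :: 'b::comm_monoid_mult)"
  using assms(2)
proof (induction u)
  case (Cons i u)
  have "(\<Prod>j\<in>A. f j ^ count_list (i # u) j) = (\<Prod>j\<in>A. (if j = i then f i else 1) * f j ^ count_list u j)"
    by (intro prod.cong) auto
  also have "\<dots> = f i * (\<Prod>j\<in>A. f j ^ count_list u j)"
    using Cons.prems assms(1) by (simp add: prod.distrib)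
  finally show ?case using Cons by simp
qed simp

lemma lookup_wdeg: "Poly_Mapping.lookup (wdeg u) i = int (count_list u i)"
  unfolding wdeg_def by (induction u) (auto simp: lookup_add simple_root_def lookup_single when_def)

lemma chi_wdeg: "chi Q (wdeg u) (wdeg v) = word_chi Q u v"
proof -
  have k: "Poly_Mapping.keys (wdeg u) = set u" for u by (auto simp: in_keys_iff lookup_wdeg count_list_0_iff)
  have "chi Q (wdeg u) (wdeg v) = (\<Prod>i\<in>set u. \<Prod>j\<in>set v. Q i j ^ (count_list u i * count_list v j))"
    unfolding chi_def k by (simp add: lookup_wdeg flip: of_nat_mult power_int_of_nat)
  also have "\<dots> = (\<Prod>i\<in>set u. (\<Prod>j\<leftarrow>v. Q i j) ^ count_list u i)"
    by (intro prod.cong refl, subst prod_list_map_eq_prod_count[of "set v"])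
      (auto simp: prod_power_distrib power_mult[symmetric] mult.commute)
  also have "\<dots> = word_chi Q u v"
    unfolding word_chi_def by (rule prod_list_map_eq_prod_count[symmetric]) auto
  finally show ?thesis .
qed

lemma wdeg_interval: "wdeg [j..<Suc k] = pos_root j k"
  unfolding wdeg_def pos_root_def 
  by (simp add: sum_list_distinct_conv_sum_set atLeastLessThanSuc_atLeastAtMost del: upt_Suc)

lemma chi_pos_root: "chi Q (pos_root j k) (pos_root l m) = word_chi Q [j..<Suc k] [l..<Suc m]"
  by (simp only: chi_wdeg[symmetric] wdeg_interval)

section \<open>The braided product and the coproduct of the free algebra\<close>

abbreviation sq_one :: "nat list \<times> nat list \<Rightarrow>\<^sub>0 'k::field" where
  "sq_one \<equiv> Poly_Mapping.single ([], []) 1"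

lemma braided_mult_single [simp]:
  "braided_mult Q (Poly_Mapping.single (u, v) c) (Poly_Mapping.single (u', v') d)
    = Poly_Mapping.single (u @ u', v @ v') (c * d * word_chi Q v u')"
  by (simp add: braided_mult_def chi_wdeg)

lemma lin_braided_left: "lin (\<lambda>x. braided_mult Q x y)" and lin_braided_right: "lin (braided_mult Q x)"
  unfolding braided_mult_def by (rule lin_bilinear_ext_left lin_bilinear_ext_right)+

lemma lin_tensor_left: "lin (\<lambda>x. free_tensor x y)" and lin_tensor_right: "lin (free_tensor x)"
  unfolding free_tensor_def by (rule lin_bilinear_ext_left lin_bilinear_ext_right)+

lemma free_tensor_single [simp]:
  "free_tensor (Poly_Mapping.single u c) (Poly_Mapping.single v d) = Poly_Mapping.single (u, v) (c * d)"
  by (simp add: free_tensor_def)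

text \<open>Multiplication of each word by its character makes the braided product of a pure tensor and
  a pair of words a pure tensor, also when the factors are not homogeneous.\<close>

definition twist :: "(nat list \<Rightarrow> 'k::field) \<Rightarrow> (nat list \<Rightarrow>\<^sub>0 'k) \<Rightarrow> (nat list \<Rightarrow>\<^sub>0 'k)" where
  "twist h = linear_ext (\<lambda>w. Poly_Mapping.single w (h w))"

lemma twist_single [simp]: "twist h (Poly_Mapping.single w c) = Poly_Mapping.single w (c * h w)"
  by (simp add: twist_def)

lemma lin_twist: "lin (twist h)"
  unfolding twist_def by (rule lin_linear_ext)

lemma lin_coproduct: "lin (free_coproduct Q)"
  unfolding free_coproduct_def by (rule lin_linear_ext)

lemmas lin_intros = lin_compose[OF lin_mult_left] lin_compose[OF lin_mult_right]
  lin_compose[OF lin_braided_left] lin_compose[OF lin_braided_right]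
  lin_compose[OF lin_tensor_left] lin_compose[OF lin_tensor_right]
  lin_compose[OF lin_twist] lin_compose[OF lin_coproduct] lin_id

lemma lin_eq2:
  assumes "\<And>y. lin (\<lambda>x. f x y)" "\<And>x. lin (f x)" "\<And>y. lin (\<lambda>x. g x y)" "\<And>x. lin (g x)"
    and "\<And>u v. f (Poly_Mapping.single u 1) (Poly_Mapping.single v 1) = g (Poly_Mapping.single u 1) (Poly_Mapping.single v 1)"
  shows "f x y = g x y"
  by (rule lin_eq[OF assms(1,3)]) (rule lin_eq[OF assms(2,4) assms(5)])

lemma braided_mult_assoc: "braided_mult Q (braided_mult Q x y) z = braided_mult Q x (braided_mult Q y z)"
proof -
  let ?m = "braided_mult Q"
  have 1: "?m (?m x y) (Poly_Mapping.single w 1) = ?m x (?m y (Poly_Mapping.single w 1))" for w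
    by (rule lin_eq2[of "\<lambda>x y. ?m (?m x y) (Poly_Mapping.single w 1)"
          "\<lambda>x y. ?m x (?m y (Poly_Mapping.single w 1))"]; (intro lin_intros)?)
      (cases w; auto simp: ac_simps)
  show ?thesis
    by (rule lin_eq[of "\<lambda>z. ?m (?m x y) z" "\<lambda>z. ?m x (?m y z)" z]; (intro lin_intros 1)?)
qed

lemma braided_mult_one: "braided_mult Q sq_one x = x" "braided_mult Q x sq_one = x"
  by (rule lin_eq[of "braided_mult Q sq_one" "\<lambda>x. x" x]; (intro lin_intros)?; auto)
    (rule lin_eq[of "\<lambda>x. braided_mult Q x sq_one" "\<lambda>x. x" x]; (intro lin_intros)?; auto)

lemma twist_mult:
  assumes "\<And>u v. h (u @ v) = h u * h v"
  shows "twist h (x * y) = twist h x * twist h y"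
  by (rule lin_eq2[of "\<lambda>x y. twist h (x * y)" "\<lambda>x y. twist h x * twist h y"]; (intro lin_intros)?)
    (simp add: single_mult_single assms)

lemma braided_mult_word_left:
  "braided_mult Q (Poly_Mapping.single (u, v) 1) (free_tensor x y)
    = free_tensor (Poly_Mapping.single u 1 * twist (word_chi Q v) x) (Poly_Mapping.single v 1 * y)"
  by (rule lin_eq2[of "\<lambda>x y. braided_mult Q (Poly_Mapping.single (u, v) 1) (free_tensor x y)"
        "\<lambda>x y. free_tensor (Poly_Mapping.single u 1 * twist (word_chi Q v) x) (Poly_Mapping.single v 1 * y)"];
      (intro lin_intros)?) (simp add: single_mult_single)

lemma braided_mult_word_right:
  "braided_mult Q (free_tensor x y) (Poly_Mapping.single (u, v) 1)
    = free_tensor (x * Poly_Mapping.single u 1) (twist (\<lambda>w. word_chi Q w u) y * Poly_Mapping.single v 1)"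
  by (rule lin_eq2[of "\<lambda>x y. braided_mult Q (free_tensor x y) (Poly_Mapping.single (u, v) 1)"
        "\<lambda>x y. free_tensor (x * Poly_Mapping.single u 1) (twist (\<lambda>w. word_chi Q w u) y * Poly_Mapping.single v 1)"];
      (intro lin_intros)?) (simp add: single_mult_single)

lemma braided_mult_tensor_left: "braided_mult Q (free_tensor x 1) (free_tensor y 1) = free_tensor (x * y) 1"
  by (rule lin_eq2[of "\<lambda>x y. braided_mult Q (free_tensor x 1) (free_tensor y 1)" "\<lambda>x y. free_tensor (x * y) 1"];
      (intro lin_intros)?) (simp add: one_eq_single single_mult_single)

lemma braided_mult_tensor_right: "braided_mult Q (free_tensor 1 x) (free_tensor 1 y) = free_tensor 1 (x * y)"
  by (rule lin_eq2[of "\<lambda>x y. braided_mult Q (free_tensor 1 x) (free_tensor 1 y)" "\<lambda>x y. free_tensor 1 (x * y)"];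
      (intro lin_intros)?) (simp add: one_eq_single single_mult_single)

lemma braided_mult_tensor: "braided_mult Q (free_tensor x 1) (free_tensor 1 y) = free_tensor x y"
  by (rule lin_eq2[of "\<lambda>x y. braided_mult Q (free_tensor x 1) (free_tensor 1 y)" free_tensor];
      (intro lin_intros)?) (simp add: one_eq_single)

lemma braided_mult_gen:
  "braided_mult Q (free_tensor 1 (gen i)) (free_tensor (gen j) 1) = scale (Q i j) (free_tensor (gen j) (gen i))"
  by (simp add: one_eq_single gen_def)

lemma coproduct_gen: "free_coproduct Q (gen i) = free_tensor (gen i) 1 + free_tensor 1 (gen i)"
  by (simp add: free_coproduct_def gen_def braided_mult_one)

text \<open>The coproduct of a word is by definition the product of the coproducts of its letters,
  so on words the claim is associativity of the braided product.\<close>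

lemma coproduct_mult: "free_coproduct Q (x * y) = braided_mult Q (free_coproduct Q x) (free_coproduct Q y)"
proof (rule lin_eq2[of "\<lambda>x y. free_coproduct Q (x * y)" "\<lambda>x y. braided_mult Q (free_coproduct Q x) (free_coproduct Q y)"];
    (intro lin_intros)?)
  fix u v
  define g :: "nat \<Rightarrow> nat list \<times> nat list \<Rightarrow>\<^sub>0 'a" where "g i = free_tensor (gen i) 1 + free_tensor 1 (gen i)" for i
  have "foldr (\<lambda>i. braided_mult Q (g i)) u y = braided_mult Q (foldr (\<lambda>i. braided_mult Q (g i)) u sq_one) y" for y
    by (induction u) (simp_all add: braided_mult_one braided_mult_assoc)
  from this[of "foldr (\<lambda>i. braided_mult Q (g i)) v sq_one"]
  show "free_coproduct Q (Poly_Mapping.single u 1 * Poly_Mapping.single v 1)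
    = braided_mult Q (free_coproduct Q (Poly_Mapping.single u 1)) (free_coproduct Q (Poly_Mapping.single v 1))"
    unfolding g_def by (simp add: free_coproduct_def single_mult_single)
qed

section \<open>Graded ideals\<close>

text \<open>The degree is given by a reference word, up to permutation of its letters, so that it
  can be fed to \<open>word_chi\<close> directly; 0 is homogeneous of every degree.\<close>

definition homogeneous :: "nat list \<Rightarrow> (nat list \<Rightarrow>\<^sub>0 'k::field) \<Rightarrow> bool" where
  "homogeneous u x \<longleftrightarrow> (\<forall>w\<in>Poly_Mapping.keys x. mset w = mset u)"

lemma word_chi_cong_mset:
  assumes "mset u = mset u'" "mset v = mset v'"
  shows "word_chi Q u v = word_chi Q u' v'"
proof -
  have "wdeg u = wdeg u'" "wdeg v = wdeg v'"
    using assms by (auto intro!: poly_mapping_eqI simp: lookup_wdeg simp flip: count_mset)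
  then show ?thesis by (metis chi_wdeg)
qed

lemma homogeneous_gen [simp]: "homogeneous [i] (gen i)"
  by (simp add: homogeneous_def gen_def)

lemma homogeneous_mult: "homogeneous u x \<Longrightarrow> homogeneous v y \<Longrightarrow> homogeneous (u @ v) (x * y)"
  unfolding homogeneous_def by (force dest!: subsetD[OF keys_mult] simp: plus_list_def)

lemma homogeneous_scale: "homogeneous u x \<Longrightarrow> homogeneous u (scale c x)"
  by (auto simp: homogeneous_def in_keys_iff)

lemma homogeneous_diff: "homogeneous u x \<Longrightarrow> homogeneous u y \<Longrightarrow> homogeneous u (x - y)"
  unfolding homogeneous_def by (auto dest!: subsetD[OF keys_diff])

lemma homogeneous_cong: "homogeneous u x \<Longrightarrow> mset u = mset v \<Longrightarrow> homogeneous v x"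
  by (simp add: homogeneous_def)

lemma cbracket_homogeneous:
  assumes "homogeneous u x" "homogeneous v y"
  shows "cbracket Q x y = x * y - scale (word_chi Q u v) (y * x)"
proof (rule lin_eq[of "\<lambda>x. cbracket Q x y"])
  fix w assume w: "w \<in> Poly_Mapping.keys x"
  show "cbracket Q (Poly_Mapping.single w 1) y
    = Poly_Mapping.single w 1 * y - scale (word_chi Q u v) (y * Poly_Mapping.single w 1)"
  proof (rule lin_eq[of "cbracket Q (Poly_Mapping.single w 1)"])
    fix w' assume w': "w' \<in> Poly_Mapping.keys y"
    have "word_chi Q w w' = word_chi Q u v"
      using w w' assms by (intro word_chi_cong_mset) (auto simp: homogeneous_def)
    then show "cbracket Q (Poly_Mapping.single w 1) (Poly_Mapping.single w' 1)
      = Poly_Mapping.single w 1 * Poly_Mapping.single w' 1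
        - scale (word_chi Q u v) (Poly_Mapping.single w' 1 * Poly_Mapping.single w 1)"
      by (simp add: cbracket_def single_mult_single chi_wdeg)
  qed (simp_all only: cbracket_def lin_bilinear_ext_right, intro lin_minus lin_scale_fun lin_intros)
qed (simp_all only: cbracket_def lin_bilinear_ext_left, intro lin_minus lin_scale_fun lin_intros)

lemma homogeneous_cbracket:
  assumes "homogeneous u x" "homogeneous v y"
  shows "homogeneous (u @ v) (cbracket Q x y)"
proof -
  have "homogeneous (u @ v) (y * x)"
    by (rule homogeneous_cong[OF homogeneous_mult[OF assms(2,1)]]) simp
  from homogeneous_diff[OF homogeneous_mult[OF assms] homogeneous_scale[OF this]]
  show ?thesis unfolding cbracket_homogeneous[OF assms] .
qed

lemma twist_homogeneous:
  assumes "homogeneous u x" "\<And>w. mset w = mset u \<Longrightarrow> h w = h u"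
  shows "twist h x = scale (h u) x"
proof (rule lin_eq[of "twist h" "\<lambda>x. scale (h u) x" x])
  fix w assume "w \<in> Poly_Mapping.keys x"
  then have "h w = h u" using assms(1) by (intro assms(2)) (simp add: homogeneous_def)
  then show "twist h (Poly_Mapping.single w 1) = scale (h u) (Poly_Mapping.single w 1)" by simp
qed (intro lin_twist lin_scale_fun lin_id)+

lemma relators_homogeneous:
  assumes "r \<in> relators \<theta> S Q"
  shows "\<exists>u. homogeneous u r"
proof -
  have "homogeneous ([i] @ [j]) (gen i * gen j - scale c (gen j * gen i))" for i j :: nat and c :: 'a
    by (intro homogeneous_diff homogeneous_scale homogeneous_mult homogeneous_gen
        homogeneous_cong[OF homogeneous_mult[OF homogeneous_gen homogeneous_gen, of j i]]) simp
  then show ?thesis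
    using assms unfolding relators_def
    by (auto simp: power2_eq_square intro: homogeneous_mult homogeneous_cbracket homogeneous_gen exI)
      (blast intro: homogeneous_mult homogeneous_cbracket homogeneous_gen)+
qed

definition root_word :: "(nat \<Rightarrow> nat \<Rightarrow> 'k::field) \<Rightarrow> nat \<Rightarrow> nat \<Rightarrow> (nat list \<Rightarrow>\<^sub>0 'k)" where
  "root_word Q j k = foldr (ad_c Q) [j..<k] (gen k)"

lemma root_word_self: "root_word Q k k = gen k"
  by (simp add: root_word_def)

lemma root_word_step: "j < k \<Longrightarrow> root_word Q j k = ad_c Q j (root_word Q (Suc j) k)"
  by (simp add: root_word_def upt_conv_Cons)

lemma homogeneous_root_word:
  assumes "j \<le> k"
  shows "homogeneous (interval j k) (root_word Q j k)"
  using assms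
proof (induction j rule: inc_induct)
  case (step j)
  then have "homogeneous ([j] @ interval (Suc j) k) (root_word Q j k)"
    unfolding root_word_step[OF step(2)] by (intro homogeneous_cbracket homogeneous_gen)
  then show ?case using step interval_Cons[of j k] by simp
qed (simp add: root_word_self)

lemma subspace_keys: "free_module.subspace {x. Poly_Mapping.keys x \<subseteq> A}"
  by (rule free_module.subspaceI)
    (auto simp: in_keys_iff subset_iff lookup_add, metis add_0)

section \<open>Carriers and ring structures\<close>

lemma free_alg_simps [simp]:
  "mult (free_alg \<theta>) = (*)" "one (free_alg \<theta>) = 1" "zero (free_alg \<theta>) = 0" "add (free_alg \<theta>) = (+)"
  "smult (free_alg \<theta>) = scale"
  by (simp_all add: free_alg_def)

lemma free_sq_simps [simp]:
  "mult (free_sq \<theta> Q) = braided_mult Q" "one (free_sq \<theta> Q) = sq_one" "zero (free_sq \<theta> Q) = 0"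
  "add (free_sq \<theta> Q) = (+)" "smult (free_sq \<theta> Q) = scale"
  by (simp_all add: free_sq_def)

lemma free_alg_carrier: "x \<in> carrier (free_alg \<theta>) \<longleftrightarrow> Poly_Mapping.keys x \<subseteq> lists {1..\<theta>}"
  and free_sq_carrier: "z \<in> carrier (free_sq \<theta> Q) \<longleftrightarrow> Poly_Mapping.keys z \<subseteq> lists {1..\<theta>} \<times> lists {1..\<theta>}"
  by (simp_all add: free_alg_def free_sq_def)

lemma subspace_free_alg: "free_module.subspace (carrier (free_alg \<theta>))"
  and subspace_free_sq: "free_module.subspace (carrier (free_sq \<theta> Q))"
  by (simp_all add: free_alg_def free_sq_def subspace_keys)

lemmas free_alg_closed [intro] = free_module.subspace_add[OF subspace_free_alg]
  free_module.subspace_diff[OF subspace_free_alg] free_module.subspace_neg[OF subspace_free_alg]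
  free_module.subspace_scale[OF subspace_free_alg] free_module.subspace_0[OF subspace_free_alg]

lemmas free_sq_closed [intro] = free_module.subspace_add[OF subspace_free_sq]
  free_module.subspace_diff[OF subspace_free_sq] free_module.subspace_neg[OF subspace_free_sq]
  free_module.subspace_scale[OF subspace_free_sq] free_module.subspace_0[OF subspace_free_sq]

lemma free_alg_single: "c = 0 \<or> u \<in> lists {1..\<theta>} \<Longrightarrow> Poly_Mapping.single u c \<in> carrier (free_alg \<theta>)"
  by (auto simp: free_alg_carrier)

lemma free_alg_one: "1 \<in> carrier (free_alg \<theta>)"
  by (simp add: one_eq_single free_alg_single)

lemma free_alg_gen: "i \<in> {1..\<theta>} \<Longrightarrow> gen i \<in> carrier (free_alg \<theta>)"
  by (auto simp: gen_def free_alg_single)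

lemma free_alg_mult: "x \<in> carrier (free_alg \<theta>) \<Longrightarrow> y \<in> carrier (free_alg \<theta>) \<Longrightarrow> x * y \<in> carrier (free_alg \<theta>)"
  unfolding free_alg_carrier
proof
  fix w assume xy: "Poly_Mapping.keys x \<subseteq> lists {1..\<theta>}" "Poly_Mapping.keys y \<subseteq> lists {1..\<theta>}"
    and "w \<in> Poly_Mapping.keys (x * y)"
  then obtain u v where "u \<in> Poly_Mapping.keys x" "v \<in> Poly_Mapping.keys y" "w = u @ v"
    using keys_mult[of x y] by (auto simp: plus_list_def)
  then show "w \<in> lists {1..\<theta>}" using xy by (auto simp only: append_in_lists_conv)
qed

lemma free_alg_pow: "x \<in> carrier (free_alg \<theta>) \<Longrightarrow> x ^ n \<in> carrier (free_alg \<theta>)"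
  by (induction n) (auto simp: free_alg_one free_alg_mult)

lemma free_alg_twist: "x \<in> carrier (free_alg \<theta>) \<Longrightarrow> twist h x \<in> carrier (free_alg \<theta>)"
  by (rule lin_mem_subspace[OF lin_twist subspace_free_alg]) (auto simp: free_alg_carrier)

lemma free_alg_cbracket:
  assumes "x \<in> carrier (free_alg \<theta>)" "y \<in> carrier (free_alg \<theta>)"
  shows "cbracket Q x y \<in> carrier (free_alg \<theta>)"
  unfolding cbracket_def
proof (rule lin_mem_subspace[OF lin_bilinear_ext_left subspace_free_alg],
    rule lin_mem_subspace[OF lin_bilinear_ext_right subspace_free_alg])
  fix u v assume "u \<in> Poly_Mapping.keys x" "v \<in> Poly_Mapping.keys y"
  then have "u @ v \<in> lists {1..\<theta>}" "v @ u \<in> lists {1..\<theta>}" using assms by (auto simp: free_alg_carrier)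
  then show "bilinear_ext (\<lambda>u v. Poly_Mapping.single (u @ v) 1 - Poly_Mapping.single (v @ u) (chi Q (wdeg u) (wdeg v)))
     (Poly_Mapping.single u 1) (Poly_Mapping.single v 1) \<in> carrier (free_alg \<theta>)"
    by (simp add: free_alg_closed free_alg_single)
qed

lemma free_alg_root_word:
  assumes "1 \<le> j" "j \<le> k" "k \<le> \<theta>"
  shows "root_word Q j k \<in> carrier (free_alg \<theta>)"
  using assms(2,1,3)
proof (induction rule: inc_induct)
  case (step j)
  then show ?case by (simp add: root_word_step free_alg_cbracket free_alg_gen)
qed (simp add: root_word_self free_alg_gen)

lemma free_sq_tensor:
  assumes "x \<in> carrier (free_alg \<theta>)" "y \<in> carrier (free_alg \<theta>)"
  shows "free_tensor x y \<in> carrier (free_sq \<theta> Q)"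
  by (rule lin_mem_subspace[OF lin_tensor_left subspace_free_sq],
      rule lin_mem_subspace[OF lin_tensor_right subspace_free_sq])
    (use assms in \<open>auto simp: free_alg_carrier free_sq_carrier\<close>)

lemma free_sq_mult:
  assumes "x \<in> carrier (free_sq \<theta> Q)" "y \<in> carrier (free_sq \<theta> Q)"
  shows "braided_mult Q x y \<in> carrier (free_sq \<theta> Q)"
proof (rule lin_mem_subspace[OF lin_braided_left subspace_free_sq],
    rule lin_mem_subspace[OF lin_braided_right subspace_free_sq])
  fix w w' assume "w \<in> Poly_Mapping.keys x" "w' \<in> Poly_Mapping.keys y"
  then show "braided_mult Q (Poly_Mapping.single w 1) (Poly_Mapping.single w' 1) \<in> carrier (free_sq \<theta> Q)"
    using assms by (cases w; cases w') (auto simp: free_sq_carrier split: if_splits)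
qed

lemma free_sq_one: "sq_one \<in> carrier (free_sq \<theta> Q)"
  by (simp add: free_sq_carrier)

lemma free_sq_coproduct:
  assumes "x \<in> carrier (free_alg \<theta>)"
  shows "free_coproduct Q x \<in> carrier (free_sq \<theta> Q)"
proof (rule lin_mem_subspace[OF lin_coproduct subspace_free_sq])
  fix u assume "u \<in> Poly_Mapping.keys x"
  then have "u \<in> lists {1..\<theta>}" using assms by (auto simp: free_alg_carrier)
  then have "foldr (\<lambda>i. braided_mult Q (free_tensor (gen i) 1 + free_tensor 1 (gen i))) u sq_one \<in> carrier (free_sq \<theta> Q)"
    by (induction u)
      (auto intro!: free_sq_one free_sq_mult free_sq_closed(1) free_sq_tensor free_alg_gen free_alg_one)
  then show "free_coproduct Q (Poly_Mapping.single u 1) \<in> carrier (free_sq \<theta> Q)"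
    by (simp add: free_coproduct_def)
qed

lemma ring_free_alg: "ring (free_alg \<theta> :: ('k::field, nat list \<Rightarrow>\<^sub>0 'k) module)"
proof (rule ringI)
  show "abelian_group (free_alg \<theta> :: ('k, nat list \<Rightarrow>\<^sub>0 'k) module)"
  proof (rule abelian_groupI)
    fix x :: "nat list \<Rightarrow>\<^sub>0 'k" assume "x \<in> carrier (free_alg \<theta>)"
    then show "\<exists>y\<in>carrier (free_alg \<theta>). y \<oplus>\<^bsub>free_alg \<theta>\<^esub> x = \<zero>\<^bsub>free_alg \<theta>\<^esub>"
      by (intro bexI[of _ "- x"]) auto
  qed (auto simp: ac_simps)
  show "monoid (free_alg \<theta> :: ('k, nat list \<Rightarrow>\<^sub>0 'k) module)"
    by (rule monoidI) (auto simp: free_alg_mult free_alg_one mult.assoc)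
qed (auto simp: ring_distribs)

lemma ring_free_sq: "ring (free_sq \<theta> (Q :: nat \<Rightarrow> nat \<Rightarrow> 'k::field))"
proof (rule ringI)
  show "abelian_group (free_sq \<theta> Q)"
  proof (rule abelian_groupI)
    fix x assume "x \<in> carrier (free_sq \<theta> Q)"
    then show "\<exists>y\<in>carrier (free_sq \<theta> Q). y \<oplus>\<^bsub>free_sq \<theta> Q\<^esub> x = \<zero>\<^bsub>free_sq \<theta> Q\<^esub>"
      by (intro bexI[of _ "- x"]) auto
  qed (auto simp: ac_simps)
  show "monoid (free_sq \<theta> Q)"
    by (rule monoidI) (auto simp: free_sq_mult free_sq_one braided_mult_assoc braided_mult_one)
qed (auto simp: free_module.linear_add[OF lin_braided_left] free_module.linear_add[OF lin_braided_right])

lemma a_inv_free_alg: "x \<in> carrier (free_alg \<theta>) \<Longrightarrow> \<ominus>\<^bsub>free_alg \<theta>\<^esub> x = - x"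
  by (rule abelian_group.minus_equality[OF ring.is_abelian_group[OF ring_free_alg]]) auto

lemma a_inv_free_sq: "x \<in> carrier (free_sq \<theta> Q) \<Longrightarrow> \<ominus>\<^bsub>free_sq \<theta> Q\<^esub> x = - x"
  by (rule abelian_group.minus_equality[OF ring.is_abelian_group[OF ring_free_sq]]) auto

lemma ideal_free_algI:
  assumes "J \<subseteq> carrier (free_alg \<theta>)" "0 \<in> J" "\<And>x y. x \<in> J \<Longrightarrow> y \<in> J \<Longrightarrow> x + y \<in> J" "\<And>x. x \<in> J \<Longrightarrow> - x \<in> J"
    and "\<And>r x. r \<in> carrier (free_alg \<theta>) \<Longrightarrow> x \<in> J \<Longrightarrow> r * x \<in> J \<and> x * r \<in> J"
  shows "ideal J (free_alg \<theta>)"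
proof (rule idealI[OF ring_free_alg])
  show "subgroup J (add_monoid (free_alg \<theta>))"
  proof (rule subgroup.intro)
    fix x assume x: "x \<in> J"
    then have "inv\<^bsub>add_monoid (free_alg \<theta>)\<^esub> x = - x"
      using a_inv_free_alg[of x \<theta>] assms(1) unfolding a_inv_def by blast
    then show "inv\<^bsub>add_monoid (free_alg \<theta>)\<^esub> x \<in> J"
      using assms(4)[OF x] by (simp only:)
  qed (use assms(1-3) in auto)
qed (use assms(5) in auto)

section \<open>The ideals \<open>I\<close> and \<open>K\<close>\<close>

context super_data
begin

abbreviation I where "I \<equiv> rel_ideal \<theta> S Q"
abbreviation K where "K \<equiv> sq_ideal \<theta> S Q"

lemma relators_carrier: "relators \<theta> S Q \<subseteq> carrier (free_alg \<theta>)"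
proof -
  have "i \<in> {1..\<theta>}" if "i \<in> S" for i using that S_subset by auto
  then show ?thesis
    unfolding relators_def power2_eq_square
    by (auto intro!: free_alg_closed(2,4) free_alg_mult free_alg_cbracket free_alg_gen)
qed

lemma ideal_I: "ideal I (free_alg \<theta>)"
  unfolding rel_ideal_def by (rule ring.genideal_ideal[OF ring_free_alg relators_carrier])

lemma relators_I: "relators \<theta> S Q \<subseteq> I"
  unfolding rel_ideal_def by (rule ring.genideal_self[OF ring_free_alg relators_carrier])

lemma I_minimal: "ideal J (free_alg \<theta>) \<Longrightarrow> relators \<theta> S Q \<subseteq> J \<Longrightarrow> I \<subseteq> J"
  unfolding rel_ideal_def by (rule ring.genideal_minimal[OF ring_free_alg])

lemma I_carrier: "x \<in> I \<Longrightarrow> x \<in> carrier (free_alg \<theta>)"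
  by (rule ideal.Icarr[OF ideal_I])

lemma I_add: "x \<in> I \<Longrightarrow> y \<in> I \<Longrightarrow> x + y \<in> I"
  using additive_subgroup.a_closed[OF ideal.axioms(1)[OF ideal_I]] by simp

lemma I_zero: "0 \<in> I"
  using additive_subgroup.zero_closed[OF ideal.axioms(1)[OF ideal_I]] by simp

lemma I_mult: "x \<in> I \<Longrightarrow> r \<in> carrier (free_alg \<theta>) \<Longrightarrow> r * x \<in> I" "x \<in> I \<Longrightarrow> r \<in> carrier (free_alg \<theta>) \<Longrightarrow> x * r \<in> I"
  using ideal.I_l_closed[OF ideal_I] ideal.I_r_closed[OF ideal_I] by auto

lemma I_scale: "x \<in> I \<Longrightarrow> scale c x \<in> I"
proof -
  assume "x \<in> I"
  then have "Poly_Mapping.single [] c * x \<in> I" by (intro I_mult free_alg_single) auto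
  then show ?thesis by (simp add: scale_def mult_map_scale_conv_mult zero_list_def)
qed

lemma I_minus: "x \<in> I \<Longrightarrow> - x \<in> I"
  using I_scale[of x "- 1"] by simp

text \<open>The relators are homogeneous, so \<open>I\<close> is graded.\<close>

lemma I_twist:
  assumes h: "\<And>u v. h (u @ v) = h u * h v" "\<And>u v. mset u = mset v \<Longrightarrow> h u = h v" and x: "x \<in> I"
  shows "twist h x \<in> I"
proof -
  let ?J = "{x \<in> I. twist h x \<in> I}"
  note lin = free_module.linear_add[OF lin_twist] free_module.linear_0[OF lin_twist] free_module.linear_neg[OF lin_twist]
  have "ideal ?J (free_alg \<theta>)"
    by (rule ideal_free_algI)
      (auto simp: lin I_add I_zero I_minus I_mult twist_mult[OF h(1)] free_alg_twist intro: I_carrier)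
  moreover have "relators \<theta> S Q \<subseteq> ?J"
  proof
    fix r assume r: "r \<in> relators \<theta> S Q"
    then obtain u where "homogeneous u r" using relators_homogeneous by blast
    then have "twist h r = scale (h u) r" by (rule twist_homogeneous) (rule h(2))
    then show "r \<in> ?J" using r relators_I I_scale by auto
  qed
  ultimately show ?thesis using I_minimal x by blast
qed

lemma K_tensor:
  "x \<in> I \<Longrightarrow> y \<in> carrier (free_alg \<theta>) \<Longrightarrow> free_tensor x y \<in> K"
  "x \<in> carrier (free_alg \<theta>) \<Longrightarrow> y \<in> I \<Longrightarrow> free_tensor x y \<in> K"
  unfolding sq_ideal_def by (rule generate.incl; blast)+

lemma K_zero: "0 \<in> K"
  using generate.one[of "add_monoid (free_sq \<theta> Q)"] by (simp add: sq_ideal_def)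

lemma K_add: "x \<in> K \<Longrightarrow> y \<in> K \<Longrightarrow> x + y \<in> K"
  using generate.eng[of x "add_monoid (free_sq \<theta> Q)"] by (simp add: sq_ideal_def)

lemma K_induct [consumes 1, case_names zero tensor_left tensor_right add minus]:
  assumes "z \<in> K" "P 0"
    and "\<And>x y. x \<in> I \<Longrightarrow> y \<in> carrier (free_alg \<theta>) \<Longrightarrow> P (free_tensor x y)"
    and "\<And>x y. x \<in> carrier (free_alg \<theta>) \<Longrightarrow> y \<in> I \<Longrightarrow> P (free_tensor x y)"
    and "\<And>x y. P x \<Longrightarrow> P y \<Longrightarrow> P (x + y)" and "\<And>x. P x \<Longrightarrow> P (- x)"
  shows "P z"
  using assms(1) unfolding sq_ideal_def
proof (induction rule: generate.induct)
  case (inv h)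
  then have "h \<in> carrier (free_sq \<theta> Q)" by (auto intro!: free_sq_tensor dest: I_carrier)
  then have "inv\<^bsub>add_monoid (free_sq \<theta> Q)\<^esub> h = - h" using a_inv_free_sq by (simp add: a_inv_def)
  then show ?case using inv assms(3,4,6) by auto
qed (use assms in auto)

lemma K_carrier: "z \<in> K \<Longrightarrow> z \<in> carrier (free_sq \<theta> Q)"
  by (induction rule: K_induct) (auto intro!: free_sq_tensor dest: I_carrier)

lemma K_minus: "z \<in> K \<Longrightarrow> - z \<in> K"
proof -
  assume "z \<in> K"
  then have "z \<in> K \<and> - z \<in> K"
  proof (induction rule: K_induct)
    case (tensor_left x y)
    then show ?case using K_tensor(1)[OF I_minus] K_tensor(1)
      by (simp flip: free_module.linear_neg[OF lin_tensor_left])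
  next
    case (tensor_right x y)
    then show ?case using K_tensor(2)[OF _ I_minus] K_tensor(2)
      by (simp flip: free_module.linear_neg[OF lin_tensor_right])
  next
    case (add x y)
    then show ?case using K_add[of x y] K_add[of "- x" "- y"] by simp
  qed (auto simp: K_zero)
  then show ?thesis by simp
qed

lemma subspace_K: "free_module.subspace K"
proof (rule free_module.subspaceI)
  fix c z assume "z \<in> K"
  then show "scale c z \<in> K"
  proof (induction rule: K_induct)
    case (tensor_left x y)
    then show ?case using K_tensor(1)[OF I_scale] by (simp flip: lin_scale[OF lin_tensor_left])
  next
    case (tensor_right x y)
    then show ?case using K_tensor(2)[OF _ I_scale] by (simp flip: lin_scale[OF lin_tensor_right])
  qed (auto simp: K_zero K_add K_minus free_module.scale_right_distrib)
qed (auto simp: K_zero K_add)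

text \<open>A word times a pure tensor is again a pure tensor, with one factor twisted.
  \<open>I\<close> absorbs products and is stable under twists by \<open>I_twist\<close>, so a
  factor from \<open>I\<close> stays in \<open>I\<close>.\<close>

lemma K_mult:
  assumes "w \<in> carrier (free_sq \<theta> Q)" "z \<in> K"
  shows "braided_mult Q w z \<in> K" "braided_mult Q z w \<in> K"
proof -
  have tw: "twist (word_chi Q v) x \<in> I" "twist (\<lambda>w. word_chi Q w v) x \<in> I" if "x \<in> I" for x v
    by (rule I_twist; use that in \<open>auto intro: word_chi_cong_mset\<close>)+
  have *: "braided_mult Q (Poly_Mapping.single (u, v) 1) z \<in> K \<and> braided_mult Q z (Poly_Mapping.single (u, v) 1) \<in> K"
    if "u \<in> lists {1..\<theta>}" "v \<in> lists {1..\<theta>}" for u v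
    using assms(2)
  proof (induction rule: K_induct)
    case zero
    show ?case
      by (simp add: K_zero free_module.linear_0[OF lin_braided_left] free_module.linear_0[OF lin_braided_right])
  next
    case (tensor_left x y)
    then show ?case unfolding braided_mult_word_left braided_mult_word_right using that
      by (intro conjI K_tensor(1) I_mult tw free_alg_mult free_alg_twist free_alg_single disjI2)
  next
    case (tensor_right x y)
    then show ?case unfolding braided_mult_word_left braided_mult_word_right using that
      by (intro conjI K_tensor(2) I_mult tw free_alg_mult free_alg_twist free_alg_single disjI2)
  next
    case (add x y)
    then show ?case
      by (simp add: K_add free_module.linear_add[OF lin_braided_left] free_module.linear_add[OF lin_braided_right])
  next
    case (minus x)
    then show ?case
      by (simp add: K_minus free_module.linear_neg[OF lin_braided_left] free_module.linear_neg[OF lin_braided_right])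
  qed
  have "w' \<in> lists {1..\<theta>} \<times> lists {1..\<theta>}" if "w' \<in> Poly_Mapping.keys w" for w'
    using assms(1) that unfolding free_sq_carrier by blast
  then show "braided_mult Q w z \<in> K" "braided_mult Q z w \<in> K"
    by (rule_tac lin_mem_subspace[OF lin_braided_left subspace_K],
        use * in force,
        rule_tac lin_mem_subspace[OF lin_braided_right subspace_K],
        use * in force)
qed

lemma ideal_K: "ideal K (free_sq \<theta> Q)"
proof (rule idealI[OF ring_free_sq])
  show "subgroup K (add_monoid (free_sq \<theta> Q))"
  proof (rule subgroup.intro)
    fix x assume x: "x \<in> K"
    then have "inv\<^bsub>add_monoid (free_sq \<theta> Q)\<^esub> x = - x"
      using a_inv_free_sq[of x \<theta> Q] K_carrier unfolding a_inv_def by blast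
    then show "inv\<^bsub>add_monoid (free_sq \<theta> Q)\<^esub> x \<in> K"
      using K_minus[OF x] by (simp only:)
  qed (use K_zero K_add K_carrier in auto)
qed (auto simp: K_mult)

end

section \<open>A faithful representation of the tensor square\<close>

typedef (overloaded) ('b, 'k) lin_endo = "{f :: ('b \<Rightarrow>\<^sub>0 'k::field) \<Rightarrow> ('b \<Rightarrow>\<^sub>0 'k). lin f}"
  morphisms apply_endo Lin_endo
  using lin_id by blast

setup_lifting type_definition_lin_endo

instantiation lin_endo :: (type, field) ring_1
begin

lift_definition zero_lin_endo :: "('a, 'b) lin_endo" is "\<lambda>_. 0"
  by (intro linI) auto

lift_definition one_lin_endo :: "('a, 'b) lin_endo" is "\<lambda>x. x"
  by (rule lin_id)

lift_definition plus_lin_endo :: "('a, 'b) lin_endo \<Rightarrow> ('a, 'b) lin_endo \<Rightarrow> ('a, 'b) lin_endo" is "\<lambda>f g x. f x + g x"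
  by (rule lin_plus)

lift_definition minus_lin_endo :: "('a, 'b) lin_endo \<Rightarrow> ('a, 'b) lin_endo \<Rightarrow> ('a, 'b) lin_endo" is "\<lambda>f g x. f x - g x"
  by (rule lin_minus)

lift_definition uminus_lin_endo :: "('a, 'b) lin_endo \<Rightarrow> ('a, 'b) lin_endo" is "\<lambda>f x. - f x"
  using lin_scale_fun[of _ "- 1"] by auto

lift_definition times_lin_endo :: "('a, 'b) lin_endo \<Rightarrow> ('a, 'b) lin_endo \<Rightarrow> ('a, 'b) lin_endo" is "\<lambda>f g x. f (g x)"
  by (rule lin_compose)

instance
proof
  show "(0 :: ('a, 'b) lin_endo) \<noteq> 1"
  proof (transfer, rule notI)
    assume "(\<lambda>_. 0) = (\<lambda>x :: 'a \<Rightarrow>\<^sub>0 'b. x)"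
    \<comment> \<open>Every type is inhabited, so the monomial of \<open>undefined\<close> is a
      nonzero vector on which 0 and 1 differ.\<close>
    from fun_cong[OF this, of "Poly_Mapping.single undefined 1"] show False
      by (metis lookup_single_eq lookup_zero zero_neq_one)
  qed
qed (transfer; auto simp: fun_eq_iff algebra_simps free_module.linear_add)+

end

lift_definition scale_endo :: "'k::field \<Rightarrow> ('b, 'k) lin_endo \<Rightarrow> ('b, 'k) lin_endo" is "\<lambda>c f x. scale c (f x)"
  by (rule lin_scale_fun)

lemma scaled_ring_endo: "scaled_ring scale_endo"
  by unfold_locales
    (transfer; auto simp: fun_eq_iff free_module.scale_left_distrib free_module.scale_right_distrib lin_scale)+

section \<open>Homomorphisms and the relators\<close>

lemma relators_odd:
  assumes "1 \<le> i" "Suc (Suc i) \<le> \<theta>" "Suc i \<in> S"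
  shows "cbracket Q (ad_c Q i (ad_c Q (Suc i) (gen (Suc (Suc i))))) (gen (Suc i)) \<in> relators \<theta> S Q"
  unfolding relators_def Un_iff mem_Collect_eq
  by (rule disjI1, rule disjI1, rule disjI2, rule exI[of _ "Suc i"]) (use assms in simp)

lemma relators_pred:
  assumes "1 \<le> i" "Suc i \<le> \<theta>" "Suc i \<notin> S"
  shows "ad_c Q (Suc i) (ad_c Q (Suc i) (gen i)) \<in> relators \<theta> S Q"
  unfolding relators_def Un_iff mem_Collect_eq
  by (rule disjI1, rule disjI2, rule exI[of _ "Suc i"]) (use assms in simp)

lemma relators_succ:
  assumes "1 \<le> i" "Suc i \<le> \<theta>" "i \<notin> S"
  shows "ad_c Q i (ad_c Q i (gen (Suc i))) \<in> relators \<theta> S Q"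
  unfolding relators_def Un_iff mem_Collect_eq
  by (rule disjI2, rule exI[of _ i]) (use assms in simp)

text \<open>Unitality is not among the axioms: the maps built from \<open>rep\<close> send 1 to an
  idempotent, so powers are transported with exponent \<open>Suc n\<close>. Multiplicativity is
  asked on the carrier, where \<open>rep\<close> has it.\<close>

locale free_alg_hom = super_scaled_ring \<theta> S q Q scl
  for \<theta> S and q :: "'k::field" and Q and scl :: "'k \<Rightarrow> 'a::ring_1 \<Rightarrow> 'a" (infixr "\<cdot>" 75) +
  fixes \<phi> :: "(nat list \<Rightarrow>\<^sub>0 'k) \<Rightarrow> 'a"
  assumes hom_add: "\<phi> (x + y) = \<phi> x + \<phi> y"
    and hom_scale: "\<phi> (scale c x) = c \<cdot> \<phi> x"
    and hom_mult: "x \<in> carrier (free_alg \<theta>) \<Longrightarrow> y \<in> carrier (free_alg \<theta>) \<Longrightarrow> \<phi> (x * y) = \<phi> x * \<phi> y"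
begin

lemma hom_zero [simp]: "\<phi> 0 = 0"
  using hom_add[of 0 0] by simp

lemma hom_minus: "\<phi> (- x) = - \<phi> x"
  using hom_add[of x "- x"] by (simp add: eq_neg_iff_add_eq_0 add.commute)

lemma hom_diff: "\<phi> (x - y) = \<phi> x - \<phi> y"
  using hom_add[of x "- y"] by (simp add: hom_minus)

lemma hom_power:
  assumes "x \<in> carrier (free_alg \<theta>)"
  shows "\<phi> (x ^ Suc n) = \<phi> x ^ Suc n"
proof (induction n)
  case (Suc n)
  have "\<phi> (x * x ^ Suc n) = \<phi> x * \<phi> (x ^ Suc n)" by (rule hom_mult[OF assms free_alg_pow[OF assms]])
  then show ?case by (simp only: power_Suc[of _ "Suc n"] Suc)
qed simp

lemma hom_cbracket:
  assumes "homogeneous u x" "homogeneous v y" "x \<in> carrier (free_alg \<theta>)" "y \<in> carrier (free_alg \<theta>)"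
  shows "\<phi> (cbracket Q x y) = bracket (word_chi Q u v) (\<phi> x) (\<phi> y)"
  by (simp add: cbracket_homogeneous[OF assms(1,2)] bracket_def hom_diff hom_scale hom_mult assms(3,4))

lemma hom_root_word:
  assumes "1 \<le> j" "j \<le> k" "k \<le> \<theta>"
  shows "\<phi> (root_word Q j k) = rootv (\<lambda>i. \<phi> (gen i)) j k"
  using assms(2,1)
proof (induction j rule: inc_induct)
  case (step j)
  then show ?case
    using hom_cbracket[OF homogeneous_gen homogeneous_root_word[of "Suc j" k]] assms
    by (simp add: root_word_step rootv_step free_alg_gen free_alg_root_word del: upt_Suc)
qed (simp add: root_word_self)

lemma hom_ad_gen:
  assumes "i \<in> {1..\<theta>}" "j \<in> {1..\<theta>}"
  shows "\<phi> (ad_c Q i (gen j)) = bracket (Q i j) (\<phi> (gen i)) (\<phi> (gen j))"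
  using hom_cbracket[OF homogeneous_gen homogeneous_gen, of i j] assms by (simp add: free_alg_gen)

lemma hom_ad_ad:
  assumes "h \<in> {1..\<theta>}" "i \<in> {1..\<theta>}" "j \<in> {1..\<theta>}"
  shows "\<phi> (ad_c Q h (ad_c Q i (gen j)))
    = bracket (word_chi Q [h] [i, j]) (\<phi> (gen h)) (bracket (Q i j) (\<phi> (gen i)) (\<phi> (gen j)))"
proof -
  have "homogeneous [i, j] (ad_c Q i (gen j))"
    using homogeneous_cbracket[OF homogeneous_gen homogeneous_gen] by (metis append_Cons append_Nil)
  from hom_cbracket[OF homogeneous_gen this, of h] show ?thesis
    using assms by (simp add: free_alg_gen free_alg_cbracket hom_ad_gen)
qed

lemma hom_odd_relator:
  assumes "1 \<le> i" "Suc (Suc i) \<le> \<theta>"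
  shows "\<phi> (cbracket Q (ad_c Q i (ad_c Q (Suc i) (gen (Suc (Suc i))))) (gen (Suc i)))
    = bracket (word_chi Q [i, Suc i, Suc (Suc i)] [Suc i])
        (bracket (word_chi Q [i] [Suc i, Suc (Suc i)]) (\<phi> (gen i))
          (bracket (Q (Suc i) (Suc (Suc i))) (\<phi> (gen (Suc i))) (\<phi> (gen (Suc (Suc i)))))) (\<phi> (gen (Suc i)))"
proof -
  have "homogeneous [i, Suc i, Suc (Suc i)] (ad_c Q i (ad_c Q (Suc i) (gen (Suc (Suc i)))))"
    using homogeneous_cbracket[OF homogeneous_gen homogeneous_cbracket[OF homogeneous_gen homogeneous_gen]]
    by (metis append_Cons append_Nil)
  from hom_cbracket[OF this homogeneous_gen, of "Suc i"] show ?thesis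
    using assms by (simp add: free_alg_gen free_alg_cbracket hom_ad_ad del: word_chi_simps)
qed

text \<open>One half of an equivalence with \<open>hom_relators\<close>. This half serves
  \<open>rep_left\<close> and \<open>rep_right\<close>, which kill the relators because
  \<open>K\<close> contains their tensor products with 1; the other half serves
  \<open>rep_coproduct\<close>, whose values on generators satisfy the relations by
  \<open>relations_add\<close>.\<close>

lemma relations_of_hom:
  assumes "\<And>r. r \<in> relators \<theta> S Q \<Longrightarrow> \<phi> r = 0"
  shows "super_relations \<theta> S q Q scl (\<lambda>i. \<phi> (gen i))"
proof unfold_locales
  fix i j assume ij: "1 \<le> i" "i + 2 \<le> j" "j \<le> \<theta>"
  then have "\<phi> (gen i * gen j - scale (Q i j) (gen j * gen i)) = 0"
    by (intro assms) (auto simp: relators_def)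
  then show "\<phi> (gen i) * \<phi> (gen j) = Q i j \<cdot> (\<phi> (gen j) * \<phi> (gen i))"
    using ij by (simp add: hom_diff hom_scale hom_mult free_alg_gen)
next
  fix i assume i: "i \<in> S"
  then have "\<phi> ((gen i)\<^sup>2) = 0" by (intro assms) (auto simp: relators_def)
  moreover have "i \<in> {1..\<theta>}" using i S_subset by blast
  ultimately show "\<phi> (gen i) * \<phi> (gen i) = 0"
    by (simp add: power2_eq_square hom_mult free_alg_gen del: atLeastAtMost_iff)
next
  fix i assume i: "1 \<le> i" "Suc (Suc i) \<le> \<theta>" "Suc i \<in> S"
  then have "\<phi> (cbracket Q (ad_c Q i (ad_c Q (Suc i) (gen (Suc (Suc i))))) (gen (Suc i))) = 0"
    by (intro assms relators_odd)
  then show "bracket (word_chi Q [i, Suc i, Suc (Suc i)] [Suc i])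
        (bracket (word_chi Q [i] [Suc i, Suc (Suc i)]) (\<phi> (gen i))
          (bracket (Q (Suc i) (Suc (Suc i))) (\<phi> (gen (Suc i))) (\<phi> (gen (Suc (Suc i)))))) (\<phi> (gen (Suc i))) = 0"
    using hom_odd_relator[OF i(1,2)] by (simp only:)
next
  fix i assume i: "1 \<le> i" "Suc i \<le> \<theta>" "Suc i \<notin> S"
  then have "\<phi> (ad_c Q (Suc i) (ad_c Q (Suc i) (gen i))) = 0"
    by (intro assms relators_pred)
  then show "bracket (word_chi Q [Suc i] [Suc i, i]) (\<phi> (gen (Suc i))) (bracket (Q (Suc i) i) (\<phi> (gen (Suc i))) (\<phi> (gen i))) = 0"
    using hom_ad_ad[of "Suc i" "Suc i" i] i by simp
next
  fix i assume i: "1 \<le> i" "Suc i \<le> \<theta>" "i \<notin> S"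
  then have "\<phi> (ad_c Q i (ad_c Q i (gen (Suc i)))) = 0"
    by (intro assms relators_succ)
  then show "bracket (word_chi Q [i] [i, Suc i]) (\<phi> (gen i)) (bracket (Q i (Suc i)) (\<phi> (gen i)) (\<phi> (gen (Suc i)))) = 0"
    using hom_ad_ad[of i i "Suc i"] i by simp
qed

lemma hom_relators:
  assumes "super_relations \<theta> S q Q scl (\<lambda>i. \<phi> (gen i))" "r \<in> relators \<theta> S Q"
  shows "\<phi> r = 0"
proof -
  interpret super_relations \<theta> S q Q scl "\<lambda>i. \<phi> (gen i)" by fact
  consider i j where "r = gen i * gen j - scale (Q i j) (gen j * gen i)" "1 \<le> i" "i + 2 \<le> j" "j \<le> \<theta>"
    | i where "r = (gen i)\<^sup>2" "i \<in> S"
    | i where "r = cbracket Q (ad_c Q (i - 1) (ad_c Q i (gen (i + 1)))) (gen i)" "i \<in> S" "1 < i" "i < \<theta>"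
    | i where "r = ad_c Q i (ad_c Q i (gen (i - 1)))" "i \<in> {1..\<theta>} - S" "1 < i"
    | i where "r = ad_c Q i (ad_c Q i (gen (i + 1)))" "i \<in> {1..\<theta>} - S" "i < \<theta>"
    using assms(2) unfolding relators_def by blast
  then show ?thesis
  proof cases
    case 1
    then show ?thesis using far[of i j] by (simp add: hom_diff hom_scale hom_mult free_alg_gen)
  next
    case 2
    then have "i \<in> {1..\<theta>}" using S_subset by blast
    with 2 show ?thesis
      using odd_square[of i] by (simp add: power2_eq_square hom_mult free_alg_gen del: atLeastAtMost_iff)
  next
    case 3
    then obtain h where "i = Suc h" "1 \<le> h" by (cases i) auto
    then show ?thesis using odd_middle[of h] hom_odd_relator[of h] 3 by (simp del: word_chi_simps)
  next
    case 4
    then obtain h where "i = Suc h" "1 \<le> h" by (cases i) auto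
    then show ?thesis using serre_pred[of h] hom_ad_ad[of i i h] 4 by simp
  next
    case 5
    then show ?thesis using serre_succ[of i] hom_ad_ad[of i i "Suc i"] by simp
  qed
qed

lemma hom_rel_ideal:
  assumes "\<And>r. r \<in> relators \<theta> S Q \<Longrightarrow> \<phi> r = 0" "x \<in> I"
  shows "\<phi> x = 0"
proof -
  have "ideal {x \<in> carrier (free_alg \<theta>). \<phi> x = 0} (free_alg \<theta>)"
    by (rule ideal_free_algI) (auto simp: hom_add hom_minus hom_mult free_alg_mult)
  moreover have "relators \<theta> S Q \<subseteq> {x \<in> carrier (free_alg \<theta>). \<phi> x = 0}"
    using assms(1) relators_carrier by auto
  ultimately show ?thesis using I_minimal assms(2) by blast
qed

end

section \<open>The regular representation modulo \<open>K\<close>\<close>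

context super_data
begin

text \<open>Endomorphisms act on words in all natural numbers, whereas \<open>K\<close> is an ideal
  of the algebra with letters up to \<open>\<theta>\<close>. Projecting the argument first defines
  the action everywhere and makes it zero on foreign words.\<close>

definition restrict_letters :: "(nat list \<times> nat list \<Rightarrow>\<^sub>0 'k) \<Rightarrow> (nat list \<times> nat list \<Rightarrow>\<^sub>0 'k)" where
  "restrict_letters = linear_ext (\<lambda>w. if w \<in> lists {1..\<theta>} \<times> lists {1..\<theta>} then Poly_Mapping.single w 1 else 0)"

lemma lin_restrict_letters: "lin restrict_letters"
  unfolding restrict_letters_def by (rule lin_linear_ext)

lemma restrict_letters_carrier: "restrict_letters z \<in> carrier (free_sq \<theta> Q)"
  by (rule lin_mem_subspace[OF lin_restrict_letters subspace_free_sq])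
    (auto simp: restrict_letters_def free_sq_carrier)

lemma restrict_letters_id: "z \<in> carrier (free_sq \<theta> Q) \<Longrightarrow> restrict_letters z = z"
  by (rule lin_eq[OF lin_restrict_letters lin_id]) (auto simp: restrict_letters_def free_sq_carrier)

text \<open>A linear choice of representatives modulo \<open>K\<close>: the identity minus a linear
  projection onto \<open>K\<close>, which exists because every subspace has a complement.\<close>

definition reduce :: "(nat list \<times> nat list \<Rightarrow>\<^sub>0 'k) \<Rightarrow> (nat list \<times> nat list \<Rightarrow>\<^sub>0 'k)" where
  "reduce = (SOME f. lin f \<and> (\<forall>z. z - f z \<in> K) \<and> (\<forall>z\<in>K. f z = 0))"

lemma reduce: "lin reduce" "z - reduce z \<in> K" "z \<in> K \<Longrightarrow> reduce z = 0"
proof -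
  obtain g where g: "g ` UNIV \<subseteq> K" "lin g" "\<forall>z\<in>K. g z = z"
    using free_module.linear_exists_left_inverse_on[OF lin_id subspace_K] by auto
  then have "\<exists>f. lin f \<and> (\<forall>z. z - f z \<in> K) \<and> (\<forall>z\<in>K. f z = 0)"
    by (intro exI[of _ "\<lambda>z. z - g z"]) (auto intro: lin_minus lin_id)
  then have "lin reduce \<and> (\<forall>z. z - reduce z \<in> K) \<and> (\<forall>z\<in>K. reduce z = 0)"
    unfolding reduce_def by (rule someI_ex)
  then show "lin reduce" "z - reduce z \<in> K" "z \<in> K \<Longrightarrow> reduce z = 0" by auto
qed

lemma reduce_diff: "w - z \<in> K \<Longrightarrow> reduce w = reduce z"
  using reduce(3)[of "w - z"] free_module.linear_diff[OF reduce(1)] by simp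

text \<open>The regular representation of the quotient of the tensor square by \<open>K\<close>, transported to
  linear endomorphisms of the free tensor square by means of a linear projection with kernel \<open>K\<close>.
  It is not unital: \<open>rep sq_one\<close> is an idempotent.\<close>

lift_definition rep :: "(nat list \<times> nat list \<Rightarrow>\<^sub>0 'k) \<Rightarrow> (nat list \<times> nat list, 'k) lin_endo" is
  "\<lambda>x z. reduce (braided_mult Q x (restrict_letters z))"
  by (intro lin_compose[OF reduce(1)] lin_compose[OF lin_braided_right] lin_restrict_letters)

lemma rep_add: "rep (x + y) = rep x + rep y"
  by transfer (simp add: fun_eq_iff free_module.linear_add[OF lin_braided_left] free_module.linear_add[OF reduce(1)])

lemma rep_scale: "rep (scale c x) = scale_endo c (rep x)"
  by transfer (simp add: fun_eq_iff lin_scale[OF lin_braided_left] lin_scale[OF reduce(1)])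

lemma rep_mult:
  assumes "x \<in> carrier (free_sq \<theta> Q)" "y \<in> carrier (free_sq \<theta> Q)"
  shows "rep (braided_mult Q x y) = rep x * rep y"
  using assms
proof (transfer, intro ext)
  fix x y z assume x: "x \<in> carrier (free_sq \<theta> Q)" and y: "y \<in> carrier (free_sq \<theta> Q)"
  define t where "t = braided_mult Q y (restrict_letters z)"
  have t: "t \<in> carrier (free_sq \<theta> Q)" by (simp add: t_def free_sq_mult y restrict_letters_carrier)
  \<comment> \<open>The representative \<open>reduce t\<close> differs from \<open>t\<close> by an
    element of \<open>K\<close>, hence stays in the carrier; the inner
    \<open>restrict_letters\<close> of the composed action leaves it unchanged.\<close>
  have "t - (t - reduce t) \<in> carrier (free_sq \<theta> Q)"
    using t K_carrier[OF reduce(2)] by (rule free_sq_closed(2))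
  then have rt: "restrict_letters (reduce t) = reduce t" by (simp add: restrict_letters_id)
  have "braided_mult Q x t - braided_mult Q x (reduce t) = braided_mult Q x (t - reduce t)"
    by (simp add: free_module.linear_diff[OF lin_braided_right])
  also have "\<dots> \<in> K" by (rule K_mult(1)[OF x reduce(2)])
  finally have "reduce (braided_mult Q x t) = reduce (braided_mult Q x (reduce t))"
    by (rule reduce_diff)
  then show "reduce (braided_mult Q (braided_mult Q x y) (restrict_letters z))
    = reduce (braided_mult Q x (restrict_letters (reduce (braided_mult Q y (restrict_letters z)))))"
    by (simp add: braided_mult_assoc rt flip: t_def)
qed

text \<open>Faithfulness modulo \<open>K\<close> comes from acting on 1 (x) 1, which returns
  \<open>reduce x\<close>; that \<open>K\<close> acts by zero is its being a right ideal.\<close>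

lemma rep_eq_0_iff: "rep x = 0 \<longleftrightarrow> x \<in> K"
proof
  assume "x \<in> K"
  then show "rep x = 0"
    by transfer (simp add: fun_eq_iff reduce(3) K_mult(2) restrict_letters_carrier)
next
  assume "rep x = 0"
  then have "apply_endo (rep x) sq_one = 0" by (simp add: zero_lin_endo.rep_eq)
  then have "reduce x = 0"
    by (simp add: rep.rep_eq restrict_letters_id free_sq_one braided_mult_one)
  then show "x \<in> K" using reduce(2)[of x] by simp
qed

definition rep_left where "rep_left x = rep (free_tensor x 1)"
definition rep_right where "rep_right x = rep (free_tensor 1 x)"
definition rep_coproduct where "rep_coproduct x = rep (free_coproduct Q x)"

lemma super_scaled_ring_endo: "super_scaled_ring \<theta> S q Q scale_endo"
  by (intro super_scaled_ring.intro scaled_ring_endo super_data_axioms)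

lemma hom_rep_left: "free_alg_hom \<theta> S q Q scale_endo rep_left"
  by (intro free_alg_hom.intro super_scaled_ring_endo free_alg_hom_axioms.intro)
    (auto simp: rep_left_def rep_add rep_scale free_module.linear_add[OF lin_tensor_left] lin_scale[OF lin_tensor_left]
      free_sq_tensor free_alg_one simp flip: rep_mult braided_mult_tensor_left[of Q])

lemma hom_rep_right: "free_alg_hom \<theta> S q Q scale_endo rep_right"
  by (intro free_alg_hom.intro super_scaled_ring_endo free_alg_hom_axioms.intro)
    (auto simp: rep_right_def rep_add rep_scale free_module.linear_add[OF lin_tensor_right] lin_scale[OF lin_tensor_right]
      free_sq_tensor free_alg_one simp flip: rep_mult braided_mult_tensor_right[of Q])

lemma hom_rep_coproduct: "free_alg_hom \<theta> S q Q scale_endo rep_coproduct"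
  by (intro free_alg_hom.intro super_scaled_ring_endo free_alg_hom_axioms.intro)
    (auto simp: rep_coproduct_def rep_add rep_scale free_module.linear_add[OF lin_coproduct] lin_scale[OF lin_coproduct]
      free_sq_coproduct coproduct_mult rep_mult)

lemma rep_coproduct_gen: "rep_coproduct (gen i) = rep_left (gen i) + rep_right (gen i)"
  by (simp add: rep_coproduct_def rep_left_def rep_right_def coproduct_gen rep_add)

lemma rep_tensor:
  assumes "x \<in> carrier (free_alg \<theta>)" "y \<in> carrier (free_alg \<theta>)"
  shows "rep (free_tensor x y) = rep_left x * rep_right y"
  unfolding rep_left_def rep_right_def braided_mult_tensor[symmetric, of x y Q]
  by (intro rep_mult free_sq_tensor free_alg_one assms)

lemma braided_pair_rep: "braided_pair \<theta> S q Q scale_endo (\<lambda>i. rep_left (gen i)) (\<lambda>i. rep_right (gen i))"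
proof (intro braided_pair.intro braided_pair_axioms.intro super_scaled_ring_endo)
  show "super_relations \<theta> S q Q scale_endo (\<lambda>i. rep_left (gen i))"
    by (rule free_alg_hom.relations_of_hom[OF hom_rep_left])
      (use relators_I in \<open>auto simp: rep_left_def rep_eq_0_iff intro!: K_tensor(1) free_alg_one\<close>)
  show "super_relations \<theta> S q Q scale_endo (\<lambda>i. rep_right (gen i))"
    by (rule free_alg_hom.relations_of_hom[OF hom_rep_right])
      (use relators_I in \<open>auto simp: rep_right_def rep_eq_0_iff intro!: K_tensor(2) free_alg_one\<close>)
  fix i j assume ij: "i \<in> {1..\<theta>}" "j \<in> {1..\<theta>}"
  have "rep_right (gen i) * rep_left (gen j) = rep (braided_mult Q (free_tensor 1 (gen i)) (free_tensor (gen j) 1))"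
    unfolding rep_left_def rep_right_def
    by (intro rep_mult[symmetric] free_sq_tensor free_alg_one free_alg_gen ij)
  then show "rep_right (gen i) * rep_left (gen j) = scale_endo (Q i j) (rep_left (gen j) * rep_right (gen i))"
    by (simp only: braided_mult_gen rep_scale rep_tensor[OF free_alg_gen[OF ij(2)] free_alg_gen[OF ij(1)]])
qed

lemma coproduct_I: "x \<in> I \<Longrightarrow> free_coproduct Q x \<in> K"
  unfolding rep_eq_0_iff[symmetric] rep_coproduct_def[symmetric]
  by (rule free_alg_hom.hom_rel_ideal[OF hom_rep_coproduct free_alg_hom.hom_relators[OF hom_rep_coproduct]])
    (simp_all add: rep_coproduct_gen braided_pair.relations_add[OF braided_pair_rep])

lemma coproduct_root_power:
  assumes jk: "1 \<le> j" "j \<le> k" "k \<le> \<theta>" and even: "even (card (S \<inter> {j..k}))"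
    and q: "is_root_of_unity_of_order q N" and N: "2 \<le> N"
  shows "free_coproduct Q (root_word Q j k ^ N)
    - (free_tensor (root_word Q j k ^ N) 1 + free_tensor 1 (root_word Q j k ^ N)
      + (\<Sum>l\<in>{l. j \<le> l \<and> l < k \<and> even (card (S \<inter> {j..l}))}.
        scale ((1 - qtilde Q l (Suc l)) ^ N * word_chi Q (interval (Suc l) k) (interval j l) ^ (N * (N - 1) div 2))
          (free_tensor (root_word Q j l ^ N) (root_word Q (Suc l) k ^ N)))) \<in> K" (is "?x - (?y + ?z + sum ?f ?L) \<in> K")
proof -
  interpret A: free_alg_hom \<theta> S q Q scale_endo rep_left by (rule hom_rep_left)
  interpret B: free_alg_hom \<theta> S q Q scale_endo rep_right by (rule hom_rep_right)
  interpret D: free_alg_hom \<theta> S q Q scale_endo rep_coproduct by (rule hom_rep_coproduct)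
  \<comment> \<open>The exponent is written as a successor because \<open>hom_power\<close> stays
    away from exponent 0, where the image of 1 would intervene.\<close>
  obtain n where n: "N = Suc n" using N by (cases N) auto
  note rw = free_alg_root_word
  have L: "rep (?f l) = scale_endo ((1 - qtilde Q l (Suc l)) ^ N * word_chi Q (interval (Suc l) k) (interval j l) ^ (N * (N - 1) div 2))
      (A.rootv (\<lambda>i. rep_left (gen i)) j l ^ N * A.rootv (\<lambda>i. rep_right (gen i)) (Suc l) k ^ N)" if "l \<in> ?L" for l
    using that jk unfolding n
    by (simp add: rep_scale rep_tensor free_alg_pow rw A.hom_power B.hom_power A.hom_root_word B.hom_root_word
        del: upt_Suc power_Suc)
  have S: "rep (sum f M) = (\<Sum>l\<in>M. rep (f l))" if "finite M" for f and M :: "nat set"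
    using that by (induction M) (auto simp: rep_add rep_eq_0_iff K_zero)
  have "rep ?x = A.rootv (\<lambda>i. rep_left (gen i) + rep_right (gen i)) j k ^ N"
    unfolding n using jk
    by (simp only: rep_coproduct_def[symmetric] D.hom_power rw D.hom_root_word rep_coproduct_gen)
  also have "\<dots> = A.rootv (\<lambda>i. rep_left (gen i)) j k ^ N + A.rootv (\<lambda>i. rep_right (gen i)) j k ^ N
    + (\<Sum>l\<in>?L. scale_endo ((1 - qtilde Q l (Suc l)) ^ N * word_chi Q (interval (Suc l) k) (interval j l) ^ (N * (N - 1) div 2))
      (A.rootv (\<lambda>i. rep_left (gen i)) j l ^ N * A.rootv (\<lambda>i. rep_right (gen i)) (Suc l) k ^ N))"
    by (rule braided_pair.rootv_add_power[OF braided_pair_rep assms])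
  also have "A.rootv (\<lambda>i. rep_left (gen i)) j k ^ N = rep ?y"
    unfolding n using jk by (simp only: rep_left_def[symmetric] A.hom_power rw A.hom_root_word)
  also have "A.rootv (\<lambda>i. rep_right (gen i)) j k ^ N = rep ?z"
    unfolding n using jk by (simp only: rep_right_def[symmetric] B.hom_power rw B.hom_root_word)
  also have "(\<Sum>l\<in>?L. scale_endo ((1 - qtilde Q l (Suc l)) ^ N * word_chi Q (interval (Suc l) k) (interval j l) ^ (N * (N - 1) div 2))
      (A.rootv (\<lambda>i. rep_left (gen i)) j l ^ N * A.rootv (\<lambda>i. rep_right (gen i)) (Suc l) k ^ N)) = (\<Sum>l\<in>?L. rep (?f l))"
    by (rule sum.cong[OF refl]) (rule L[symmetric])
  also have "\<dots> = rep (sum ?f ?L)" by (rule S[symmetric]) simp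
  also have "rep ?y + rep ?z + \<dots> = rep (?y + ?z + sum ?f ?L)" by (simp only: rep_add)
  finally have "rep ?x = rep (?y + ?z + sum ?f ?L)" .
  then have "rep (?x - (?y + ?z + sum ?f ?L)) = 0"
    using rep_add[of "?x - (?y + ?z + sum ?f ?L)" "?y + ?z + sum ?f ?L"] by (simp only: diff_add_cancel) simp
  then show ?thesis by (simp only: rep_eq_0_iff)
qed

end

section \<open>The coproduct of powers of root vectors\<close>

lemma induced_coset:
  assumes "x \<in> X" "\<And>x'. x' \<in> X \<Longrightarrow> f x' = f x"
  shows "induced f X = f x"
proof -
  have "f ` X = (\<lambda>_. f x) ` X"
    by (rule image_cong[OF refl]) (rule assms(2))
  then have "f ` X = {f x}" using assms(1) by auto
  then show ?thesis by (simp add: induced_def)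
qed

section \<open>Arithmetic of cosets\<close>

lemma alg_quot_simps [simp]:
  "carrier (alg_quot A J) = carrier (A Quot J)" "mult (alg_quot A J) = mult (A Quot J)"
  "one (alg_quot A J) = one (A Quot J)" "zero (alg_quot A J) = zero (A Quot J)" "add (alg_quot A J) = add (A Quot J)"
  "smult (alg_quot A J) = (\<lambda>c. induced (\<lambda>x. J +>\<^bsub>A\<^esub> (c \<odot>\<^bsub>A\<^esub> x)))"
  by (simp_all add: alg_quot_def)

lemma abelian_monoid_alg_quot:
  assumes "ideal J A"
  shows "abelian_monoid (alg_quot A J)"
proof -
  interpret R: ring "A Quot J" by (rule ideal.quotient_is_ring[OF assms])
  show ?thesis
    by (rule abelian_monoidI) (simp_all add: R.a_assoc, rule R.a_comm)
qed

lemma alg_quot_mult: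
  "ideal J A \<Longrightarrow> x \<in> carrier A \<Longrightarrow> y \<in> carrier A \<Longrightarrow>
    (J +>\<^bsub>A\<^esub> x) \<otimes>\<^bsub>alg_quot A J\<^esub> (J +>\<^bsub>A\<^esub> y) = J +>\<^bsub>A\<^esub> (x \<otimes>\<^bsub>A\<^esub> y)"
  using ideal.rcoset_mult_add[of J A x y] by (simp add: FactRing_def)

lemma alg_quot_add:
  "ideal J A \<Longrightarrow> x \<in> carrier A \<Longrightarrow> y \<in> carrier A \<Longrightarrow>
    (J +>\<^bsub>A\<^esub> x) \<oplus>\<^bsub>alg_quot A J\<^esub> (J +>\<^bsub>A\<^esub> y) = J +>\<^bsub>A\<^esub> (x \<oplus>\<^bsub>A\<^esub> y)"
  using ideal.a_rcos_sum[of J A x y] by (simp add: FactRing_def)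

lemma alg_quot_one: "\<one>\<^bsub>alg_quot A J\<^esub> = J +>\<^bsub>A\<^esub> \<one>\<^bsub>A\<^esub>"
  by (simp add: FactRing_def)

lemma alg_quot_coset_carrier: "x \<in> carrier A \<Longrightarrow> J +>\<^bsub>A\<^esub> x \<in> carrier (alg_quot A J)"
  by (auto simp: FactRing_def A_RCOSETS_def')

lemma alg_quot_pow:
  assumes "ideal J (free_alg \<theta>)" "x \<in> carrier (free_alg \<theta>)"
  shows "(J +>\<^bsub>free_alg \<theta>\<^esub> x) [^]\<^bsub>alg_quot (free_alg \<theta>) J\<^esub> (n :: nat) = J +>\<^bsub>free_alg \<theta>\<^esub> (x ^ n)"
proof (induction n)
  case 0
  then show ?case by (simp add: nat_pow_def alg_quot_one[unfolded alg_quot_simps])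
next
  case (Suc n)
  then show ?case
    using alg_quot_mult[OF assms(1) free_alg_pow[OF assms(2)] assms(2), of n]
    by (simp add: nat_pow_def power_commutes)
qed

lemma coset_eqI:
  fixes x y :: "'b::ab_group_add"
  assumes "add A = (+)" "0 \<in> J" "\<And>x y. x \<in> J \<Longrightarrow> y \<in> J \<Longrightarrow> x + y \<in> J" "\<And>x. x \<in> J \<Longrightarrow> - x \<in> J"
    and "x - y \<in> J"
  shows "J +>\<^bsub>A\<^esub> x = J +>\<^bsub>A\<^esub> y"
proof -
  have *: "J +>\<^bsub>A\<^esub> x \<subseteq> J +>\<^bsub>A\<^esub> y" if d: "x - y \<in> J" for x y
  proof
    fix z assume "z \<in> J +>\<^bsub>A\<^esub> x"
    then obtain h where "h \<in> J" "z = h + x" using assms(1) by (auto simp: a_r_coset_def')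
    then have "h + (x - y) \<in> J" "z = (h + (x - y)) + y" using assms(3)[OF _ d] by simp_all
    then obtain h' where "h' \<in> J" "z = h' + y" by blast
    then show "z \<in> J +>\<^bsub>A\<^esub> y" using assms(1) unfolding a_r_coset_def' by auto
  qed
  have "y - x \<in> J" using assms(4)[OF assms(5)] by simp
  then show ?thesis using *[OF assms(5)] *[of y x] by blast
qed

lemma coset_memD: "add A = (+) \<Longrightarrow> z \<in> J +>\<^bsub>A\<^esub> x \<Longrightarrow> z - x \<in> J" for x z :: "'b::ab_group_add"
  by (auto simp: a_r_coset_def')

lemma coset_self: "add A = (+) \<Longrightarrow> 0 \<in> J \<Longrightarrow> x \<in> J +>\<^bsub>A\<^esub> x" for x :: "'b::ab_group_add"
  by (auto simp: a_r_coset_def' intro!: bexI[of _ 0])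

lemma parity_pos_root:
  assumes "finite S"
  shows "parity S (pos_root j k) = int (card (S \<inter> {j..k})) mod 2"
proof -
  have "Poly_Mapping.lookup (pos_root j k) i = (if i \<in> {j..k} then 1 else 0)" for i
    by (simp add: pos_root_def simple_root_def lookup_sum lookup_single when_def)
  then show ?thesis
    using assms by (simp add: parity_def sum.If_cases Int_def flip: Collect_conj_eq)
qed

lemma even_roots_iff:
  assumes "finite S" "1 \<le> j" "j \<le> k" "k \<le> \<theta>"
  shows "pos_root j k \<in> even_roots \<theta> S \<longleftrightarrow> even (card (S \<inter> {j..k}))"
proof -
  have "pos_root j k \<in> even_roots \<theta> S \<longleftrightarrow> parity S (pos_root j k) = 0"
    using assms unfolding even_roots_def by auto
  then show ?thesis
    unfolding parity_pos_root[OF assms(1)] by (simp add: even_iff_mod_2_eq_zero flip: of_nat_mod) presburger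
qed

section \<open>The operations of U and U (x) U on representatives\<close>

context super_data
begin

lemma K_coset_eq: "x - y \<in> K \<Longrightarrow> K +>\<^bsub>free_sq \<theta> Q\<^esub> x = K +>\<^bsub>free_sq \<theta> Q\<^esub> y"
  by (rule coset_eqI) (auto simp: K_zero K_add K_minus)

lemma root_vector_eq: "root_vector \<theta> S Q j k = I +>\<^bsub>free_alg \<theta>\<^esub> root_word Q j k"
  by (simp add: root_vector_def root_word_def)

lemma coproduct_coset:
  "coproduct \<theta> S Q (I +>\<^bsub>free_alg \<theta>\<^esub> x) = K +>\<^bsub>free_sq \<theta> Q\<^esub> free_coproduct Q x"
  unfolding coproduct_def
proof (rule induced_coset)
  fix x' assume "x' \<in> I +>\<^bsub>free_alg \<theta>\<^esub> x"
  then have "x' - x \<in> I" by (rule coset_memD[rotated]) simp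
  then show "K +>\<^bsub>free_sq \<theta> Q\<^esub> free_coproduct Q x' = K +>\<^bsub>free_sq \<theta> Q\<^esub> free_coproduct Q x"
    by (intro K_coset_eq) (simp add: coproduct_I flip: free_module.linear_diff[OF lin_coproduct])
qed (simp add: coset_self I_zero)

lemma tensor_coset:
  assumes "x \<in> carrier (free_alg \<theta>)" "y \<in> carrier (free_alg \<theta>)"
  shows "tensor \<theta> S Q (I +>\<^bsub>free_alg \<theta>\<^esub> x) (I +>\<^bsub>free_alg \<theta>\<^esub> y) = K +>\<^bsub>free_sq \<theta> Q\<^esub> free_tensor x y"
proof -
  have "induced (\<lambda>(x, y). K +>\<^bsub>free_sq \<theta> Q\<^esub> free_tensor x y) ((I +>\<^bsub>free_alg \<theta>\<^esub> x) \<times> (I +>\<^bsub>free_alg \<theta>\<^esub> y))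
    = (\<lambda>(x, y). K +>\<^bsub>free_sq \<theta> Q\<^esub> free_tensor x y) (x, y)"
  proof (rule induced_coset)
    fix p assume p: "p \<in> (I +>\<^bsub>free_alg \<theta>\<^esub> x) \<times> (I +>\<^bsub>free_alg \<theta>\<^esub> y)"
    obtain x' y' where p': "p = (x', y')" by (cases p)
    then have I: "x' - x \<in> I" "y' - y \<in> I"
      using p coset_memD[of "free_alg \<theta>" x' I x] coset_memD[of "free_alg \<theta>" y' I y] by auto
    \<comment> \<open>The difference of x' (x) y' and x (x) y is (x' - x) (x) y' + x (x) (y' - y);
      the first summand requires \<open>y'\<close> to lie in the carrier.\<close>
    have "y' = (y' - y) + y" by simp
    then have "y' \<in> carrier (free_alg \<theta>)" using free_alg_closed(1)[OF I_carrier[OF I(2)] assms(2)] by simp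
    then have "free_tensor (x' - x) y' + free_tensor x (y' - y) \<in> K"
      using I assms by (intro K_add K_tensor)
    then have "free_tensor x' y' - free_tensor x y \<in> K"
      by (simp add: free_module.linear_diff[OF lin_tensor_left] free_module.linear_diff[OF lin_tensor_right])
    then show "(\<lambda>(x, y). K +>\<^bsub>free_sq \<theta> Q\<^esub> free_tensor x y) p = (\<lambda>(x, y). K +>\<^bsub>free_sq \<theta> Q\<^esub> free_tensor x y) (x, y)"
      unfolding p' by (simp add: K_coset_eq)
  qed (simp add: coset_self I_zero)
  then show ?thesis by (simp add: tensor_def)
qed

lemma smult_coset:
  "c \<odot>\<^bsub>preNichols_sq \<theta> S Q\<^esub> (K +>\<^bsub>free_sq \<theta> Q\<^esub> z) = K +>\<^bsub>free_sq \<theta> Q\<^esub> scale c z"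
proof -
  have "induced (\<lambda>z. K +>\<^bsub>free_sq \<theta> Q\<^esub> scale c z) (K +>\<^bsub>free_sq \<theta> Q\<^esub> z) = K +>\<^bsub>free_sq \<theta> Q\<^esub> scale c z"
  proof (rule induced_coset)
    fix z' assume "z' \<in> K +>\<^bsub>free_sq \<theta> Q\<^esub> z"
    then have "z' - z \<in> K" by (rule coset_memD[rotated]) simp
    then show "K +>\<^bsub>free_sq \<theta> Q\<^esub> scale c z' = K +>\<^bsub>free_sq \<theta> Q\<^esub> scale c z"
      by (intro K_coset_eq)
        (simp add: free_module.subspace_scale[OF subspace_K] flip: free_module.scale_right_diff_distrib)
  qed (simp add: coset_self K_zero)
  then show ?thesis by (simp add: preNichols_sq_def)
qed

text \<open>Membership of the partial sums in the carrier is carried along in the induction, because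
  coset addition is computed on representatives from the carrier.\<close>

lemma finsum_coset:
  assumes "finite A" "\<And>l. l \<in> A \<Longrightarrow> f l = K +>\<^bsub>free_sq \<theta> Q\<^esub> g l" "\<And>l. l \<in> A \<Longrightarrow> g l \<in> carrier (free_sq \<theta> Q)"
  shows "finsum (preNichols_sq \<theta> S Q) f A = K +>\<^bsub>free_sq \<theta> Q\<^esub> sum g A" and "sum g A \<in> carrier (free_sq \<theta> Q)"
proof -
  interpret UU: abelian_monoid "preNichols_sq \<theta> S Q"
    unfolding preNichols_sq_def by (rule abelian_monoid_alg_quot[OF ideal_K])
  have "finsum (preNichols_sq \<theta> S Q) f A = K +>\<^bsub>free_sq \<theta> Q\<^esub> sum g A \<and> sum g A \<in> carrier (free_sq \<theta> Q)"
    using assms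
  proof (induction A rule: finite_induct)
    case empty
    have "K +>\<^bsub>free_sq \<theta> Q\<^esub> 0 = K" by (auto simp: a_r_coset_def')
    moreover have "\<zero>\<^bsub>preNichols_sq \<theta> S Q\<^esub> = K" by (simp add: preNichols_sq_def FactRing_def)
    ultimately show ?case by (simp only: UU.finsum_empty sum.empty free_sq_closed(5) simp_thms)
  next
    case (insert l A)
    have "f \<in> insert l A \<rightarrow> carrier (preNichols_sq \<theta> S Q)"
    proof
      fix i assume i: "i \<in> insert l A"
      show "f i \<in> carrier (preNichols_sq \<theta> S Q)"
        unfolding preNichols_sq_def insert.prems(1)[OF i]
        by (rule alg_quot_coset_carrier) (rule insert.prems(2)[OF i])
    qed
    then have "finsum (preNichols_sq \<theta> S Q) f (insert l A) = f l \<oplus>\<^bsub>preNichols_sq \<theta> S Q\<^esub> finsum (preNichols_sq \<theta> S Q) f A"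
      using insert by (intro UU.finsum_insert) auto
    moreover have "finsum (preNichols_sq \<theta> S Q) f A = K +>\<^bsub>free_sq \<theta> Q\<^esub> sum g A" "sum g A \<in> carrier (free_sq \<theta> Q)"
      using insert.IH insert.prems by auto
    moreover have "f l = K +>\<^bsub>free_sq \<theta> Q\<^esub> g l" "g l \<in> carrier (free_sq \<theta> Q)"
      using insert.prems by auto
    ultimately show ?case
      using alg_quot_add[OF ideal_K, of "g l" "sum g A"] insert.hyps free_sq_closed(1)[of "g l" \<theta> Q "sum g A"]
      by (simp only: preNichols_sq_def free_sq_simps sum.insert simp_thms)
  qed
  then show "finsum (preNichols_sq \<theta> S Q) f A = K +>\<^bsub>free_sq \<theta> Q\<^esub> sum g A" "sum g A \<in> carrier (free_sq \<theta> Q)"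
    by auto
qed

lemma coproduct_root_vector_power:
  assumes "N \<ge> 2" and "is_root_of_unity_of_order q N" and jk: "1 \<le> j" "j \<le> k" "k \<le> \<theta>"
    and "pos_root j k \<in> even_roots \<theta> S"
  defines "U \<equiv> preNichols \<theta> S Q" and "UU \<equiv> preNichols_sq \<theta> S Q" and "E \<equiv> root_vector \<theta> S Q"
    and "tens \<equiv> tensor \<theta> S Q"
  shows "coproduct \<theta> S Q (E j k [^]\<^bsub>U\<^esub> N) =
    tens (E j k [^]\<^bsub>U\<^esub> N) \<one>\<^bsub>U\<^esub> \<oplus>\<^bsub>UU\<^esub> tens \<one>\<^bsub>U\<^esub> (E j k [^]\<^bsub>U\<^esub> N) \<oplus>\<^bsub>UU\<^esub>
    (\<Oplus>\<^bsub>UU\<^esub>l\<in>{l. j \<le> l \<and> l < k \<and> pos_root j l \<in> even_roots \<theta> S}.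
       ((1 - qtilde Q l (l + 1)) ^ N *
         chi Q (pos_root (l + 1) k) (pos_root j l) ^ (N * (N - 1) div 2)) \<odot>\<^bsub>UU\<^esub>
       tens (E j l [^]\<^bsub>U\<^esub> N) (E (l + 1) k [^]\<^bsub>U\<^esub> N))"
proof -
  let ?r = "\<lambda>j k. root_word Q j k ^ N" and ?k = "\<lambda>z. K +>\<^bsub>free_sq \<theta> Q\<^esub> z"
  let ?c = "\<lambda>l. (1 - qtilde Q l (Suc l)) ^ N * word_chi Q (interval (Suc l) k) (interval j l) ^ (N * (N - 1) div 2)"
  let ?L = "{l. j \<le> l \<and> l < k \<and> even (card (S \<inter> {j..l}))}"
  have rc: "?r a b \<in> carrier (free_alg \<theta>)" if "1 \<le> a" "a \<le> b" "b \<le> \<theta>" for a b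
    using that by (intro free_alg_pow free_alg_root_word)
  have E: "E a b [^]\<^bsub>U\<^esub> N = I +>\<^bsub>free_alg \<theta>\<^esub> ?r a b" if "1 \<le> a" "a \<le> b" "b \<le> \<theta>" for a b
    unfolding E_def U_def root_vector_eq preNichols_def
    using that by (intro alg_quot_pow ideal_I free_alg_root_word)
  have one: "\<one>\<^bsub>U\<^esub> = I +>\<^bsub>free_alg \<theta>\<^esub> 1"
    unfolding U_def preNichols_def alg_quot_one by simp
  have tens: "tens (E a b [^]\<^bsub>U\<^esub> N) (E c d [^]\<^bsub>U\<^esub> N) = ?k (free_tensor (?r a b) (?r c d))"
    if "1 \<le> a" "a \<le> b" "b \<le> \<theta>" "1 \<le> c" "c \<le> d" "d \<le> \<theta>" for a b c d
    unfolding tens_def E[OF that(1-3)] E[OF that(4-6)] by (intro tensor_coset rc that)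
  have t1: "tens (E j k [^]\<^bsub>U\<^esub> N) \<one>\<^bsub>U\<^esub> = ?k (free_tensor (?r j k) 1)"
    and t2: "tens \<one>\<^bsub>U\<^esub> (E j k [^]\<^bsub>U\<^esub> N) = ?k (free_tensor 1 (?r j k))"
    unfolding tens_def E[OF jk] one by (intro tensor_coset rc jk free_alg_one)+
  have L: "{l. j \<le> l \<and> l < k \<and> pos_root j l \<in> even_roots \<theta> S} = ?L"
    using even_roots_iff[OF finite_S, of j _ \<theta>] jk by auto
  let ?t = "\<lambda>l. ?c l \<odot>\<^bsub>UU\<^esub> tens (E j l [^]\<^bsub>U\<^esub> N) (E (Suc l) k [^]\<^bsub>U\<^esub> N)"
  let ?g = "\<lambda>l. scale (?c l) (free_tensor (?r j l) (?r (Suc l) k))"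
  have fs: "finsum UU ?t ?L = ?k (sum ?g ?L)" and gs: "sum ?g ?L \<in> carrier (free_sq \<theta> Q)"
  proof -
    have t: "?t l = ?k (?g l)" and g: "?g l \<in> carrier (free_sq \<theta> Q)" if "l \<in> ?L" for l
    proof -
      have "tens (E j l [^]\<^bsub>U\<^esub> N) (E (Suc l) k [^]\<^bsub>U\<^esub> N) = ?k (free_tensor (?r j l) (?r (Suc l) k))"
        using that jk by (intro tens) auto
      then show "?t l = ?k (?g l)" unfolding UU_def by (simp only: smult_coset)
      show "?g l \<in> carrier (free_sq \<theta> Q)"
        using that jk by (intro free_sq_closed(4) free_sq_tensor rc) auto
    qed
    show "finsum UU ?t ?L = ?k (sum ?g ?L)" "sum ?g ?L \<in> carrier (free_sq \<theta> Q)"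
      unfolding UU_def[symmetric] using finsum_coset[of ?L ?t ?g, folded UU_def] t g by auto
  qed
  have add: "?k x \<oplus>\<^bsub>UU\<^esub> ?k y = ?k (x + y)" if "x \<in> carrier (free_sq \<theta> Q)" "y \<in> carrier (free_sq \<theta> Q)" for x y
    using alg_quot_add[OF ideal_K that] by (simp only: UU_def preNichols_sq_def free_sq_simps)
  have c: "free_tensor (?r j k) 1 \<in> carrier (free_sq \<theta> Q)" "free_tensor 1 (?r j k) \<in> carrier (free_sq \<theta> Q)"
    by (intro free_sq_tensor rc jk free_alg_one)+
  have "coproduct \<theta> S Q (E j k [^]\<^bsub>U\<^esub> N) = ?k (free_coproduct Q (?r j k))"
    unfolding E[OF jk] by (rule coproduct_coset)
  also have "\<dots> = ?k (free_tensor (?r j k) 1 + free_tensor 1 (?r j k) + sum ?g ?L)"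
    using assms(1,2,6) even_roots_iff[OF finite_S jk]
    by (intro K_coset_eq coproduct_root_power jk) auto
  also have "\<dots> = tens (E j k [^]\<^bsub>U\<^esub> N) \<one>\<^bsub>U\<^esub> \<oplus>\<^bsub>UU\<^esub> tens \<one>\<^bsub>U\<^esub> (E j k [^]\<^bsub>U\<^esub> N) \<oplus>\<^bsub>UU\<^esub> finsum UU ?t ?L"
    unfolding t1 t2 fs add[OF c] by (rule add[symmetric]) (intro free_sq_closed(1) c gs)+
  finally show ?thesis
    unfolding L chi_pos_root Suc_eq_plus1[symmetric] .
qed

end

text \<open>The bicharacter is taken with the degree of the right tensor factor first, as the
  product rule of \<open>braided_mult\<close> dictates. The displayed English formula has the
  opposite order; the two values of chi multiply to q~_{l,l+1}, so they cannot be interchanged in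
  general.\<close>

theorem proposition5p2:
  fixes q :: "'k::{alg_closed_field, field_char_0}"
    and Q :: "nat \<Rightarrow> nat \<Rightarrow> 'k"
    and \<theta> N j k :: nat
    and S :: "nat set"
  defines "U \<equiv> preNichols \<theta> S Q"
    and "UU \<equiv> preNichols_sq \<theta> S Q"
    and "E \<equiv> root_vector \<theta> S Q"
    and "tens \<equiv> tensor \<theta> S Q"
  assumes "\<theta> \<ge> 2"
    and "N \<ge> 3"
    and "is_root_of_unity_of_order q N"
    and "super_type_A \<theta> S q Q"
    and "1 \<le> j" and "j \<le> k" and "k \<le> \<theta>"
    and "pos_root j k \<in> even_roots \<theta> S"
  shows "coproduct \<theta> S Q (E j k [^]\<^bsub>U\<^esub> N) =
    tens (E j k [^]\<^bsub>U\<^esub> N) \<one>\<^bsub>U\<^esub> \<oplus>\<^bsub>UU\<^esub> tens \<one>\<^bsub>U\<^esub> (E j k [^]\<^bsub>U\<^esub> N) \<oplus>\<^bsub>UU\<^esub>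
    (\<Oplus>\<^bsub>UU\<^esub>l\<in>{l. j \<le> l \<and> l < k \<and> pos_root j l \<in> even_roots \<theta> S}.
       ((1 - qtilde Q l (l + 1)) ^ N *
         chi Q (pos_root (l + 1) k) (pos_root j l) ^ (N * (N - 1) div 2)) \<odot>\<^bsub>UU\<^esub>
       tens (E j l [^]\<^bsub>U\<^esub> N) (E (l + 1) k [^]\<^bsub>U\<^esub> N))"
proof -
  have "q\<^sup>2 \<noteq> 1" using assms by (simp add: is_root_of_unity_of_order_def)
  then interpret super_data \<theta> S q Q using assms by unfold_locales
  show ?thesis
    unfolding U_def UU_def E_def tens_def
    by (rule coproduct_root_vector_power) (use assms in auto)
qed

end
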